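(* Consider the FedPBC algorithm described in the context, run with a constant learning rate $\eta>0$ and $s\ge 1$ local steps per round. Suppose Assumptions (A1)–(A4) of the context hold and that $L\ge 1$. If $$\eta \le \frac{1-\sqrt{\rho}}{108\, L^2 s^3 (\beta^2+1)(1+\kappa^2 L^2)},$$ then for every $T\ge 1$, $$\frac{1}{T}\sum_{t=0}^{T-1}\mathbb{E}\left[\|\nabla F(\bar{x}^t)\|^2\right] \le \frac{6\,(F(\bar{x}^0)-F^\star)}{\eta s T} + 54\,\eta s L\left(\kappa^2L^2+1+\frac{1}{1-\sqrt{\rho}}\right)(\sigma^2+\zeta^2).$$
   Context: Federated learning problem: $m$ clients and a parameter server minimize $F(x)=\frac1m\sum_{i=1}^m F_i(x)$ over $x\in\mathbb{R}^d$, where $F_i(x)=\mathbb{E}_{\xi\sim\mathcal{D}_i}[\ell_i(x;\xi)]$ (losses may be non-convex). FedPBC algorithm: fix $s\ge1$, learning rate $\eta>0$ and initial point $x^0$; every client starts with $x_i^0=x^0$. In each round $t=0,1,\dots$: every client $i\in[m]$ sets $x_i^{(t,0)}=x_i^t$ and performs $x_i^{(t,k+1)}=x_i^{(t,k)}-\eta\nabla\ell_i(x_i^{(t,k)};\xi_i^t)$ for $k=0,\dots,s-1$, where $\xi_i^t$ is a random sample drawn in round $t$, and sets $x_i^{t\star}=x_i^{(t,s)}$. A random set $\mathcal{A}^t\subseteq[m]$ consists of the clients whose uplink to the server is active in round $t$; client $i$'s uplink is active with probability $p_i^t$ (unknown and possibly time-varying), where $p_i^t\ge c$ for all $i,t$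 for some constant $c\in(0,1]$. If $\mathcal{A}^t\neq\emptyset$ the server sets $x^{t+1}=\frac{1}{|\mathcal{A}^t|}\sum_{i\in\mathcal{A}^t}x_i^{t\star}$, otherwise $x^{t+1}=x^t$. Each client $i\in\mathcal{A}^t$ sets $x_i^{t+1}=x^{t+1}$, and each client $i\notin\mathcal{A}^t$ keeps $x_i^{t+1}=x_i^{t\star}$. Let $\bar x^t=\frac1m\sum_{i=1}^m x_i^t$ and let $\mathcal{F}^t$ be the sigma-algebra generated by all randomness up to round $t$. Mixing matrix: $W^{(t)}\in\mathbb{R}^{m\times m}$ with $W^{(t)}_{ij}=1/|\mathcal{A}^t|$ if $i,j\in\mathcal{A}^t$, $W^{(t)}_{ii}=1$ if $i\notin\mathcal{A}^t$, and $W^{(t)}_{ij}=0$ otherwise. Let $\rho=\sup_t \lambda_2\big(\mathbb{E}[(W^{(t)})^2]\big)$, where $\lambda_2$ denotes the second largest eigenvalue. Constant $\kappa$: with $L_i$ as in (A1), $\kappa=\max_i\frac{(1+\eta L_i)^s-1-s\eta L_i}{\binom{s}{2}(\eta L_i)^2}$ when $s\ge2$, and $\kappa=0$ when $s=1$. Assumptions. (A1) For each $i$ and every sample $\xi$, $x\mapsto\nabla\ell_i(x;\xi)$ is $L_i$-Lipschitz; $L:=\max_i L_i$. (A2) $\mathbb{E}[\nabla\ell_i(x_i^t;\xi_i^t)\mid\mathcal{F}^t]=\nabla F_i(x_i^t)$ and $\mathbb{E}[\|\nabla\ell_i(x;\xi_i^t)-\nabla F_i(x)\|^2\mid\mathcal{F}^t]\le\sigma^2$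 for all $x$ and $i$. (A3) There is $F^\star\in\mathbb{R}$ with $F(x)\ge F^\star$ for all $x$. (A4) For some $\beta,\zeta\ge0$ and all $x$: $\frac1m\sum_{i=1}^m\|\nabla F_i(x)-\nabla F(x)\|^2\le\beta^2\|\nabla F(x)\|^2+\zeta^2$.
   Formalization: The active set A^t of each round is assumed independent of all randomness of earlier rounds and of the samples of round t (without this, e.g. with A^t=A^0 for all t, the bound can fail), and m≥2 is assumed so that the second largest eigenvalue exists. *)

theory Defs
  imports "HOL-Probability.Probability" "Jordan_Normal_Form.Char_Poly"
begin

text \<open>Local phase of client i: s steps of SGD with the (single) sample xi drawn in the round,
  i.e. x^(t,k+1) = x^(t,k) - eta * grad l_i(x^(t,k); xi).\<close>
definition local_sgd :: "real \<Rightarrow> nat \<Rightarrow> ('a::real_vector \<Rightarrow> 'a) \<Rightarrow> 'a \<Rightarrow> 'a" where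
  "local_sgd eta s g x = ((\<lambda>y. y - eta *\<^sub>R g y) ^^ s) x"

text \<open>Deterministic trajectory for one realisation of the randomness:
  gl i x z = grad l_i(x; z), xi i t = sample of client i in round t, A t = active set in round t.
  Returns (server model x^t, client models i \<mapsto> x_i^t).\<close>
primrec fedpbc ::
  "real \<Rightarrow> nat \<Rightarrow> (nat \<Rightarrow> 'a::real_vector \<Rightarrow> 's \<Rightarrow> 'a) \<Rightarrow> (nat \<Rightarrow> nat \<Rightarrow> 's) \<Rightarrow> (nat \<Rightarrow> nat set)
    \<Rightarrow> 'a \<Rightarrow> nat \<Rightarrow> 'a \<times> (nat \<Rightarrow> 'a)" where
  "fedpbc eta s gl xi A x0 0 = (x0, (\<lambda>i. x0))"
| "fedpbc eta s gl xi A x0 (Suc t) =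
     (let (srv, cl) = fedpbc eta s gl xi A x0 t;
          xstar = (\<lambda>i. local_sgd eta s (\<lambda>y. gl i y (xi i t)) (cl i));
          srv' = (if A t = {} then srv else (1 / real (card (A t))) *\<^sub>R (\<Sum>i\<in>A t. xstar i))
      in (srv', (\<lambda>i. if i \<in> A t then srv' else xstar i)))"

definition client_iter ::
  "real \<Rightarrow> nat \<Rightarrow> (nat \<Rightarrow> 'a::real_vector \<Rightarrow> 's \<Rightarrow> 'a) \<Rightarrow> (nat \<Rightarrow> nat \<Rightarrow> 'w \<Rightarrow> 's) \<Rightarrow> (nat \<Rightarrow> 'w \<Rightarrow> nat set)
    \<Rightarrow> 'a \<Rightarrow> nat \<Rightarrow> nat \<Rightarrow> 'w \<Rightarrow> 'a" where
  "client_iter eta s gl xi A x0 i t \<omega> =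
     snd (fedpbc eta s gl (\<lambda>j r. xi j r \<omega>) (\<lambda>r. A r \<omega>) x0 t) i"

definition avg_iter ::
  "nat \<Rightarrow> real \<Rightarrow> nat \<Rightarrow> (nat \<Rightarrow> 'a::real_vector \<Rightarrow> 's \<Rightarrow> 'a) \<Rightarrow> (nat \<Rightarrow> nat \<Rightarrow> 'w \<Rightarrow> 's) \<Rightarrow> (nat \<Rightarrow> 'w \<Rightarrow> nat set)
    \<Rightarrow> 'a \<Rightarrow> nat \<Rightarrow> 'w \<Rightarrow> 'a" where
  "avg_iter m eta s gl xi A x0 t \<omega> = (1 / real m) *\<^sub>R (\<Sum>i<m. client_iter eta s gl xi A x0 i t \<omega>)"

definition hist_gens :: "'w measure \<Rightarrow> 's measure \<Rightarrow> nat \<Rightarrow> (nat \<Rightarrow> nat \<Rightarrow> 'w \<Rightarrow> 's) \<Rightarrow> (nat \<Rightarrow> 'w \<Rightarrow> nat set)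
    \<Rightarrow> nat \<Rightarrow> 'w set set" where
  "hist_gens M S m xi A t =
     {xi i r -` B \<inter> space M | i r B. i < m \<and> r < t \<and> B \<in> sets S}
     \<union> {A r -` B \<inter> space M | r B. r < t}"

definition filt :: "'w measure \<Rightarrow> 's measure \<Rightarrow> nat \<Rightarrow> (nat \<Rightarrow> nat \<Rightarrow> 'w \<Rightarrow> 's) \<Rightarrow> (nat \<Rightarrow> 'w \<Rightarrow> nat set)
    \<Rightarrow> nat \<Rightarrow> 'w measure" where
  "filt M S m xi A t = sigma (space M) (hist_gens M S m xi A t)"

definition filt_samples :: "'w measure \<Rightarrow> 's measure \<Rightarrow> nat \<Rightarrow> (nat \<Rightarrow> nat \<Rightarrow> 'w \<Rightarrow> 's) \<Rightarrow> (nat \<Rightarrow> 'w \<Rightarrow> nat set)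
    \<Rightarrow> nat \<Rightarrow> 'w measure" where
  "filt_samples M S m xi A t = sigma (space M)
     (hist_gens M S m xi A t \<union> {xi i t -` B \<inter> space M | i B. i < m \<and> B \<in> sets S})"

definition mixing :: "nat \<Rightarrow> nat set \<Rightarrow> real mat" where
  "mixing m Act = mat m m (\<lambda>(i,j).
      if i \<in> Act \<and> j \<in> Act then 1 / real (card Act)
      else if i = j \<and> i \<notin> Act then 1 else 0)"

definition exp_mixing_sq :: "'w measure \<Rightarrow> nat \<Rightarrow> ('w \<Rightarrow> nat set) \<Rightarrow> real mat" where
  "exp_mixing_sq M m At = mat m m (\<lambda>(i,j).
      \<integral>\<omega>. (mixing m (At \<omega>) * mixing m (At \<omega>)) $$ (i,j) \<partial>M)"

text \<open>Second largest eigenvalue (counted with multiplicity) of a real matrix whose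
  characteristic polynomial splits over the reals (e.g. a symmetric matrix).\<close>
definition lambda2 :: "real mat \<Rightarrow> real" where
  "lambda2 B = rev (sorted_list_of_multiset (proots (char_poly B))) ! 1"

definition rho_mix :: "'w measure \<Rightarrow> nat \<Rightarrow> (nat \<Rightarrow> 'w \<Rightarrow> nat set) \<Rightarrow> real" where
  "rho_mix M m A = (SUP t. lambda2 (exp_mixing_sq M m (A t)))"

definition kappa :: "nat \<Rightarrow> real \<Rightarrow> nat \<Rightarrow> (nat \<Rightarrow> real) \<Rightarrow> real" where
  "kappa m eta s Lc = (if s \<ge> 2 then
      Max ((\<lambda>i. ((1 + eta * Lc i) ^ s - 1 - real s * eta * Lc i) / (real (s choose 2) * (eta * Lc i)\<^sup>2)) ` {..<m})
    else 0)"

end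

theory Submission
  imports Defs
begin

text \<open>Since the mixing matrices are doubly stochastic, the average iterate moves by the average of the
  local updates, and each local update is \<open>-eta s\<close> times the stochastic gradient at the start of the
  round, up to a relative error of order \<open>kappa s eta L\<close>. The descent inequality for \<open>F\<close> at the average
  iterate therefore decreases \<open>E F\<close> by a multiple of \<open>eta s E|grad F|^2\<close>, up to the consensus error
  and the second moment of the gradients. The active set is independent of the samples of its round,
  so on sum-zero vectors mixing contracts the expected square by \<open>rho\<close>; this is the Rayleigh bound
  for the second eigenvalue of the doubly stochastic matrix \<open>E[W^2]\<close>. Hence the consensus error obeys a
  linear recursion with factor \<open>sqrt rho\<close>, driven by the second moment of the gradients. Summing the
  recursions over the rounds, the step size condition absorbs all terms but the noise.\<close>

section \<open>The second eigenvalue of a doubly stochastic matrix\<close>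

text \<open>\<open>lambda2\<close> is read off a sorted multiset of characteristic roots, so one
  copy of the eigenvalue 1 has to be removed with multiplicities respected: a change of basis splits
  the factor X - 1 off the characteristic polynomial. Diagonalisation is avoided; it suffices that
  the maximal Rayleigh quotient on sum-zero vectors is a root of the remaining factor. The local
  phase reuses a single sample, hence along each path it is a deterministic gradient iteration, and
  its deviation from one step of length \<open>eta * s\<close> is controlled by the gradient at its
  start; \<open>kappa\<close> normalises that bound. The variance bound is given at fixed points but
  needed at random iterates, and every expectation that is split must first be known to exist; this
  is why square integrability is propagated along the rounds. The recursions are circular: the
  gradient moments are bounded by the consensus error and conversely. The factor 108 makes the loop
  gain small. After absorption, more than 1/6 of the descent coefficient 7/16 survives, and each
  noise coefficient is at most 9; multiplying by 6 gives the constants 6 and 54.\<close>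

lemma char_poly_row_stochastic:
  fixes b :: "nat \<Rightarrow> nat \<Rightarrow> real"
  assumes rows: "\<And>i. i < Suc k \<Longrightarrow> (\<Sum>j<Suc k. b i j) = 1"
  shows "char_poly (mat (Suc k) (Suc k) (\<lambda>(i,j). b i j)) =
    [:-1, 1:] * char_poly (mat k k (\<lambda>(i,j). b (Suc i) (Suc j) - b 0 (Suc j)))"
proof -
  let ?n = "Suc k"
  define B where "B = mat ?n ?n (\<lambda>(i,j). b i j)"
  \<comment> \<open>\<open>P\<close> replaces the first basis vector by the all-ones vector, an eigenvector of \<open>B\<close> for 1;
    \<open>Q\<close> is its inverse.\<close>
  define P where "P = mat ?n ?n (\<lambda>(i,j). if j = 0 \<or> i = j then 1 else 0 :: real)"
  define Q where "Q = mat ?n ?n (\<lambda>(i,j). if i = j then 1 else if j = 0 then -1 else 0 :: real)"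
  define A1 where "A1 = mat 1 1 (\<lambda>(i::nat,j::nat). 1::real)"
  define A2 where "A2 = mat 1 k (\<lambda>(i::nat,j). b 0 (Suc j))"
  define A3 where "A3 = mat k k (\<lambda>(i,j). b (Suc i) (Suc j) - b 0 (Suc j))"
  \<comment> \<open>\<open>C\<close> is \<open>B\<close> in the basis of the columns of
    \<open>P\<close>. Its first column is the first unit vector because the all-ones vector is fixed
    by \<open>B\<close>; \<open>A3\<close> is the action of \<open>B\<close> modulo constant
    vectors, in the coordinates \<open>v (Suc i) - v 0\<close>.\<close>
  define C where "C = four_block_mat A1 A2 (0\<^sub>m k 1) A3"
  have car: "B \<in> carrier_mat ?n ?n" "P \<in> carrier_mat ?n ?n" "Q \<in> carrier_mat ?n ?n"
    "C \<in> carrier_mat ?n ?n"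
    by (auto simp: B_def P_def Q_def C_def A1_def A2_def A3_def)
  have C_entry: "C $$ (i,j) = (if j = 0 then (if i = 0 then 1 else 0)
      else if i = 0 then b 0 j else b i j - b 0 j)" if "i < ?n" "j < ?n" for i j
    using that by (auto simp: C_def A1_def A2_def A3_def split: nat.splits)
  have split0: "sum f {0..<?n} = f 0 + (\<Sum>i<k. f (Suc i))" for f :: "nat \<Rightarrow> real"
    unfolding atLeast0LessThan by (rule sum.lessThan_Suc_shift)
  have QP: "Q * P = 1\<^sub>m ?n"
  proof (rule eq_matI)
    fix i j assume "i < dim_row (1\<^sub>m ?n :: real mat)" "j < dim_col (1\<^sub>m ?n :: real mat)"
    hence ij: "i < ?n" "j < ?n" by auto
    have "(Q * P) $$ (i,j) = (\<Sum>l\<in>{0..<?n}. Q $$ (i,l) * P $$ (l,j))"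
      using ij by (auto simp: P_def Q_def scalar_prod_def)
    also have "\<dots> = Q $$ (i,0) * P $$ (0,j) + (\<Sum>l<k. Q $$ (i,Suc l) * P $$ (Suc l,j))"
      by (rule split0)
    also have "(\<Sum>l<k. Q $$ (i,Suc l) * P $$ (Suc l,j)) = (\<Sum>l<k. if i = Suc l then P $$ (i,j) else 0)"
      using ij by (intro sum.cong) (auto simp: Q_def)
    also have "\<dots> = (if i = 0 then 0 else P $$ (i,j))"
      using ij by (cases i) auto
    also have "Q $$ (i,0) * P $$ (0,j) + \<dots> = 1\<^sub>m ?n $$ (i,j)"
      using ij by (auto simp: P_def Q_def)
    finally show "(Q * P) $$ (i, j) = 1\<^sub>m ?n $$ (i, j)" .
  qed (auto simp: P_def Q_def)
  have PQ: "P * Q = 1\<^sub>m ?n"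
    using mat_mult_left_right_inverse[OF car(3,2) QP] .
  have PC: "P * C = B * P"
  proof (rule eq_matI)
    fix i j assume "i < dim_row (B * P)" "j < dim_col (B * P)"
    hence ij: "i < ?n" "j < ?n" using car by auto
    have "(P * C) $$ (i,j) = (\<Sum>l\<in>{0..<?n}. (if l = 0 \<or> i = l then 1 else 0) * C $$ (l,j))"
      using ij car by (auto simp: P_def scalar_prod_def)
    also have "\<dots> = C $$ (0,j) + (\<Sum>l<k. (if i = Suc l then 1 else 0) * C $$ (Suc l, j))"
      unfolding split0 by simp
    also have "(\<Sum>l<k. (if i = Suc l then 1 else 0) * C $$ (Suc l, j)) = (if i = 0 then 0 else C $$ (i,j))"
      using ij by (cases i) (auto simp: if_distrib if_distribR sum.delta cong: if_cong)
    also have "C $$ (0,j) + \<dots> = (if j = 0 then 1 else b i j)"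
      using ij by (auto simp: C_entry)
    also have "\<dots> = (B * P) $$ (i,j)"
    proof -
      have "(B * P) $$ (i,j) = (\<Sum>l\<in>{0..<?n}. b i l * (if j = 0 \<or> l = j then 1 else 0))"
        using ij by (auto simp: B_def P_def scalar_prod_def)
      also have "\<dots> = (if j = 0 then 1 else b i j)"
        using rows[OF ij(1)] ij by (auto simp: if_distrib if_distribR sum.delta atLeast0LessThan cong: if_cong)
      finally show ?thesis by simp
    qed
    finally show "(P * C) $$ (i,j) = (B * P) $$ (i,j)" .
  qed (use car in auto)
  have "B = B * (P * Q)" using car PQ by simp
  also have "\<dots> = (B * P) * Q" using car by (simp add: assoc_mult_mat[of _ ?n ?n _ ?n _ ?n])
  also have "\<dots> = P * C * Q" using PC by simp
  finally have "similar_mat B C"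
    using car PQ QP by (intro similar_matI[of _ _ P Q ?n]) auto
  hence "char_poly B = char_poly C" by (rule char_poly_similar)
  also have "\<dots> = char_poly A1 * char_poly A3" unfolding C_def
    by (rule char_poly_four_block_zeros_col) (auto simp: A1_def A2_def A3_def)
  also have "char_poly A1 = [:-1,1:]"
  proof -
    have "upper_triangular A1" by (auto simp: A1_def upper_triangular_def)
    from char_poly_upper_triangular[OF _ this, of 1] show ?thesis
      by (simp add: A1_def diag_mat_def)
  qed
  finally show ?thesis by (simp add: B_def A3_def)
qed

text \<open>Eigenvectors become plain functions on indices, so that the variational argument can
  work with finite sums and with compactness in a function space.\<close>

lemma root_char_poly_mat:
  fixes b :: "nat \<Rightarrow> nat \<Rightarrow> real"
  shows "poly (char_poly (mat n n (\<lambda>(i,j). b i j))) r = 0 \<longleftrightarrow>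
    (\<exists>v. (\<exists>i<n. v i \<noteq> 0) \<and> (\<forall>i<n. (\<Sum>j<n. b i j * v j) = r * v i))"
    (is "?L \<longleftrightarrow> ?R")
proof -
  define B where "B = mat n n (\<lambda>(i,j). b i j)"
  have car: "B \<in> carrier_mat n n" by (simp add: B_def)
  have L: "?L \<longleftrightarrow> (\<exists>w. eigenvector B w r)"
    using eigenvalue_root_char_poly[OF car, of r] by (simp add: B_def eigenvalue_def)
  have ev: "eigenvector B (vec n v) r \<longleftrightarrow> (\<exists>i<n. v i \<noteq> 0) \<and> (\<forall>i<n. (\<Sum>j<n. b i j * v j) = r * v i)" for v
    unfolding eigenvector_def
    by (auto simp: B_def vec_eq_iff scalar_prod_def atLeast0LessThan)
  show ?thesis
  proof
    assume ?L
    then obtain w where w: "eigenvector B w r" using L by blast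
    then have "w = vec n (vec_index w)" using car by (auto simp: eigenvector_def vec_eq_iff)
    with w ev[of "vec_index w"] show ?R by metis
  next
    assume ?R thus ?L using L ev by blast
  qed
qed

text \<open>The unit sphere of the sum-zero space is compact, so the form has a maximiser there; the
  bound for other sum-zero vectors follows by homogeneity.\<close>

lemma quadratic_form_attains_sup:
  fixes b :: "nat \<Rightarrow> nat \<Rightarrow> real"
  assumes n: "n \<ge> 2"
  obtains v mu where "(\<Sum>i<n. v i) = 0" "(\<Sum>i<n. (v i)\<^sup>2) = 1"
    "mu = (\<Sum>i<n. \<Sum>j<n. b i j * v i * v j)"
    "\<And>y. (\<Sum>i<n. y i) = 0 \<Longrightarrow> (\<Sum>i<n. \<Sum>j<n. b i j * y i * y j) \<le> mu * (\<Sum>i<n. (y i)\<^sup>2)"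
proof -
  define q where "q y = (\<Sum>i<n. \<Sum>j<n. b i j * y i * y j)" for y :: "nat \<Rightarrow> real"
  \<comment> \<open>Coordinates from \<open>n\<close> on are pinned to 0 and the others confined to
    a compact interval, so Tychonoff's theorem makes the ambient box compact in the product
    topology.\<close>
  define K where "K = {y::nat \<Rightarrow> real. (\<forall>i. y i \<in> (if i < n then {-1..1} else {0}))
      \<and> (\<Sum>i<n. y i) = 0 \<and> (\<Sum>i<n. (y i)\<^sup>2) = 1}"
  have cc: "continuous_on UNIV (\<lambda>y::nat \<Rightarrow> real. y i)" for i
    by (rule continuous_on_product_coordinates)
  have "compactin (product_topology (\<lambda>i. euclidean) UNIV)
      (PiE UNIV (\<lambda>i::nat. if i < n then {-1..1::real} else {0}))"
    by (subst compactin_PiE) auto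
  hence K0: "compact {y::nat \<Rightarrow> real. \<forall>i. y i \<in> (if i < n then {-1..1} else {0})}"
    by (simp add: euclidean_product_topology PiE_def Pi_def)
  have cl: "closed {y::nat \<Rightarrow> real. (\<Sum>i<n. y i) = 0 \<and> (\<Sum>i<n. (y i)\<^sup>2) = 1}"
    by (intro closed_Collect_conj closed_Collect_eq continuous_intros cc)
  have "K = {y::nat \<Rightarrow> real. \<forall>i. y i \<in> (if i < n then {-1..1} else {0})} \<inter>
      {y::nat \<Rightarrow> real. (\<Sum>i<n. y i) = 0 \<and> (\<Sum>i<n. (y i)\<^sup>2) = 1}"
    by (auto simp: K_def)
  hence comp: "compact K" using K0 cl by (simp add: compact_Int_closed)
  have norm_in: "(\<lambda>i. if i < n then y i / sqrt (\<Sum>i<n. (y i)\<^sup>2) else 0) \<in> K"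
    if y: "(\<Sum>i<n. y i) = 0" and pos: "(\<Sum>i<n. (y i)\<^sup>2) > 0" for y
  proof -
    let ?N = "\<Sum>i<n. (y i)\<^sup>2"
    have "\<bar>y i\<bar> \<le> sqrt ?N" if "i < n" for i
    proof -
      have "(y i)\<^sup>2 \<le> ?N" using that by (intro member_le_sum) auto
      thus ?thesis using real_le_rsqrt[of "\<bar>y i\<bar>"] by simp
    qed
    hence "\<bar>y i / sqrt ?N\<bar> \<le> 1" if "i < n" for i using pos that by (simp add: abs_divide)
    hence 1: "- 1 \<le> y i / sqrt ?N \<and> y i / sqrt ?N \<le> 1" if "i < n" for i
      using that by (meson abs_le_D1 abs_le_D2 minus_le_iff)
    have "(\<Sum>i<n. y i / sqrt ?N) = 0" using y by (simp flip: sum_divide_distrib)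
    moreover have "(\<Sum>i<n. (y i / sqrt ?N)\<^sup>2) = 1"
      using pos by (simp add: power_divide sum_nonneg flip: sum_divide_distrib)
    ultimately show ?thesis using 1 by (auto simp: K_def)
  qed
  have "K \<noteq> {}"
  proof -
    \<comment> \<open>This is where \<open>n \<ge> 2\<close> enters: for \<open>n = 1\<close> the
      sum-zero space is trivial and its sphere empty.\<close>
    define y where "y i = (if i = 0 then 1 else if i = 1 then -1 else 0 :: real)" for i :: nat
    have e: "{..<n} = insert 0 (insert 1 {2..<n})" using n by auto
    have "(\<Sum>i<n. y i) = 0" "(\<Sum>i<n. (y i)\<^sup>2) = 2" unfolding e y_def by auto
    thus ?thesis using norm_in[of y] by auto
  qed
  moreover have "continuous_on K q" unfolding q_def
    by (intro continuous_intros continuous_on_subset[OF cc]) auto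
  ultimately obtain v where v: "v \<in> K" "\<And>y. y \<in> K \<Longrightarrow> q y \<le> q v"
    using continuous_attains_sup[OF comp] by blast
  have "q y \<le> q v * (\<Sum>i<n. (y i)\<^sup>2)" if y: "(\<Sum>i<n. y i) = 0" for y
  proof (cases "(\<Sum>i<n. (y i)\<^sup>2) > 0")
    case True
    let ?N = "\<Sum>i<n. (y i)\<^sup>2"
    have "q (\<lambda>i. if i < n then y i / sqrt ?N else 0) = q y / ?N"
      using True by (simp add: q_def sum_divide_distrib real_sqrt_mult_self power2_eq_square[symmetric])
    with v(2)[OF norm_in[OF y True]] True show ?thesis by (simp add: field_simps)
  next
    case False
    hence "(\<Sum>i<n. (y i)\<^sup>2) = 0" by (meson antisym_conv1 not_less sum_nonneg zero_le_power2 leD order.antisym)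
    moreover from this have "\<forall>i<n. y i = 0" by (subst (asm) sum_nonneg_eq_0_iff) auto
    ultimately show ?thesis by (simp add: q_def)
  qed
  with v(1) show ?thesis using that[of v "q v"] unfolding K_def q_def by auto
qed


text \<open>Used with \<open>a = 1\<close>: once 1 is known to bound all roots, it occupies index 0
  of the descending list, and the index 1 in \<open>lambda2\<close> refers to the largest root of
  the remaining factor.\<close>

lemma sorted_list_of_multiset_insert_max:
  fixes a :: "'a :: linorder"
  assumes le: "\<And>x. x \<in># N \<Longrightarrow> x \<le> a"
  shows "rev (sorted_list_of_multiset (add_mset a N)) = a # rev (sorted_list_of_multiset N)"
proof -
  have "sorted (sorted_list_of_multiset N @ [a])" using le by (simp add: sorted_append)
  hence "sorted_list_of_multiset (mset (sorted_list_of_multiset N @ [a])) = sorted_list_of_multiset N @ [a]"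
    unfolding sorted_list_of_multiset_mset by (rule sorted_sort_id)
  hence "sorted_list_of_multiset (add_mset a N) = sorted_list_of_multiset N @ [a]" by simp
  thus ?thesis by simp
qed

text \<open>The maximal Rayleigh quotient \<open>mu\<close> on sum-zero vectors is attained at an
  eigenvector, which survives in the quotient by constants; so \<open>mu\<close> is a root of the
  deflated polynomial \<open>p\<close>, whose largest root is \<open>lambda2 B\<close>. The
  hypothesis \<open>psd\<close> gives \<open>0 \<le> mu\<close>, and \<open>contr\<close> keeps
  every root at most 1, which makes the split-off root 1 the largest.\<close>

lemma lambda2_bounds:
  fixes b :: "nat \<Rightarrow> nat \<Rightarrow> real"
  assumes n: "n \<ge> 2"
    and sym: "\<And>i j. i < n \<Longrightarrow> j < n \<Longrightarrow> b i j = b j i"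
    and rows: "\<And>i. i < n \<Longrightarrow> (\<Sum>j<n. b i j) = 1"
    and psd: "\<And>y. 0 \<le> (\<Sum>i<n. \<Sum>j<n. b i j * y i * y j)"
    and contr: "\<And>y. (\<Sum>i<n. \<Sum>j<n. b i j * y i * y j) \<le> (\<Sum>i<n. (y i)\<^sup>2)"
  defines "B \<equiv> mat n n (\<lambda>(i,j). b i j)"
  shows "0 \<le> lambda2 B" "lambda2 B \<le> 1"
    "(\<Sum>i<n. y i) = 0 \<Longrightarrow> (\<Sum>i<n. \<Sum>j<n. b i j * y i * y j) \<le> lambda2 B * (\<Sum>i<n. (y i)\<^sup>2)"
proof -
  define q where "q y z = (\<Sum>i<n. \<Sum>j<n. b i j * y i * z j)" for y z :: "nat \<Rightarrow> real"
  obtain v mu where v: "(\<Sum>i<n. v i) = 0" "(\<Sum>i<n. (v i)\<^sup>2) = 1" "mu = q v v"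
    and mu: "\<And>y. (\<Sum>i<n. y i) = 0 \<Longrightarrow> q y y \<le> mu * (\<Sum>i<n. (y i)\<^sup>2)"
  proof (rule quadratic_form_attains_sup[OF n, of b])
    fix v mu
    assume "(\<Sum>i<n. v i) = 0" "(\<Sum>i<n. (v i)\<^sup>2) = 1" "mu = (\<Sum>i<n. \<Sum>j<n. b i j * v i * v j)"
      "\<And>y. (\<Sum>i<n. y i) = 0 \<Longrightarrow> (\<Sum>i<n. \<Sum>j<n. b i j * y i * y j) \<le> mu * (\<Sum>i<n. (y i)\<^sup>2)"
    thus thesis unfolding q_def[symmetric] by (rule that)
  qed
  have mu0: "0 \<le> mu" using psd[of v] v(3) by (simp add: q_def)
  define w where "w i = mu * v i - (\<Sum>j<n. b i j * v j)" for i
  have cols: "(\<Sum>i<n. b i j) = 1" if "j < n" for j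
  proof -
    have "(\<Sum>i<n. b i j) = (\<Sum>i<n. b j i)" using sym[OF _ that] by (intro sum.cong) auto
    thus ?thesis using rows[OF that] by simp
  qed
  have w_sum: "(\<Sum>i<n. w i) = 0"
  proof -
    have "(\<Sum>i<n. \<Sum>j<n. b i j * v j) = (\<Sum>j<n. (\<Sum>i<n. b i j) * v j)"
      by (subst sum.swap) (simp add: sum_distrib_right)
    also have "\<dots> = 0" using cols v(1) by simp
    finally show ?thesis using v(1) by (simp add: w_def sum_subtractf flip: sum_distrib_left)
  qed
  \<comment> \<open>The form \<open>mu |y|^2 - q y y\<close> is nonnegative on the sum-zero space and vanishes at \<open>v\<close>,
    so its first variation at \<open>v\<close> in the direction \<open>w\<close>, which is \<open>2 |w|^2\<close>, vanishes.\<close>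
  have q_expand: "q (\<lambda>i. v i + e * w i) (\<lambda>i. v i + e * w i)
      = q v v + 2 * e * (\<Sum>i<n. w i * (\<Sum>j<n. b i j * v j)) + e\<^sup>2 * q w w" for e
  proof -
    have "q v w = q w v" unfolding q_def
      
      by (subst sum.swap, intro sum.cong refl) (use sym in \<open>simp add: mult_ac\<close>)
    moreover have "q w v = (\<Sum>i<n. w i * (\<Sum>j<n. b i j * v j))"
      by (simp add: q_def sum_distrib_left mult_ac)
    moreover have "q (\<lambda>i. v i + e * w i) (\<lambda>i. v i + e * w i)
      = q v v + e * q v w + e * q w v + e\<^sup>2 * q w w"
      by (simp add: q_def sum_distrib_left sum.distrib[symmetric] algebra_simps power2_eq_square)
    ultimately show ?thesis by simp
  qed
  have n_expand: "(\<Sum>i<n. (v i + e * w i)\<^sup>2)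
      = (\<Sum>i<n. (v i)\<^sup>2) + 2 * e * (\<Sum>i<n. w i * v i) + e\<^sup>2 * (\<Sum>i<n. (w i)\<^sup>2)" for e
    by (simp add: sum_distrib_left sum.distrib[symmetric] algebra_simps power2_eq_square)
  define N where "N = (\<Sum>i<n. (w i)\<^sup>2)"
  define c where "c = mu * N - q w w"
  define r1 where "r1 = (\<Sum>i<n. w i * (\<Sum>j<n. b i j * v j))"
  define r2 where "r2 = (\<Sum>i<n. w i * v i)"
  have first_var: "0 \<le> 2 * e * N + e\<^sup>2 * c" for e
  proof -
    have "(\<Sum>i<n. v i + e * w i) = 0" using v(1) w_sum by (simp add: sum.distrib flip: sum_distrib_left)
    from mu[OF this] have 1: "q v v + 2 * e * r1 + e\<^sup>2 * q w w \<le> mu * (1 + 2 * e * r2 + e\<^sup>2 * N)"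
      unfolding q_expand n_expand v(2) N_def r1_def r2_def .
    have "N = (\<Sum>i<n. mu * (w i * v i) - w i * (\<Sum>j<n. b i j * v j))"
      unfolding N_def
    proof (rule sum.cong)
      fix i
      have "(w i)\<^sup>2 = w i * (mu * v i - (\<Sum>j<n. b i j * v j))"
        unfolding power2_eq_square by (subst (2) w_def) simp
      thus "(w i)\<^sup>2 = mu * (w i * v i) - w i * (\<Sum>j<n. b i j * v j)"
        by (simp only: right_diff_distrib mult.left_commute)
    qed simp
    hence 2: "N = mu * r2 - r1" by (simp only: sum_subtractf r1_def r2_def sum_distrib_left)
    have "2 * e * N + e\<^sup>2 * c = mu * (1 + 2 * e * r2 + e\<^sup>2 * N) - (mu + 2 * e * r1 + e\<^sup>2 * q w w)"
      unfolding c_def by (subst 2) (simp only: algebra_simps)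
    thus ?thesis using 1 v(3) by simp
  qed
  have "N = 0"
  proof (rule ccontr)
    assume "N \<noteq> 0"
    moreover have "N \<ge> 0" unfolding N_def by (simp add: sum_nonneg)
    ultimately have N: "N > 0" by simp
    \<comment> \<open>A nonnegative quadratic in \<open>e\<close> without constant term has no
      linear term. If \<open>c \<le> 0\<close>, the point \<open>e = -1\<close> refutes it,
      otherwise the minimiser \<open>e = - N / c\<close> does.\<close>
    show False
    proof (cases "c \<le> 0")
      case True with first_var[of "-1"] N show False by simp
    next
      case False
      hence "2 * (- N / c) * N + (- N / c)\<^sup>2 * c = - (N * N / c)"
        by (simp add: power2_eq_square)
      moreover have "N * N / c > 0" using N False by simp
      ultimately show False using first_var[of "- N / c"] by linarith
    qed
  qed
  hence w0: "w i = 0" if "i < n" for i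
    using that unfolding N_def by (subst (asm) sum_nonneg_eq_0_iff) auto
  hence ev: "(\<Sum>j<n. b i j * v j) = mu * v i" if "i < n" for i
    using that by (force simp: w_def)
  obtain k where k: "n = Suc k" using n by (cases n) auto
  define p where "p = char_poly (mat k k (\<lambda>(i,j). b (Suc i) (Suc j) - b 0 (Suc j)))"
  have cp: "char_poly B = [:-1,1:] * p"
    unfolding B_def p_def k by (rule char_poly_row_stochastic) (use rows k in auto)
  have cp0: "char_poly B \<noteq> 0"
    using degree_monic_char_poly[of B n] n by (auto simp: B_def)
  hence p0: "p \<noteq> 0" using cp by auto
  \<comment> \<open>The eigenvector of the deflated matrix is the class of \<open>v\<close> modulo
    constants. It is nonzero because a constant vector with sum 0 vanishes, whereas \<open>v\<close>
    has unit norm.\<close>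
  have pmu: "poly p mu = 0"
    unfolding p_def root_char_poly_mat
  proof (rule exI[of _ "\<lambda>i. v (Suc i) - v 0"], rule conjI)
    let ?u = "\<lambda>i. v (Suc i) - v 0"
    show "\<exists>i<k. ?u i \<noteq> 0"
    proof (rule ccontr)
      assume "\<not> ?thesis"
      hence c: "v i = v 0" if "i < n" for i using that k by (cases i) auto
      have eq: "(\<Sum>i<n. v i) = (\<Sum>i<n. v 0)" "(\<Sum>i<n. (v i)\<^sup>2) = (\<Sum>i<n. (v 0)\<^sup>2)"
        by (intro sum.cong refl, metis c lessThan_iff)+
      with v(1,2) n show False by simp
    qed
    show "\<forall>i<k. (\<Sum>j<k. (b (Suc i) (Suc j) - b 0 (Suc j)) * ?u j) = mu * ?u i"
    proof (intro allI impI)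
      fix i assume i: "i < k"
      have "(\<Sum>j<k. (b (Suc i) (Suc j) - b 0 (Suc j)) * ?u j)
          = (\<Sum>j<n. (b (Suc i) j - b 0 j) * (v j - v 0))"
        unfolding k by (simp add: sum.lessThan_Suc_shift del: sum.lessThan_Suc)
      also have "\<dots> = (\<Sum>j<n. b (Suc i) j * v j) - (\<Sum>j<n. b 0 j * v j)
          - ((\<Sum>j<n. b (Suc i) j) * v 0 - (\<Sum>j<n. b 0 j) * v 0)"
        unfolding sum_distrib_right sum_subtractf[symmetric] by (intro sum.cong) (auto simp: algebra_simps)
      also have "\<dots> = mu * ?u i"
        using ev[of "Suc i"] ev[of 0] rows[of "Suc i"] rows[of 0] i k by (simp add: algebra_simps)
      finally show "(\<Sum>j<k. (b (Suc i) (Suc j) - b 0 (Suc j)) * ?u j) = mu * ?u i" .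
    qed
  qed
  have root_le: "r \<le> 1" if r: "poly (char_poly B) r = 0" for r
  proof -
    from r obtain u where u: "\<exists>i<n. u i \<noteq> 0" "\<forall>i<n. (\<Sum>j<n. b i j * u j) = r * u i"
      unfolding B_def root_char_poly_mat by blast
    have "(\<Sum>i<n. \<Sum>j<n. b i j * u i * u j) = (\<Sum>i<n. u i * (\<Sum>j<n. b i j * u j))"
      by (simp add: sum_distrib_left mult_ac)
    also have "\<dots> = r * (\<Sum>i<n. (u i)\<^sup>2)"
      using u(2) by (simp add: sum_distrib_left power2_eq_square mult_ac)
    finally have "r * (\<Sum>i<n. (u i)\<^sup>2) \<le> 1 * (\<Sum>i<n. (u i)\<^sup>2)" using contr[of u] by simp
    moreover have "(\<Sum>i<n. (u i)\<^sup>2) > 0"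
    proof -
      from u(1) obtain i where "i < n" "u i \<noteq> 0" by blast
      thus ?thesis by (intro sum_pos2[of _ i]) auto
    qed
    ultimately show ?thesis by (simp only: mult_le_cancel_right_pos)
  qed
  define l where "l = rev (sorted_list_of_multiset (proots p))"
  have pr: "proots (char_poly B) = add_mset 1 (proots p)"
    unfolding cp using p0 by (subst proots_mult) auto
  have lam: "lambda2 B = l ! 0"
    unfolding lambda2_def pr l_def
    by (subst sorted_list_of_multiset_insert_max) (use p0 root_le cp in auto)
  have mem: "mu \<in> set l" using pmu p0 by (simp add: l_def)
  have srt: "sorted_wrt (\<ge>) l" by (simp add: l_def sorted_wrt_rev)
  have ge: "mu \<le> l ! 0"
    using mem srt by (cases l) auto
  have "l ! 0 \<in> set l" using mem by (cases l) auto
  hence "poly p (l ! 0) = 0" using p0 by (simp add: l_def)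
  hence le: "l ! 0 \<le> 1" using root_le cp by simp
  show "0 \<le> lambda2 B" "lambda2 B \<le> 1" using lam ge le mu0 by auto
  assume y: "(\<Sum>i<n. y i) = 0"
  have "q y y \<le> mu * (\<Sum>i<n. (y i)\<^sup>2)" by (rule mu[OF y])
  also have "\<dots> \<le> lambda2 B * (\<Sum>i<n. (y i)\<^sup>2)"
    using ge lam by (intro mult_right_mono sum_nonneg) auto
  finally show "(\<Sum>i<n. \<Sum>j<n. b i j * y i * y j) \<le> lambda2 B * (\<Sum>i<n. (y i)\<^sup>2)"
    by (simp add: q_def)
qed

section \<open>Averaging over the active set\<close>

text \<open>The variance decomposition around the mean. It yields Jensen's inequality for averages,
  the passage from heterogeneity to second moments, and the fact that centering does not increase a
  sum of squares.\<close>

lemma sum_norm_centered: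
  fixes y :: "'i \<Rightarrow> 'a::real_inner"
  assumes "finite I" "I \<noteq> {}"
  defines "avg \<equiv> (1 / real (card I)) *\<^sub>R (\<Sum>i\<in>I. y i)"
  shows "(\<Sum>i\<in>I. (norm (y i - avg))\<^sup>2) = (\<Sum>i\<in>I. (norm (y i))\<^sup>2) - real (card I) * (norm avg)\<^sup>2"
proof -
  have c: "real (card I) \<noteq> 0" using assms by (simp add: card_gt_0_iff)
  hence s: "(\<Sum>i\<in>I. y i) = real (card I) *\<^sub>R avg" by (simp add: avg_def)
  have "(\<Sum>i\<in>I. (norm (y i - avg))\<^sup>2)
      = (\<Sum>i\<in>I. (norm (y i))\<^sup>2 - 2 * (y i \<bullet> avg) + (norm avg)\<^sup>2)"
    by (intro sum.cong) (auto simp: power2_norm_eq_inner inner_diff inner_commute)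
  also have "\<dots> = (\<Sum>i\<in>I. (norm (y i))\<^sup>2) - 2 * ((\<Sum>i\<in>I. y i) \<bullet> avg) + real (card I) * (norm avg)\<^sup>2"
    by (simp add: sum.distrib sum_subtractf inner_sum_left sum_distrib_left)
  also have "\<dots> = (\<Sum>i\<in>I. (norm (y i))\<^sup>2) - real (card I) * (norm avg)\<^sup>2"
    unfolding s by (simp add: power2_norm_eq_inner)
  finally show ?thesis .
qed

lemma norm_avg_sq_le:
  fixes y :: "'i \<Rightarrow> 'a::real_inner"
  assumes "finite I" "I \<noteq> {}"
  shows "(norm ((1 / real (card I)) *\<^sub>R (\<Sum>i\<in>I. y i)))\<^sup>2 \<le> (1 / real (card I)) * (\<Sum>i\<in>I. (norm (y i))\<^sup>2)"
proof -
  have "0 \<le> (\<Sum>i\<in>I. (norm (y i - (1 / real (card I)) *\<^sub>R (\<Sum>i\<in>I. y i)))\<^sup>2)" by (simp add: sum_nonneg)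
  moreover have "real (card I) > 0" using assms by (simp add: card_gt_0_iff)
  ultimately show ?thesis unfolding sum_norm_centered[OF assms] by (simp add: field_simps)
qed

text \<open>The action of \<open>mixing\<close> on a family of vectors in any real vector space. For
  \<open>Act = {}\<close> it is the identity, in agreement with a round in which no uplink is
  active.\<close>

definition mix_step :: "nat set \<Rightarrow> (nat \<Rightarrow> 'a::real_vector) \<Rightarrow> nat \<Rightarrow> 'a" where
  "mix_step Act y i = (if i \<in> Act then (1 / real (card Act)) *\<^sub>R (\<Sum>j\<in>Act. y j) else y i)"

context
  fixes m :: nat and Act :: "nat set"
  assumes Act: "Act \<subseteq> {..<m}"
begin

lemma finite_active: "finite Act"
  using Act finite_subset by blast

text \<open>Column sums of the mixing matrix are 1; hence the average iterate does not depend on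
  which clients are active in the current round.\<close>

lemma sum_mix_step: "(\<Sum>i<m. mix_step Act y i) = (\<Sum>i<m. y i)"
proof (cases "Act = {}")
  case False
  have c: "card Act \<noteq> 0" using False finite_active by simp
  have "(\<Sum>i<m. mix_step Act y i) = (\<Sum>i\<in>{..<m} - Act. mix_step Act y i) + (\<Sum>i\<in>Act. mix_step Act y i)"
    by (rule sum.subset_diff[OF Act]) simp
  also have "\<dots> = (\<Sum>i\<in>{..<m} - Act. y i) + (\<Sum>i\<in>Act. y i)"
    using c by (simp add: mix_step_def sum_constant_scaleR)
  also have "\<dots> = (\<Sum>i<m. y i)" by (rule sum.subset_diff[OF Act, symmetric]) simp
  finally show ?thesis .
qed (simp add: mix_step_def)

lemma sum_norm_mix_step_le:
  fixes y :: "nat \<Rightarrow> 'a::real_inner"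
  shows "(\<Sum>i<m. (norm (mix_step Act y i))\<^sup>2) \<le> (\<Sum>i<m. (norm (y i))\<^sup>2)"
proof (cases "Act = {}")
  case False
  have c: "card Act > 0" using False finite_active by (simp add: card_gt_0_iff)
  let ?f = "\<lambda>i. (norm (mix_step Act y i))\<^sup>2"
  have "(\<Sum>i<m. ?f i) = (\<Sum>i\<in>{..<m} - Act. ?f i) + (\<Sum>i\<in>Act. ?f i)"
    by (rule sum.subset_diff[OF Act]) simp
  also have "\<dots> = (\<Sum>i\<in>{..<m} - Act. (norm (y i))\<^sup>2)
      + real (card Act) * (norm ((1 / real (card Act)) *\<^sub>R (\<Sum>j\<in>Act. y j)))\<^sup>2"
    by (simp add: mix_step_def)
  also have "\<dots> \<le> (\<Sum>i\<in>{..<m} - Act. (norm (y i))\<^sup>2) + (\<Sum>i\<in>Act. (norm (y i))\<^sup>2)"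
    using mult_left_mono[OF norm_avg_sq_le[OF finite_active False, of y], of "real (card Act)"] c by simp
  also have "\<dots> = (\<Sum>i<m. (norm (y i))\<^sup>2)" by (rule sum.subset_diff[OF Act, symmetric]) simp
  finally show ?thesis .
qed (simp add: mix_step_def)

lemma mixing_sym: "i < m \<Longrightarrow> j < m \<Longrightarrow> mixing m Act $$ (i,j) = mixing m Act $$ (j,i)"
  by (auto simp: mixing_def)

lemma mix_step_eq_mixing:
  assumes i: "i < m"
  shows "mix_step Act y i = (\<Sum>j<m. mixing m Act $$ (i,j) *\<^sub>R y j)"
proof (cases "i \<in> Act")
  case True
  have "(\<Sum>j<m. mixing m Act $$ (i,j) *\<^sub>R y j) = (\<Sum>j\<in>{..<m}. if j \<in> Act then (1 / real (card Act)) *\<^sub>R y j else 0)"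
    using True i by (intro sum.cong) (auto simp: mixing_def)
  also have "\<dots> = (\<Sum>j\<in>Act. (1 / real (card Act)) *\<^sub>R y j)"
    using Act by (simp add: sum.If_cases Int_absorb1)
  finally show ?thesis using True by (simp add: mix_step_def scaleR_sum_right)
next
  case False
  have "(\<Sum>j<m. mixing m Act $$ (i,j) *\<^sub>R y j) = (\<Sum>j\<in>{..<m}. if i = j then y j else 0)"
    using False i by (intro sum.cong) (auto simp: mixing_def)
  thus ?thesis using False i by (simp add: mix_step_def)
qed

text \<open>By symmetry the square is the Gram matrix of the columns, the form in which it appears
  in the squared norm of a mixed family.\<close>

lemma mixing_sq_entry:
  "i < m \<Longrightarrow> j < m \<Longrightarrow> (mixing m Act * mixing m Act) $$ (i,j) =
    (\<Sum>k<m. mixing m Act $$ (k,i) * mixing m Act $$ (k,j))"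
  by (subst index_mult_mat) (auto simp: mixing_def scalar_prod_def atLeast0LessThan intro!: sum.cong)

lemma sum_norm_mix_step:
  fixes y :: "nat \<Rightarrow> 'a::real_inner"
  shows "(\<Sum>i<m. (norm (mix_step Act y i))\<^sup>2) =
    (\<Sum>i<m. \<Sum>j<m. (mixing m Act * mixing m Act) $$ (i,j) * (y i \<bullet> y j))"
proof -
  let ?W = "\<lambda>i j. mixing m Act $$ (i,j)"
  have "(\<Sum>k<m. (norm (mix_step Act y k))\<^sup>2) = (\<Sum>k<m. \<Sum>i<m. \<Sum>j<m. ?W k i * ?W k j * (y i \<bullet> y j))"
  proof (intro sum.cong refl)
    fix k assume "k \<in> {..<m}"
    hence "(norm (mix_step Act y k))\<^sup>2 = (\<Sum>j<m. \<Sum>i<m. ?W k i * ?W k j * (y i \<bullet> y j))"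
      by (simp add: mix_step_eq_mixing power2_norm_eq_inner inner_sum_left inner_sum_right mult_ac sum_distrib_left)
    also have "\<dots> = (\<Sum>i<m. \<Sum>j<m. ?W k i * ?W k j * (y i \<bullet> y j))" by (rule sum.swap)
    finally show "(norm (mix_step Act y k))\<^sup>2 = (\<Sum>i<m. \<Sum>j<m. ?W k i * ?W k j * (y i \<bullet> y j))" .
  qed
  also have "\<dots> = (\<Sum>i<m. \<Sum>k<m. \<Sum>j<m. ?W k i * ?W k j * (y i \<bullet> y j))"
    by (rule sum.swap)
  also have "\<dots> = (\<Sum>i<m. \<Sum>j<m. \<Sum>k<m. ?W k i * ?W k j * (y i \<bullet> y j))"
    by (intro sum.cong refl sum.swap)
  also have "\<dots> = (\<Sum>i<m. \<Sum>j<m. (mixing m Act * mixing m Act) $$ (i,j) * (y i \<bullet> y j))"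
    by (intro sum.cong refl) (simp add: mixing_sq_entry sum_distrib_right)
  finally show ?thesis .
qed

lemma mixing_sq_row_sum:
  assumes "i < m"
  shows "(\<Sum>j<m. (mixing m Act * mixing m Act) $$ (i,j)) = 1"
proof -
  have row: "(\<Sum>j<m. mixing m Act $$ (k,j)) = 1" if "k < m" for k
  proof -
    have "(\<Sum>j<m. mixing m Act $$ (k,j)) = mix_step Act (\<lambda>_. 1::real) k"
      using mix_step_eq_mixing[OF that, of "\<lambda>_. 1::real"] by simp
    also have "\<dots> = 1" using finite_active by (auto simp: mix_step_def)
    finally show ?thesis .
  qed
  have "(\<Sum>j<m. (mixing m Act * mixing m Act) $$ (i,j))
      = (\<Sum>k<m. \<Sum>j<m. mixing m Act $$ (k,i) * mixing m Act $$ (k,j))"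
    using assms by (subst sum.swap) (simp add: mixing_sq_entry)
  also have "\<dots> = (\<Sum>k<m. mixing m Act $$ (i,k))"
    using assms by (intro sum.cong refl) (simp add: row mixing_sym flip: sum_distrib_left)
  finally show ?thesis using row assms by simp
qed

end

section \<open>Expected mixing over a random active set\<close>

context prob_space
begin

lemma integral_finite_range:
  fixes g :: "'b \<Rightarrow> real"
  assumes X: "X \<in> M \<rightarrow>\<^sub>M count_space UNIV" and P: "finite P" "\<And>\<omega>. \<omega> \<in> space M \<Longrightarrow> X \<omega> \<in> P"
  shows "(\<integral>\<omega>. g (X \<omega>) \<partial>M) = (\<Sum>a\<in>P. prob (X -` {a} \<inter> space M) * g a)"
proof -
  have s: "X -` {a} \<inter> space M \<in> sets M" for a using X by (rule measurable_sets) simp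
  have "(\<integral>\<omega>. g (X \<omega>) \<partial>M) = (\<integral>\<omega>. (\<Sum>a\<in>P. indicator (X -` {a} \<inter> space M) \<omega> * g a) \<partial>M)"
  proof (rule Bochner_Integration.integral_cong)
    fix \<omega> assume w: "\<omega> \<in> space M"
    have "(\<Sum>a\<in>P. indicator (X -` {a} \<inter> space M) \<omega> * g a) = (\<Sum>a\<in>P. if X \<omega> = a then g a else 0)"
      using w by (intro sum.cong) (auto simp: indicator_def)
    thus "g (X \<omega>) = (\<Sum>a\<in>P. indicator (X -` {a} \<inter> space M) \<omega> * g a)"
      using P w by simp
  qed simp
  also have "\<dots> = (\<Sum>a\<in>P. \<integral>\<omega>. indicator (X -` {a} \<inter> space M) \<omega> * g a \<partial>M)"
    using s by (intro Bochner_Integration.integral_sum integrable_mult_left integrable_real_indicator) (auto simp: emeasure_eq_measure)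
  also have "\<dots> = (\<Sum>a\<in>P. prob (X -` {a} \<inter> space M) * g a)"
    using s by simp
  finally show ?thesis .
qed

lemma sum_prob_finite_range:
  assumes X: "X \<in> M \<rightarrow>\<^sub>M count_space UNIV" and P: "finite P" "\<And>\<omega>. \<omega> \<in> space M \<Longrightarrow> X \<omega> \<in> P"
  shows "(\<Sum>a\<in>P. prob (X -` {a} \<inter> space M)) = 1"
  using integral_finite_range[OF assms, of "\<lambda>_. 1"] prob_space by simp

context
  fixes m :: nat and At :: "'a \<Rightarrow> nat set"
  assumes m: "m \<ge> 2"
    and At: "At \<in> M \<rightarrow>\<^sub>M count_space UNIV" "\<And>\<omega>. \<omega> \<in> space M \<Longrightarrow> At \<omega> \<subseteq> {..<m}"
begin

abbreviation "pr Act \<equiv> prob (At -` {Act} \<inter> space M)"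

text \<open>For a deterministic family, the expected squared norm after mixing is the quadratic form
  of the expected squared mixing matrix. This matrix inherits symmetry, row sums 1, positivity and
  contraction from its finitely many realisations, so the eigenvalue bound applies.\<close>

lemma lambda2_exp_mixing:
  fixes y :: "nat \<Rightarrow> 'b::euclidean_space"
  shows "0 \<le> lambda2 (exp_mixing_sq M m At)" "lambda2 (exp_mixing_sq M m At) \<le> 1"
    "(\<Sum>i<m. y i) = 0 \<Longrightarrow>
      (\<Sum>Act\<in>Pow {..<m}. pr Act * (\<Sum>i<m. (norm (mix_step Act y i))\<^sup>2))
      \<le> lambda2 (exp_mixing_sq M m At) * (\<Sum>i<m. (norm (y i))\<^sup>2)"
proof -
  let ?P = "Pow {..<m}"
  let ?W2 = "\<lambda>Act i j. (mixing m Act * mixing m Act) $$ (i,j)"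
  define b where "b i j = (\<integral>\<omega>. ?W2 (At \<omega>) i j \<partial>M)" for i j
  have fr: "finite ?P" "\<And>\<omega>. \<omega> \<in> space M \<Longrightarrow> At \<omega> \<in> ?P" using At(2) by auto
  have b_eq: "b i j = (\<Sum>Act\<in>?P. pr Act * ?W2 Act i j)" for i j
    unfolding b_def by (rule integral_finite_range[OF At(1) fr])
  have B: "exp_mixing_sq M m At = mat m m (\<lambda>(i,j). b i j)"
    by (simp add: exp_mixing_sq_def b_def)
  \<comment> \<open>Proved for an arbitrary inner product space because it is needed twice: for real
    families, to verify the hypotheses of \<open>lambda2_bounds\<close>, and for the vectors
    \<open>y\<close>.\<close>
  have form: "(\<Sum>i<m. \<Sum>j<m. b i j * (z i \<bullet> z j)) = (\<Sum>Act\<in>?P. pr Act * (\<Sum>i<m. (norm (mix_step Act z i))\<^sup>2))"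
    for z :: "nat \<Rightarrow> 'c::real_inner"
  proof -
    have "(\<Sum>i<m. \<Sum>j<m. b i j * (z i \<bullet> z j)) = (\<Sum>i<m. \<Sum>j<m. \<Sum>Act\<in>?P. pr Act * (?W2 Act i j * (z i \<bullet> z j)))"
      by (simp add: b_eq sum_distrib_right mult.assoc)
    also have "\<dots> = (\<Sum>i<m. \<Sum>Act\<in>?P. \<Sum>j<m. pr Act * (?W2 Act i j * (z i \<bullet> z j)))"
      by (intro sum.cong refl sum.swap)
    also have "\<dots> = (\<Sum>Act\<in>?P. \<Sum>i<m. \<Sum>j<m. pr Act * (?W2 Act i j * (z i \<bullet> z j)))"
      by (rule sum.swap)
    also have "\<dots> = (\<Sum>Act\<in>?P. pr Act * (\<Sum>i<m. (norm (mix_step Act z i))\<^sup>2))"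
      by (intro sum.cong refl) (simp add: sum_norm_mix_step sum_distrib_left)
    finally show ?thesis .
  qed
  have form1: "(\<Sum>i<m. \<Sum>j<m. b i j * z i * z j) = (\<Sum>Act\<in>?P. pr Act * (\<Sum>i<m. (mix_step Act z i)\<^sup>2))"
    for z :: "nat \<Rightarrow> real"
    using form[of z] by (simp add: mult.assoc)
  have sym: "b i j = b j i" if "i < m" "j < m" for i j
    unfolding b_eq using that
    by (intro sum.cong refl arg_cong2[of _ _ _ _ "(*)"]) (simp add: mixing_sq_entry mult.commute)
  have rows: "(\<Sum>j<m. b i j) = 1" if "i < m" for i
  proof -
    have "(\<Sum>j<m. b i j) = (\<Sum>Act\<in>?P. pr Act * (\<Sum>j<m. ?W2 Act i j))"
      unfolding b_eq by (subst sum.swap) (simp add: sum_distrib_left)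
    also have "\<dots> = (\<Sum>Act\<in>?P. pr Act)" using that by (simp add: mixing_sq_row_sum)
    finally show ?thesis using sum_prob_finite_range[OF At(1) fr] by simp
  qed
  have psd: "0 \<le> (\<Sum>i<m. \<Sum>j<m. b i j * z i * z j)" for z :: "nat \<Rightarrow> real"
    unfolding form1 by (intro sum_nonneg mult_nonneg_nonneg) auto
  have contr: "(\<Sum>i<m. \<Sum>j<m. b i j * z i * z j) \<le> (\<Sum>i<m. (z i)\<^sup>2)" for z :: "nat \<Rightarrow> real"
  proof -
    have "(\<Sum>i<m. \<Sum>j<m. b i j * z i * z j) \<le> (\<Sum>Act\<in>?P. pr Act * (\<Sum>i<m. (z i)\<^sup>2))"
      unfolding form1 using sum_norm_mix_step_le[of _ m z] by (intro sum_mono[of ?P] mult_left_mono) auto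
    also have "\<dots> = (\<Sum>i<m. (z i)\<^sup>2)"
      using sum_prob_finite_range[OF At(1) fr] by (simp flip: sum_distrib_right)
    finally show ?thesis .
  qed
  note lam = lambda2_bounds[of m b, OF m sym rows psd contr, folded B]
  show "0 \<le> lambda2 (exp_mixing_sq M m At)" "lambda2 (exp_mixing_sq M m At) \<le> 1"
    using lam(1,2) by auto
  assume y: "(\<Sum>i<m. y i) = 0"
  \<comment> \<open>Each coordinate family of \<open>y\<close> again sums to zero, so the scalar
    bound holds per basis vector, and summing over \<open>Basis\<close> gives the vector
    bound.\<close>
  have comp: "(\<Sum>i<m. \<Sum>j<m. b i j * (y i \<bullet> u) * (y j \<bullet> u))
      \<le> lambda2 (exp_mixing_sq M m At) * (\<Sum>i<m. (y i \<bullet> u)\<^sup>2)" for u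
    using lam(3)[of "\<lambda>i. y i \<bullet> u"] y by (simp flip: inner_sum_left)
  have "(\<Sum>i<m. \<Sum>j<m. b i j * (y i \<bullet> y j)) = (\<Sum>i<m. \<Sum>j<m. \<Sum>u\<in>Basis. b i j * (y i \<bullet> u) * (y j \<bullet> u))"
    by (subst euclidean_inner) (simp add: sum_distrib_left mult.assoc)
  also have "\<dots> = (\<Sum>i<m. \<Sum>u\<in>Basis. \<Sum>j<m. b i j * (y i \<bullet> u) * (y j \<bullet> u))"
    by (intro sum.cong refl sum.swap)
  also have "\<dots> = (\<Sum>u\<in>Basis. \<Sum>i<m. \<Sum>j<m. b i j * (y i \<bullet> u) * (y j \<bullet> u))"
    by (rule sum.swap)
  also have "\<dots> \<le> (\<Sum>u\<in>Basis. lambda2 (exp_mixing_sq M m At) * (\<Sum>i<m. (y i \<bullet> u)\<^sup>2))"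
    by (intro sum_mono comp)
  also have "\<dots> = lambda2 (exp_mixing_sq M m At) * (\<Sum>i<m. \<Sum>u\<in>Basis. (y i \<bullet> u)\<^sup>2)"
    by (subst sum.swap) (simp add: sum_distrib_left)
  also have "\<dots> = lambda2 (exp_mixing_sq M m At) * (\<Sum>i<m. (norm (y i))\<^sup>2)"
    by (simp add: power2_norm_eq_inner[unfolded power2_eq_square] power2_eq_square flip: euclidean_inner)
  finally show "(\<Sum>Act\<in>?P. pr Act * (\<Sum>i<m. (norm (mix_step Act y i))\<^sup>2))
      \<le> lambda2 (exp_mixing_sq M m At) * (\<Sum>i<m. (norm (y i))\<^sup>2)"
    unfolding form .
qed

end

end

section \<open>Gradients and local steps\<close>

text \<open>Difference quotients along \<open>h\<close> are bounded by \<open>B * norm h\<close>,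
  hence so is their limit. The increment bound is needed only around the single point
  \<open>x\<close>.\<close>

lemma has_derivative_le_lipschitz:
  fixes f :: "'a::real_normed_vector \<Rightarrow> real"
  assumes f: "(f has_derivative f') (at x)"
    and bound: "\<And>y. \<bar>f y - f x\<bar> \<le> B * norm (y - x)"
  shows "\<bar>f' h\<bar> \<le> B * norm h"
proof -
  have lin: "linear f'" using has_derivative_linear[OF f] .
  have "((\<lambda>u::real. x + u *\<^sub>R h) has_derivative (\<lambda>u. u *\<^sub>R h)) (at 0)"
    by (auto intro!: derivative_eq_intros)
  from has_derivative_compose[OF this, of f f'] f
  have "((\<lambda>u::real. f (x + u *\<^sub>R h)) has_derivative (\<lambda>u. f' (u *\<^sub>R h))) (at 0)" by simp
  hence "((\<lambda>u::real. f (x + u *\<^sub>R h)) has_real_derivative f' h) (at 0)"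
    using lin by (simp add: has_field_derivative_def linear_scale mult_commute_abs)
  hence "((\<lambda>u. (f (x + u *\<^sub>R h) - f x) / u) \<longlongrightarrow> f' h) (at 0)"
    by (simp add: has_field_derivative_iff)
  hence "((\<lambda>u. \<bar>(f (x + u *\<^sub>R h) - f x) / u\<bar>) \<longlongrightarrow> \<bar>f' h\<bar>) (at 0)"
    by (rule tendsto_rabs)
  moreover have "\<forall>\<^sub>F u in at (0::real). \<bar>(f (x + u *\<^sub>R h) - f x) / u\<bar> \<le> B * norm h"
  proof (rule eventually_at_filter[THEN iffD2], rule always_eventually, intro allI impI)
    fix u :: real assume "u \<noteq> 0"
    thus "\<bar>(f (x + u *\<^sub>R h) - f x) / u\<bar> \<le> B * norm h"
      using bound[of "x + u *\<^sub>R h"] by (simp add: abs_divide divide_le_eq mult_ac)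
  qed
  ultimately show ?thesis by (rule tendsto_upperbound) simp
qed

text \<open>Differentiation under the integral sign is avoided. The second difference of the loss is
  bounded pointwise by the mean value inequality; this bound integrates to one for \<open>F\<close>,
  and the derivative in \<open>w\<close> at 0 turns it into a bound on the difference of
  gradients.\<close>

lemma lipschitz_gradient_integral:
  fixes l :: "'a::real_inner \<Rightarrow> 's \<Rightarrow> real"
  assumes D: "prob_space D"
    and int: "\<And>x. integrable D (l x)"
    and F: "\<And>x. F x = (\<integral>z. l x z \<partial>D)"
    and l': "\<And>x z. ((\<lambda>y. l y z) has_derivative (\<lambda>h. g x z \<bullet> h)) (at x)"
    and F': "\<And>x. (F has_derivative (\<lambda>h. G x \<bullet> h)) (at x)"
    and lip: "\<And>x y z. norm (g x z - g y z) \<le> K * norm (x - y)"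
  shows "norm (G x - G y) \<le> K * norm (x - y)"
proof -
  interpret D: prob_space D by (rule D)
  define B where "B = K * norm (x - y)"
  have B0: "B \<ge> 0" unfolding B_def using lip[of x undefined y] norm_ge_zero order_trans by blast
  have pointwise: "\<bar>(l (x + w) z - l (y + w) z) - (l x z - l y z)\<bar> \<le> B * norm w" for w z
  proof -
    have der: "((\<lambda>v. l (x + v) z - l (y + v) z) has_derivative
        (\<lambda>h. (g (x + v) z - g (y + v) z) \<bullet> h)) (at v within UNIV)" for v
    proof -
      have shift: "((\<lambda>v. l (a + v) z) has_derivative (\<lambda>h. g (a + v) z \<bullet> h)) (at v)" for a
      proof -
        have "((\<lambda>v. a + v) has_derivative (\<lambda>h. h)) (at v)" by (auto intro!: derivative_eq_intros)
        from has_derivative_compose[OF this l'] show ?thesis .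
      qed
      show ?thesis
        using has_derivative_diff[OF shift[of x] shift[of y]] by (simp add: inner_diff_left)
    qed
    have "onorm (\<lambda>h. (g (x + v) z - g (y + v) z) \<bullet> h) \<le> B" for v
    proof (rule onorm_bound[OF B0])
      fix h
      have "norm ((g (x + v) z - g (y + v) z) \<bullet> h) \<le> norm (g (x + v) z - g (y + v) z) * norm h"
        by (simp add: Cauchy_Schwarz_ineq2)
      also have "\<dots> \<le> B * norm h"
        using lip[of "x + v" z "y + v"] by (intro mult_right_mono) (auto simp: B_def)
      finally show "norm ((g (x + v) z - g (y + v) z) \<bullet> h) \<le> B * norm h" .
    qed
    with der have "norm ((l (x + w) z - l (y + w) z) - (l (x + 0) z - l (y + 0) z)) \<le> B * norm (w - 0)"
      by (intro differentiable_bound[OF convex_UNIV]) auto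
    thus ?thesis by simp
  qed
  have incr: "\<bar>(F (x + w) - F (y + w)) - (F x - F y)\<bar> \<le> B * norm w" for w
  proof -
    have "(F (x + w) - F (y + w)) - (F x - F y)
        = (\<integral>z. (l (x + w) z - l (y + w) z) - (l x z - l y z) \<partial>D)"
      unfolding F by (simp add: int)
    also have "\<bar>\<dots>\<bar> \<le> (\<integral>z. \<bar>(l (x + w) z - l (y + w) z) - (l x z - l y z)\<bar> \<partial>D)"
      by (rule integral_abs_bound)
    also have "\<dots> \<le> (\<integral>z. B * norm w \<partial>D)"
      by (intro integral_mono pointwise) (auto intro!: int Bochner_Integration.integrable_diff)
    finally show ?thesis by (simp add: D.prob_space)
  qed
  have "((\<lambda>w. F (x + w) - F (y + w)) has_derivative (\<lambda>h. (G x - G y) \<bullet> h)) (at 0)"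
  proof -
    have shift: "((\<lambda>v. F (a + v)) has_derivative (\<lambda>h. G a \<bullet> h)) (at 0)" for a
    proof -
      have "((\<lambda>v. a + v) has_derivative (\<lambda>h. h)) (at 0)" by (auto intro!: derivative_eq_intros)
      from has_derivative_compose[OF this, of F "\<lambda>h. G a \<bullet> h"] F'[of a] show ?thesis by simp
    qed
    show ?thesis
      using has_derivative_diff[OF shift[of x] shift[of y]] by (simp add: inner_diff_left)
  qed
  \<comment> \<open>Taking the gradient difference itself as direction makes the derivative its
    squared norm; one factor then cancels.\<close>
  from has_derivative_le_lipschitz[OF this, of B "G x - G y"] incr
  have "norm (G x - G y) * norm (G x - G y) \<le> B * norm (G x - G y)"
    by (simp flip: power2_norm_eq_inner power2_eq_square)
  thus ?thesis using B0 unfolding B_def[symmetric]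
    by (cases "norm (G x - G y) = 0") (auto simp: mult_le_cancel_right)
qed

text \<open>The mean value theorem on the segment gives the constant \<open>K\<close> instead of the
  sharp \<open>K / 2\<close>; the step size leaves room for this. The two-sided form also bounds the
  growth of \<open>F\<close>, which is needed for its integrability.\<close>

lemma descent_lemma:
  fixes F :: "'a::real_inner \<Rightarrow> real"
  assumes F': "\<And>x. (F has_derivative (\<lambda>h. G x \<bullet> h)) (at x)"
    and lip: "\<And>x y. norm (G x - G y) \<le> K * norm (x - y)" and K: "K \<ge> 0"
  shows "\<bar>F y - F x - G x \<bullet> (y - x)\<bar> \<le> K * (norm (y - x))\<^sup>2"
proof -
  define d where "d = y - x"
  have der: "((\<lambda>u. F (x + u *\<^sub>R d)) has_derivative (\<lambda>k. G (x + u *\<^sub>R d) \<bullet> (k *\<^sub>R d))) (at u within {0..1})"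
    for u :: real
  proof -
    have "((\<lambda>u::real. x + u *\<^sub>R d) has_derivative (\<lambda>k. k *\<^sub>R d)) (at u within {0..1})"
      by (auto intro!: derivative_eq_intros)
    from has_derivative_compose[OF this F'] show ?thesis .
  qed
  obtain u where u: "u \<in> {0<..<1}" "F (x + 1 *\<^sub>R d) - F (x + 0 *\<^sub>R d) = G (x + u *\<^sub>R d) \<bullet> ((1 - 0) *\<^sub>R d)"
    using mvt_simple[of 0 1 "\<lambda>u. F (x + u *\<^sub>R d)" "\<lambda>u k. G (x + u *\<^sub>R d) \<bullet> (k *\<^sub>R d)"] der
    by auto
  have "F y - F x - G x \<bullet> d = (G (x + u *\<^sub>R d) - G x) \<bullet> d"
    using u(2) by (simp add: d_def inner_diff_left)
  also have "\<bar>\<dots>\<bar> \<le> norm (G (x + u *\<^sub>R d) - G x) * norm d" by (rule Cauchy_Schwarz_ineq2)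
  also have "\<dots> \<le> (K * norm (u *\<^sub>R d)) * norm d"
    using lip[of "x + u *\<^sub>R d" x] by (intro mult_right_mono) auto
  also have "\<dots> \<le> K * norm d * norm d"
    using u(1) K by (intro mult_right_mono mult_left_mono) (auto simp: mult_left_le_one_le)
  finally show ?thesis by (simp add: d_def power2_eq_square)
qed

section \<open>Several local steps with one sample\<close>

text \<open>A discrete Gronwall argument. The drift grows by the factor \<open>1 + eta * K\<close>
  plus a source term \<open>eta * norm (g x)\<close> in each step, and the linearisation error
  accumulates \<open>eta * K\<close> times the drift; the resulting coefficient is the numerator in
  \<open>kappa\<close>. Both bounds are multiplied by \<open>K\<close> to remain meaningful at
  \<open>K = 0\<close>, where the linearisation is exact.\<close>

lemma local_sgd_deviation:
  fixes g :: "'a::real_normed_vector \<Rightarrow> 'a"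
  assumes lip: "\<And>x y. norm (g x - g y) \<le> K * norm (x - y)" and K: "K \<ge> 0" and eta: "eta > 0"
  shows "K * norm (local_sgd eta k g x - x) \<le> ((1 + eta * K) ^ k - 1) * norm (g x)"
    and "K * norm (local_sgd eta k g x - x + (eta * real k) *\<^sub>R g x)
      \<le> ((1 + eta * K) ^ k - 1 - real k * eta * K) * norm (g x)"
    and "K = 0 \<Longrightarrow> local_sgd eta k g x = x - (eta * real k) *\<^sub>R g x"
proof -
  let ?x = "\<lambda>k. local_sgd eta k g x"
  let ?e = "\<lambda>k. ?x k - x + (eta * real k) *\<^sub>R g x"
  let ?a = "eta * K"
  have step: "?x (Suc k) = ?x k - eta *\<^sub>R g (?x k)" for k by (simp add: local_sgd_def)
  show drift: "K * norm (?x k - x) \<le> ((1 + ?a) ^ k - 1) * norm (g x)" for k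
  proof (induction k)
    case (Suc k)
    have "norm (g (?x k)) \<le> norm (g x) + norm (g (?x k) - g x)" by (rule norm_triangle_sub)
    also have "\<dots> \<le> norm (g x) + K * norm (?x k - x)" using lip by simp
    finally have gx: "norm (g (?x k)) \<le> norm (g x) + K * norm (?x k - x)" .
    have "norm (?x (Suc k) - x) \<le> norm (?x k - x) + norm (eta *\<^sub>R g (?x k))"
      unfolding step using norm_triangle_ineq4[of "?x k - x" "eta *\<^sub>R g (?x k)"] by (simp add: algebra_simps)
    also have "\<dots> \<le> norm (?x k - x) + eta * (norm (g x) + K * norm (?x k - x))"
      using gx eta by simp
    finally have "K * norm (?x (Suc k) - x)
        \<le> K * (norm (?x k - x) + eta * (norm (g x) + K * norm (?x k - x)))"
      using K by (rule mult_left_mono)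
    also have "\<dots> = (1 + ?a) * (K * norm (?x k - x)) + ?a * norm (g x)" by (simp add: algebra_simps)
    also have "\<dots> \<le> (1 + ?a) * (((1 + ?a) ^ k - 1) * norm (g x)) + ?a * norm (g x)"
      using Suc K eta by (intro add_right_mono mult_left_mono) auto
    also have "\<dots> = ((1 + ?a) ^ Suc k - 1) * norm (g x)" by (simp add: algebra_simps)
    finally show ?case .
  qed (simp add: local_sgd_def)
  have e_step: "norm (?e (Suc k)) \<le> norm (?e k) + eta * (K * norm (?x k - x))" for k
  proof -
    have "?e (Suc k) = ?e k + eta *\<^sub>R (g x - g (?x k))" by (simp add: step algebra_simps)
    also have "norm \<dots> \<le> norm (?e k) + norm (eta *\<^sub>R (g x - g (?x k)))" by (rule norm_triangle_ineq)
    also have "\<dots> \<le> norm (?e k) + eta * (K * norm (?x k - x))"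
      using lip[of x "?x k"] eta by (simp add: norm_minus_commute)
    finally show ?thesis .
  qed
  show "K * norm (?e k) \<le> ((1 + ?a) ^ k - 1 - real k * eta * K) * norm (g x)"
  proof (induction k)
    case (Suc k)
    have "K * norm (?e (Suc k)) \<le> K * (norm (?e k) + eta * (K * norm (?x k - x)))"
      using e_step K by (rule mult_left_mono)
    also have "\<dots> = K * norm (?e k) + ?a * (K * norm (?x k - x))" by (simp add: algebra_simps)
    also have "\<dots> \<le> ((1 + ?a) ^ k - 1 - real k * eta * K) * norm (g x) + ?a * (((1 + ?a) ^ k - 1) * norm (g x))"
      using Suc drift[of k] K eta by (intro add_mono mult_left_mono) auto
    also have "\<dots> = ((1 + ?a) ^ Suc k - 1 - real (Suc k) * eta * K) * norm (g x)" by (simp add: algebra_simps)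
    finally show ?case .
  qed (simp add: local_sgd_def)
  assume "K = 0"
  hence "norm (?e (Suc j)) \<le> norm (?e j)" for j using e_step[of j] by simp
  hence "norm (?e k) \<le> norm (?e 0)" by (rule lift_Suc_antimono_le) simp
  hence "norm (?e k) \<le> 0" by (simp add: local_sgd_def)
  thus "?x k = x - (eta * real k) *\<^sub>R g x" by (simp add: algebra_simps)
qed

text \<open>Bernoulli's inequality makes the numerator nonnegative; for a vanishing Lipschitz
  constant the quotient is 0 by the convention for division by 0.\<close>

lemma kappa_nonneg:
  assumes "m > 0" "eta > 0" "\<And>i. i < m \<Longrightarrow> Lc i \<ge> 0"
  shows "kappa m eta s Lc \<ge> 0"
proof -
  have "0 \<le> ((1 + eta * Lc 0) ^ s - 1 - real s * eta * Lc 0) / (real (s choose 2) * (eta * Lc 0)\<^sup>2)"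
  proof (intro divide_nonneg_nonneg)
    have "0 \<le> eta * Lc 0" using assms by simp
    with Bernoulli_inequality[of "eta * Lc 0" s]
    show "0 \<le> (1 + eta * Lc 0) ^ s - 1 - real s * eta * Lc 0" by (simp add: mult_ac)
  qed auto
  also have "\<dots> \<le> Max ((\<lambda>i. ((1 + eta * Lc i) ^ s - 1 - real s * eta * Lc i) /
      (real (s choose 2) * (eta * Lc i)\<^sup>2)) ` {..<m})"
    using assms(1) by (intro Max_ge) auto
  finally show ?thesis by (simp add: kappa_def)
qed

text \<open>The maximum in \<open>kappa\<close> bounds the numerator by a multiple of
  \<open>(eta * Lc i)\<^sup>2\<close>. One factor \<open>Lc i\<close> cancels against the left side
  of the deviation bound, and \<open>s choose 2\<close> is at most half of the square of
  \<open>s\<close>.\<close>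

lemma local_sgd_kappa:
  fixes g :: "'a::real_normed_vector \<Rightarrow> 'a"
  assumes lip: "\<And>x y. norm (g x - g y) \<le> Lc i * norm (x - y)" and nonneg: "\<And>i. i < m \<Longrightarrow> Lc i \<ge> 0"
    and i: "i < m" and L: "Lc i \<le> L" and eta: "eta > 0" and s: "s \<ge> 1"
  shows "norm (local_sgd eta s g x - x + (eta * real s) *\<^sub>R g x)
    \<le> eta * real s * (kappa m eta s Lc * real s * eta * L / 2) * norm (g x)"
proof -
  let ?K = "Lc i" and ?k = "kappa m eta s Lc"
  let ?e = "norm (local_sgd eta s g x - x + (eta * real s) *\<^sub>R g x)"
  have kap: "?k \<ge> 0" using kappa_nonneg[of m eta Lc s] i eta nonneg by simp
  have L0: "L \<ge> 0" using nonneg[OF i] L by simp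
  have rhs: "0 \<le> eta * real s * (?k * real s * eta * L / 2) * norm (g x)"
    using kap L0 eta by simp
  \<comment> \<open>In the first two cases the local phase is exactly one step of length
    \<open>eta * s\<close>; only the third has a nontrivial quotient in
    \<open>kappa\<close>.\<close>
  consider "?K = 0" | "s = 1" | "?K > 0" "s \<ge> 2" using nonneg[OF i] s by fastforce
  thus ?thesis
  proof cases
    case 1
    thus ?thesis using local_sgd_deviation(3)[OF lip nonneg[OF i] eta 1] rhs by simp
  next
    case 2
    thus ?thesis using rhs by (simp add: local_sgd_def)
  next
    case 3
    define f where "f = (1 + eta * ?K) ^ s - 1 - real s * eta * ?K"
    have "f / (real (s choose 2) * (eta * ?K)\<^sup>2) \<le> ?k"
      using i 3 by (auto simp: kappa_def f_def intro!: Max_ge)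
    moreover have "real (s choose 2) * (eta * ?K)\<^sup>2 > 0" using 3 eta by simp
    ultimately have f: "f \<le> ?k * (real (s choose 2) * (eta * ?K)\<^sup>2)" by (simp only: pos_divide_le_eq)
    have "(s choose 2) * 2 \<le> s * (s - 1)" unfolding choose_two by (rule div_times_less_eq_dividend)
    also have "\<dots> \<le> s * s" by simp
    finally have "real ((s choose 2) * 2) \<le> real (s * s)" by (simp only: of_nat_le_iff)
    hence "real (s choose 2) \<le> real s * real s / 2" by simp
    hence "?k * (real (s choose 2) * (eta * ?K)\<^sup>2) \<le> ?k * ((real s * real s / 2) * (eta * ?K)\<^sup>2)"
      using kap by (intro mult_left_mono mult_right_mono) auto
    with f have f': "f \<le> ?k * ((real s * real s / 2) * (eta * ?K)\<^sup>2)" by simp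
    have "?K * ?e \<le> f * norm (g x)"
      unfolding f_def using local_sgd_deviation(2)[OF lip nonneg[OF i] eta] .
    also have "\<dots> \<le> (?k * ((real s * real s / 2) * (eta * ?K)\<^sup>2)) * norm (g x)"
      using f' by (intro mult_right_mono) auto
    also have "\<dots> = ?K * (eta * real s * (?k * real s * eta * ?K / 2) * norm (g x))"
      by (simp add: power2_eq_square mult_ac)
    finally have "?e \<le> eta * real s * (?k * real s * eta * ?K / 2) * norm (g x)"
      using 3 by (simp only: mult_le_cancel_left_pos)
    also have "\<dots> \<le> eta * real s * (?k * real s * eta * L / 2) * norm (g x)"
      using L kap eta by (intro mult_right_mono mult_left_mono divide_right_mono) auto
    finally show ?thesis .
  qed
qed

text \<open>Each coordinate of the gradient is a pointwise limit of difference quotients of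
  measurable losses, along the steps 1 / (n + 1).\<close>

lemma gradient_measurable:
  fixes l :: "'a::euclidean_space \<Rightarrow> 's \<Rightarrow> real"
  assumes l: "\<And>x. l x \<in> borel_measurable N"
    and g: "\<And>x z. ((\<lambda>y. l y z) has_derivative (\<lambda>h. g x z \<bullet> h)) (at x)"
  shows "g x \<in> borel_measurable N"
proof (rule borel_measurable_euclidean_space[THEN iffD2], intro ballI)
  fix b :: 'a
  show "(\<lambda>z. g x z \<bullet> b) \<in> borel_measurable N"
  proof (rule borel_measurable_LIMSEQ_real)
    fix z
    have "((\<lambda>u::real. x + u *\<^sub>R b) has_derivative (\<lambda>u. u *\<^sub>R b)) (at 0)"
      by (auto intro!: derivative_eq_intros)
    from has_derivative_compose[OF this, of "\<lambda>y. l y z" "\<lambda>h. g x z \<bullet> h"] g[of z x]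
    have "((\<lambda>u::real. l (x + u *\<^sub>R b) z) has_derivative (\<lambda>u. g x z \<bullet> (u *\<^sub>R b))) (at 0)" by simp
    hence "((\<lambda>u::real. l (x + u *\<^sub>R b) z) has_real_derivative (g x z \<bullet> b)) (at 0)"
      by (simp add: has_field_derivative_def mult_commute_abs)
    hence lim: "((\<lambda>u. (l (x + u *\<^sub>R b) z - l x z) / u) \<longlongrightarrow> g x z \<bullet> b) (at 0)"
      by (simp add: has_field_derivative_iff)
    have "filterlim (\<lambda>n. inverse (real (Suc n))) (at 0) sequentially"
      using LIMSEQ_inverse_real_of_nat by (simp add: filterlim_at)
    from filterlim_compose[OF lim this]
    show "(\<lambda>n. (l (x + inverse (real (Suc n)) *\<^sub>R b) z - l x z) / inverse (real (Suc n))) \<longlonglongrightarrow> g x z \<bullet> b" .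
  next
    show "(\<lambda>z. (l (x + inverse (real (Suc n)) *\<^sub>R b) z - l x z) / inverse (real (Suc n))) \<in> borel_measurable N" for n
      using l by measurable
  qed
qed

section \<open>Conditional bounds and square integrability\<close>

lemma measurable_simple_compose:
  assumes f: "\<And>v. (\<lambda>x. f v x) \<in> N \<rightarrow>\<^sub>M K" and F: "simple_function N F"
  shows "(\<lambda>x. f (F x) x) \<in> N \<rightarrow>\<^sub>M K"
proof (rule measurable_compose_countable'[where I = "F ` space N"])
  show "F \<in> N \<rightarrow>\<^sub>M count_space (F ` space N)"
    using F by (intro measurable_count_space_eq2[THEN iffD2]) (auto simp: simple_function_def)
  show "countable (F ` space N)" using F by (simp add: simple_function_def countable_finite)
qed (rule f)

text \<open>Caratheodory functions: measurability in the sample and continuity in the model replace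
  joint measurability when a gradient is evaluated at a random iterate.\<close>

lemma measurable_caratheodory:
  fixes f :: "'a::{metric_space, second_countable_topology} \<Rightarrow> 'w \<Rightarrow> 'b::metric_space"
  assumes f: "\<And>v. f v \<in> borel_measurable N"
    and cont: "\<And>x. x \<in> space N \<Longrightarrow> continuous_on UNIV (\<lambda>v. f v x)"
    and X: "X \<in> borel_measurable N"
  shows "(\<lambda>x. f (X x) x) \<in> borel_measurable N"
proof -
  obtain F where F: "\<And>i. simple_function N (F i)"
      "\<And>x. x \<in> space N \<Longrightarrow> (\<lambda>i. F i x) \<longlonglongrightarrow> X x"
    using borel_measurable_implies_sequence_metric[OF X, of undefined] by blast
  show ?thesis
  proof (rule borel_measurable_LIMSEQ_metric)
    show "(\<lambda>x. f (F i x) x) \<in> borel_measurable N" for i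
      using f F(1) by (rule measurable_simple_compose)
    show "(\<lambda>i. f (F i x) x) \<longlonglongrightarrow> f (X x) x" if "x \<in> space N" for x
      using continuous_on_tendsto_compose[OF cont[OF that] F(2)[OF that]] by simp
  qed
qed

text \<open>A conditional bound known only at each fixed point \<open>v\<close> is transferred to a random point \<open>X\<close>
  through simple functions converging to \<open>X\<close>: on each level set the point is fixed, and Fatou's lemma
  passes to the limit.\<close>

lemma (in prob_space) nn_integral_frozen_le:
  fixes h :: "'v::{metric_space, second_countable_topology} \<Rightarrow> 'a \<Rightarrow> real"
  assumes sub: "subalgebra M N"
    and h: "\<And>v. h v \<in> borel_measurable M"
    and cont: "\<And>\<omega>. \<omega> \<in> space M \<Longrightarrow> continuous_on UNIV (\<lambda>v. h v \<omega>)"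
    and bound: "\<And>v. AE \<omega> in M. nn_cond_exp M N (\<lambda>\<omega>. ennreal (h v \<omega>)) \<omega> \<le> c"
    and X: "X \<in> borel_measurable N"
  shows "(\<integral>\<^sup>+\<omega>. ennreal (h (X \<omega>) \<omega>) \<partial>M) \<le> c"
proof -
  have sp: "space N = space M" using sub by (simp add: subalgebra_def)
  interpret sigma_finite_subalgebra M N
    by (intro finite_measure_subalgebra_is_sigma_finite finite_measure_subalgebra.intro
        finite_measure_subalgebra_axioms.intro sub finite_measure_axioms)
  obtain F where F: "\<And>i. simple_function N (F i)"
      "\<And>x. x \<in> space N \<Longrightarrow> (\<lambda>i. F i x) \<longlonglongrightarrow> X x"
    using borel_measurable_implies_sequence_metric[OF X, of undefined] by blast
  have meas: "(\<lambda>\<omega>. h (F i \<omega>) \<omega>) \<in> borel_measurable M" for i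
  proof (rule measurable_simple_compose[OF h])
    have "sets N \<subseteq> sets M" using sub by (simp add: subalgebra_def)
    with F(1)[of i] sp show "simple_function M (F i)" unfolding simple_function_def by auto
  qed
  have simple: "(\<integral>\<^sup>+\<omega>. ennreal (h (F i \<omega>) \<omega>) \<partial>M) \<le> c" for i
  proof -
    let ?R = "F i ` space M"
    have fin: "finite ?R" using F(1)[of i] sp by (simp add: simple_function_def)
    let ?I = "\<lambda>v. indicator (F i -` {v} \<inter> space M) :: 'a \<Rightarrow> ennreal"
    have IN: "?I v \<in> borel_measurable N" if "v \<in> ?R" for v
      using F(1)[of i] sp that by (intro borel_measurable_indicator) (auto simp: simple_function_def)
    have IM: "?I v \<in> borel_measurable M" if "v \<in> ?R" for v
      using measurable_from_subalg[OF sub IN[OF that]] .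
    have split: "(\<Sum>v\<in>?R. ?I v \<omega> * k v) = k (F i \<omega>)" if "\<omega> \<in> space M" for k \<omega>
    proof -
      have "(\<Sum>v\<in>?R. ?I v \<omega> * k v) = (\<Sum>v\<in>?R. if F i \<omega> = v then k v else 0)"
        using that by (intro sum.cong) (auto simp: indicator_def)
      thus ?thesis using fin that by simp
    qed
    have "(\<integral>\<^sup>+\<omega>. ennreal (h (F i \<omega>) \<omega>) \<partial>M) = (\<integral>\<^sup>+\<omega>. (\<Sum>v\<in>?R. ?I v \<omega> * ennreal (h v \<omega>)) \<partial>M)"
      by (intro nn_integral_cong) (simp add: split)
    also have "\<dots> = (\<Sum>v\<in>?R. \<integral>\<^sup>+\<omega>. ?I v \<omega> * ennreal (h v \<omega>) \<partial>M)"
      using h IM by (intro nn_integral_sum) auto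
    also have "\<dots> = (\<Sum>v\<in>?R. \<integral>\<^sup>+\<omega>. ?I v \<omega> * nn_cond_exp M N (\<lambda>\<omega>. ennreal (h v \<omega>)) \<omega> \<partial>M)"
      using h IN by (intro sum.cong refl nn_cond_exp_intg[symmetric]) auto
    also have "\<dots> \<le> (\<Sum>v\<in>?R. \<integral>\<^sup>+\<omega>. ?I v \<omega> * c \<partial>M)"
    proof (intro sum_mono nn_integral_mono_AE)
      fix v show "AE \<omega> in M. ?I v \<omega> * nn_cond_exp M N (\<lambda>\<omega>. ennreal (h v \<omega>)) \<omega> \<le> ?I v \<omega> * c"
        using bound[of v] by eventually_elim (simp add: mult_left_mono)
    qed
    also have "\<dots> = (\<integral>\<^sup>+\<omega>. (\<Sum>v\<in>?R. ?I v \<omega> * c) \<partial>M)"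
      using IM by (intro nn_integral_sum[symmetric]) auto
    also have "\<dots> = (\<integral>\<^sup>+\<omega>. c \<partial>M)"
      by (intro nn_integral_cong) (simp add: split)
    also have "\<dots> = c" by (simp add: emeasure_space_1)
    finally show ?thesis .
  qed
  have "(\<integral>\<^sup>+\<omega>. ennreal (h (X \<omega>) \<omega>) \<partial>M) = (\<integral>\<^sup>+\<omega>. liminf (\<lambda>i. ennreal (h (F i \<omega>) \<omega>)) \<partial>M)"
  proof (intro nn_integral_cong)
    fix \<omega> assume w: "\<omega> \<in> space M"
    hence "(\<lambda>i. h (F i \<omega>) \<omega>) \<longlonglongrightarrow> h (X \<omega>) \<omega>"
      using continuous_on_tendsto_compose[OF cont[OF w] F(2)] sp by simp
    hence "(\<lambda>i. ennreal (h (F i \<omega>) \<omega>)) \<longlonglongrightarrow> ennreal (h (X \<omega>) \<omega>)" by (rule tendsto_ennrealI)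
    thus "ennreal (h (X \<omega>) \<omega>) = liminf (\<lambda>i. ennreal (h (F i \<omega>) \<omega>))"
      by (intro lim_imp_Liminf[symmetric]) auto
  qed
  also have "\<dots> \<le> liminf (\<lambda>i. \<integral>\<^sup>+\<omega>. ennreal (h (F i \<omega>) \<omega>) \<partial>M)"
    using meas by (intro nn_integral_liminf) auto
  also have "\<dots> \<le> limsup (\<lambda>i. \<integral>\<^sup>+\<omega>. ennreal (h (F i \<omega>) \<omega>) \<partial>M)"
    by (intro Liminf_le_Limsup) auto
  also have "\<dots> \<le> c" by (intro Limsup_bounded always_eventually allI simple)
  finally show ?thesis .
qed

text \<open>Independence says that the conditional probability of \<open>E\<close> given
  \<open>N\<close> is the constant \<open>prob E\<close>, and \<open>f\<close>, being
  \<open>N\<close>-measurable, can be taken out of the conditional expectation.\<close>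

lemma (in prob_space) integral_indep_event:
  fixes f :: "'a \<Rightarrow> real"
  assumes sub: "subalgebra M N" and E: "E \<in> sets M"
    and indep: "\<And>a. a \<in> sets N \<Longrightarrow> prob (a \<inter> E) = prob a * prob E"
    and f: "f \<in> borel_measurable N" "integrable M f"
  shows "(\<integral>\<omega>. indicator E \<omega> * f \<omega> \<partial>M) = prob E * (\<integral>\<omega>. f \<omega> \<partial>M)"
proof -
  interpret sigma_finite_subalgebra M N
    by (intro finite_measure_subalgebra_is_sigma_finite finite_measure_subalgebra.intro
        finite_measure_subalgebra_axioms.intro sub finite_measure_axioms)
  have ce: "AE \<omega> in M. real_cond_exp M N (indicator E) \<omega> = prob E"
  proof (rule real_cond_exp_charact)
    fix a assume a: "a \<in> sets N"
    hence aM: "a \<in> sets M" using sub by (auto simp: subalgebra_def)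
    have "(\<integral>\<omega>\<in>a. indicator E \<omega> \<partial>M) = (\<integral>\<omega>. indicator (a \<inter> E) \<omega> \<partial>M)"
      unfolding set_lebesgue_integral_def
      by (intro Bochner_Integration.integral_cong) (auto simp: indicator_def)
    also have "\<dots> = prob a * prob E" using aM E indep[OF a] by simp
    finally show "(\<integral>\<omega>\<in>a. indicator E \<omega> \<partial>M) = (\<integral>\<omega>\<in>a. prob E \<partial>M)"
      using aM by (simp add: set_lebesgue_integral_def)
  qed (use E in \<open>auto simp: emeasure_eq_measure intro!: integrable_real_indicator\<close>)
  have int: "integrable M (\<lambda>\<omega>. f \<omega> * indicator E \<omega>)"
    using integrable_mult_indicator[OF E f(2)] by (simp add: mult.commute)
  have "(\<integral>\<omega>. f \<omega> * indicator E \<omega> \<partial>M) = (\<integral>\<omega>. f \<omega> * real_cond_exp M N (indicator E) \<omega> \<partial>M)"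
    using real_cond_exp_intg(2)[OF int f(1)] E by simp
  also have "\<dots> = (\<integral>\<omega>. f \<omega> * prob E \<partial>M)"
    using ce measurable_from_subalg[OF sub f(1)] by (intro integral_cong_AE) auto
  finally show ?thesis by (simp add: mult.commute)
qed

section \<open>Random vectors with finite second moment\<close>

definition square_integrable :: "'w measure \<Rightarrow> ('w \<Rightarrow> 'b::euclidean_space) \<Rightarrow> bool" where
  "square_integrable M f \<longleftrightarrow> f \<in> borel_measurable M \<and> integrable M (\<lambda>\<omega>. (norm (f \<omega>))\<^sup>2)"

lemma square_integrable_bound:
  assumes f: "f \<in> borel_measurable M" and g: "integrable M g"
    and le: "\<And>\<omega>. \<omega> \<in> space M \<Longrightarrow> (norm (f \<omega>))\<^sup>2 \<le> g \<omega>"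
  shows "square_integrable M f"
  unfolding square_integrable_def
proof
  show "integrable M (\<lambda>\<omega>. (norm (f \<omega>))\<^sup>2)"
  proof (rule Bochner_Integration.integrable_bound[OF g])
    show "AE \<omega> in M. norm ((norm (f \<omega>))\<^sup>2) \<le> norm (g \<omega>)"
      using order_trans[OF le abs_ge_self] by (intro AE_I2) simp
  qed (use f in measurable)
qed (rule f)

lemma square_integrable_measurable: "square_integrable M f \<Longrightarrow> f \<in> borel_measurable M"
  and square_integrable_norm: "square_integrable M f \<Longrightarrow> integrable M (\<lambda>\<omega>. (norm (f \<omega>))\<^sup>2)"
  by (auto simp: square_integrable_def)

lemma power2_norm_add_le: "(norm (x + y :: 'a::real_normed_vector))\<^sup>2 \<le> 2 * (norm x)\<^sup>2 + 2 * (norm y)\<^sup>2"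
proof -
  have "(norm (x + y))\<^sup>2 \<le> (norm x + norm y)\<^sup>2" by (intro power_mono norm_triangle_ineq) auto
  also have "\<dots> \<le> 2 * (norm x)\<^sup>2 + 2 * (norm y)\<^sup>2"
    using sum_squares_bound[of "norm x" "norm y"] by (simp add: power2_sum)
  finally show ?thesis .
qed

lemma square_integrable_add:
  assumes "square_integrable M f" "square_integrable M g"
  shows "square_integrable M (\<lambda>\<omega>. f \<omega> + g \<omega>)"
proof (rule square_integrable_bound)
  show "integrable M (\<lambda>\<omega>. 2 * (norm (f \<omega>))\<^sup>2 + 2 * (norm (g \<omega>))\<^sup>2)"
    using assms by (simp add: square_integrable_def)
qed (use assms in \<open>auto simp: square_integrable_def power2_norm_add_le\<close>)

lemma square_integrable_scaleR:
  "square_integrable M f \<Longrightarrow> square_integrable M (\<lambda>\<omega>. c *\<^sub>R f \<omega>)"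
  by (auto simp: square_integrable_def power_mult_distrib intro!: borel_measurable_scaleR)

lemma square_integrable_diff:
  assumes "square_integrable M f" "square_integrable M g"
  shows "square_integrable M (\<lambda>\<omega>. f \<omega> - g \<omega>)"
  using square_integrable_add[OF assms(1) square_integrable_scaleR[OF assms(2), of "-1"]] by simp

lemma square_integrable_sum:
  "finite I \<Longrightarrow> (\<And>i. i \<in> I \<Longrightarrow> square_integrable M (f i)) \<Longrightarrow> square_integrable M (\<lambda>\<omega>. \<Sum>i\<in>I. f i \<omega>)"
proof (induction I rule: finite_induct)
  case empty
  show ?case by (simp add: square_integrable_def)
qed (simp add: square_integrable_add)

lemma square_integrable_inner:
  fixes f g :: "'w \<Rightarrow> 'b::euclidean_space"
  assumes "square_integrable M f" "square_integrable M g"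
  shows "integrable M (\<lambda>\<omega>. f \<omega> \<bullet> g \<omega>)"
proof (rule Bochner_Integration.integrable_bound)
  show "integrable M (\<lambda>\<omega>. (norm (f \<omega>))\<^sup>2 + (norm (g \<omega>))\<^sup>2)"
    using assms by (simp add: square_integrable_def)
  show "(\<lambda>\<omega>. f \<omega> \<bullet> g \<omega>) \<in> borel_measurable M"
    using assms by (auto simp: square_integrable_def)
  show "AE \<omega> in M. norm (f \<omega> \<bullet> g \<omega>) \<le> norm ((norm (f \<omega>))\<^sup>2 + (norm (g \<omega>))\<^sup>2)"
  proof (intro AE_I2)
    fix \<omega>
    have "\<bar>f \<omega> \<bullet> g \<omega>\<bar> \<le> norm (f \<omega>) * norm (g \<omega>)" by (rule Cauchy_Schwarz_ineq2)
    also have "\<dots> \<le> 2 * norm (f \<omega>) * norm (g \<omega>)" by simp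
    also have "\<dots> \<le> (norm (f \<omega>))\<^sup>2 + (norm (g \<omega>))\<^sup>2" by (rule sum_squares_bound)
    finally show "norm (f \<omega> \<bullet> g \<omega>) \<le> norm ((norm (f \<omega>))\<^sup>2 + (norm (g \<omega>))\<^sup>2)" by simp
  qed
qed

lemma lipschitz_imp_continuous_on:
  fixes G :: "'a::real_normed_vector \<Rightarrow> 'b::real_normed_vector"
  assumes "\<And>x y. norm (G x - G y) \<le> K * norm (x - y)"
  shows "continuous_on UNIV G"
proof (rule lipschitz_on_continuous_on)
  show "(max K 0)-lipschitz_on UNIV G"
  proof (rule lipschitz_onI)
    fix x y :: "'a"
    have "K * norm (x - y) \<le> max K 0 * norm (x - y)" by (intro mult_right_mono) auto
    with assms[of x y] show "dist (G x) (G y) \<le> max K 0 * dist x y" by (simp add: dist_norm)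
  qed simp
qed

text \<open>A Lipschitz map grows at most linearly, and constants are integrable for a finite
  measure.\<close>

lemma square_integrable_comp_lipschitz:
  fixes G :: "'a::euclidean_space \<Rightarrow> 'b::euclidean_space"
  assumes M: "finite_measure M" and f: "square_integrable M f"
    and lip: "\<And>x y. norm (G x - G y) \<le> K * norm (x - y)"
  shows "square_integrable M (\<lambda>\<omega>. G (f \<omega>))"
proof (rule square_integrable_bound)
  interpret finite_measure M by (rule M)
  have "continuous_on UNIV G" using lip by (rule lipschitz_imp_continuous_on)
  thus "(\<lambda>\<omega>. G (f \<omega>)) \<in> borel_measurable M"
    using f by (auto intro: borel_measurable_continuous_onI measurable_compose simp: square_integrable_def)
  show "integrable M (\<lambda>\<omega>. 2 * (norm (G 0))\<^sup>2 + 2 * (K\<^sup>2 * (norm (f \<omega>))\<^sup>2))"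
    using f by (simp add: square_integrable_def)
  show "(norm (G (f \<omega>)))\<^sup>2 \<le> 2 * (norm (G 0))\<^sup>2 + 2 * (K\<^sup>2 * (norm (f \<omega>))\<^sup>2)" for \<omega>
  proof -
    have "(norm (G (f \<omega>)))\<^sup>2 \<le> 2 * (norm (G 0))\<^sup>2 + 2 * (norm (G (f \<omega>) - G 0))\<^sup>2"
      using power2_norm_add_le[of "G 0" "G (f \<omega>) - G 0"] by simp
    moreover have "(norm (G (f \<omega>) - G 0))\<^sup>2 \<le> (K * norm (f \<omega>))\<^sup>2"
      using lip[of "f \<omega>" 0] by (intro power_mono) auto
    ultimately show ?thesis by (simp add: power_mult_distrib)
  qed
qed

section \<open>Summing the recursions\<close>

text \<open>Shifting the index costs nothing since \<open>C 0 = 0\<close>, so summing the recursion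
  replaces unrolling it into a geometric series.\<close>

lemma sum_linear_recursion_le:
  fixes C G :: "nat \<Rightarrow> real"
  assumes "C 0 = 0" "\<And>t. C t \<ge> 0" and rec: "\<And>t. C (Suc t) \<le> q * C t + B * G t"
  shows "(1 - q) * (\<Sum>t<T. C t) \<le> B * (\<Sum>t<T. G t)"
proof -
  have "(\<Sum>t<T. C t) \<le> (\<Sum>t<Suc T. C t)" using assms(2) by simp
  also have "\<dots> = (\<Sum>t<T. C (Suc t))" using assms(1) by (subst sum.lessThan_Suc_shift) simp
  also have "\<dots> \<le> (\<Sum>t<T. q * C t + B * G t)" by (intro sum_mono rec)
  also have "\<dots> = q * (\<Sum>t<T. C t) + B * (\<Sum>t<T. G t)" by (simp add: sum.distrib sum_distrib_left)
  finally show ?thesis by (simp add: algebra_simps)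
qed

text \<open>Pure algebra of real sequences. \<open>a\<close>, \<open>C\<close> and \<open>G\<close>
  stand for the expected squared gradient at the average, the consensus error and the second moment
  of stochastic gradients, \<open>\<Phi>\<close> for the expected objective; \<open>r\<close> is 1
  minus the square root of \<open>rho\<close>, \<open>b\<close> is \<open>beta\<^sup>2 + 1\<close>,
  and \<open>N\<close> is \<open>sigma\<^sup>2 + zeta\<^sup>2\<close>.\<close>

lemma stationarity_from_recursions:
  fixes a C G \<Phi> :: "nat \<Rightarrow> real"
  assumes h: "h > 0" and L: "L \<ge> 1" and r: "r > 0" "r \<le> 1" and kap: "kap \<ge> 0" and b: "b \<ge> 1"
    and N: "N \<ge> 0" and T: "T \<ge> 1"
    and h_le: "h \<le> r / (108 * L\<^sup>2 * b * (1 + kap\<^sup>2 * L\<^sup>2))"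
    and theta: "\<theta> = kap * h * L / 2"
    and nonneg: "\<And>t. a t \<ge> 0" "\<And>t. C t \<ge> 0" "\<And>t. G t \<ge> 0"
    and G: "\<And>t. G t \<le> 4 * N + 4 * b * a t + 4 * L\<^sup>2 * C t"
    and C0: "C 0 = 0" and C: "\<And>t. C (Suc t) \<le> (1 - r) * C t + (h * (1 + \<theta>))\<^sup>2 / r * G t"
    and \<Phi>: "\<And>t. \<Phi> (Suc t) \<le> \<Phi> t - 7 / 16 * h * a t + h / 2 * L\<^sup>2 * C t
        + (4 * h * \<theta>\<^sup>2 + L * (h * (1 + \<theta>))\<^sup>2) * G t"
    and lower: "\<And>t. \<Phi> t \<ge> F"
  shows "1 / real T * (\<Sum>t<T. a t) \<le> 6 * (\<Phi> 0 - F) / (h * real T)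
      + 54 * h * L * (kap\<^sup>2 * L\<^sup>2 + 1 + 1 / r) * N"
proof -
  define K where "K = 1 + kap\<^sup>2 * L\<^sup>2"
  \<comment> \<open>The step length amplified by the spectral gap: the total consensus error is at
    most \<open>2 * u\<^sup>2\<close> times the total gradient moment, so \<open>L * u\<close> is
    the small parameter.\<close>
  define u where "u = h / r"
  define SA SC SG where "SA = (\<Sum>t<T. a t)" and "SC = (\<Sum>t<T. C t)" and "SG = (\<Sum>t<T. G t)"
  define NT where "NT = N * real T"
  define v where "v = (L * u)\<^sup>2"
  have S0: "SA \<ge> 0" "SC \<ge> 0" "SG \<ge> 0" "NT \<ge> 0"
    using nonneg N by (auto simp: SA_def SC_def SG_def NT_def sum_nonneg)
  have K1: "K \<ge> 1" by (simp add: K_def)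
  have LL: "L \<le> L\<^sup>2" using L by (simp add: power2_eq_square)
  have u0: "u > 0" using h r by (simp add: u_def)
  have hu: "h \<le> u" using h r by (simp add: u_def le_divide_eq mult_left_le)
  have pos: "108 * L\<^sup>2 * b * K > 0" using L b K1 by (intro mult_pos_pos) auto
  have "h * (108 * L\<^sup>2 * b * K) \<le> r"
    using h_le pos unfolding K_def[symmetric] by (simp only: pos_le_divide_eq)
  hence uLbK: "L\<^sup>2 * u * b * K \<le> 1 / 108"
    using r by (simp add: u_def field_simps)
  have LubK: "L * u * b * K \<le> 1 / 108"
    using LL u0 b K1 by (intro order_trans[OF _ uLbK] mult_right_mono) auto
  have Lub: "L * u * b \<le> 1 / 108"
    using order_trans[OF mult_left_mono[OF K1, of "L * u * b"] LubK] u0 b L by simp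
  have Lu: "L * u \<le> 1 / 108"
    using order_trans[OF mult_left_mono[OF b, of "L * u"] Lub] u0 L by simp
  have Lhb: "L * h * b \<le> 1 / 108"
    using hu L b by (intro order_trans[OF _ Lub] mult_right_mono mult_left_mono) auto
  have Lh: "L * h \<le> 1 / 108"
    using hu L by (intro order_trans[OF _ Lu] mult_left_mono) auto
  have v0: "v \<ge> 0" by (simp add: v_def)
  have v_Lu: "v \<le> L * u / 108"
    using mult_left_mono[OF Lu, of "L * u"] u0 L by (simp add: v_def power2_eq_square)
  have v_small: "v \<le> 1 / 11664" using v_Lu Lu by linarith
  have vb: "v * b \<le> 1 / 11664"
  proof -
    have "v * b = (L * u) * (L * u * b)" by (simp add: v_def power2_eq_square)
    also have "\<dots> \<le> (1 / 108) * (1 / 108)"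
      using Lu Lub u0 L b by (intro mult_mono) auto
    finally show ?thesis by simp
  qed
  \<comment> \<open>The inequality 2 x \<le> 1 + x^2 lets the factor \<open>K\<close> in the step
    size condition control \<open>\<theta>\<close>, which is linear in \<open>kap\<close>.\<close>
  have kL: "kap * L \<le> K"
  proof -
    have "0 \<le> kap * L" using kap L by simp
    moreover have "2 * (kap * L) \<le> K"
      using sum_squares_bound[of 1 "kap * L"] by (simp add: K_def power_mult_distrib)
    ultimately show ?thesis by linarith
  qed
  have th0: "\<theta> \<ge> 0" unfolding theta using kap h L by simp
  have thb: "\<theta> * b \<le> 1 / 216"
  proof -
    have "\<theta> * b = (kap * L) * (h * b / 2)" by (simp add: theta)
    also have "\<dots> \<le> K * (h * b / 2)" using kL h b by (intro mult_right_mono) auto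
    also have "\<dots> = (1 * h * b * K) / 2" by simp
    also have "\<dots> \<le> (L * u * b * K) / 2"
      using L hu h u0 b K1 by (intro divide_right_mono mult_right_mono mult_mono) auto
    also have "\<dots> \<le> 1 / 216" using LubK by linarith
    finally show ?thesis .
  qed
  have th: "\<theta> \<le> 1 / 216" using order_trans[OF mult_left_mono[OF b th0] thb] by simp
  have th2b: "\<theta>\<^sup>2 * b \<le> 1 / 46656"
    using mult_mono[OF th thb] th0 b by (simp add: power2_eq_square mult.assoc)
  \<comment> \<open>One of the two factors \<open>h\<close> is traded for \<open>L\<close>, which
    brings the local bias into the shape of the \<open>kap\<close> term of the final bound.\<close>
  have th2: "\<theta>\<^sup>2 \<le> kap\<^sup>2 * L\<^sup>2 * (h * L) / 4"
  proof -
    have "1 * h \<le> L * h" using L h by (intro mult_right_mono) auto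
    hence "h \<le> L" using Lh L by linarith
    hence "kap\<^sup>2 * L\<^sup>2 * (h * h) \<le> kap\<^sup>2 * L\<^sup>2 * (h * L)"
      using h by (intro mult_left_mono) auto
    thus ?thesis by (simp add: theta power2_eq_square mult_ac)
  qed
  have one_th: "(1 + \<theta>)\<^sup>2 \<le> 2"
    using power_mono[of "1 + \<theta>" "217 / 216" 2] th th0 by (simp add: power2_eq_square)
  have "r * SC \<le> (h * (1 + \<theta>))\<^sup>2 / r * SG"
    using sum_linear_recursion_le[of C "1 - r", OF C0 nonneg(2) C, of T] by (simp add: SC_def SG_def)
  also have "\<dots> \<le> 2 * h\<^sup>2 / r * SG"
    using mult_left_mono[OF one_th, of "h\<^sup>2"] r S0
    by (intro mult_right_mono divide_right_mono) (auto simp: power_mult_distrib mult_ac)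
  finally have "SC \<le> 2 * u\<^sup>2 * SG"
    using r by (simp add: u_def power_divide power2_eq_square field_simps)
  hence X1: "L\<^sup>2 * SC \<le> 2 * v * SG"
    using mult_left_mono[of SC "2 * u\<^sup>2 * SG" "L\<^sup>2"] by (simp add: v_def power_mult_distrib mult_ac)
  have "SG \<le> (\<Sum>t<T. 4 * N + 4 * b * a t + 4 * L\<^sup>2 * C t)"
    unfolding SG_def by (intro sum_mono G)
  also have "\<dots> = real T * (4 * N) + 4 * b * SA + 4 * L\<^sup>2 * SC"
    by (simp add: sum.distrib sum_distrib_left SA_def SC_def)
  also have "\<dots> = 4 * NT + 4 * (b * SA) + 4 * (L\<^sup>2 * SC)" by (simp add: NT_def)
  finally have SG1: "SG \<le> 4 * NT + 4 * (b * SA) + 4 * (L\<^sup>2 * SC)" .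
  \<comment> \<open>\<open>Z\<close> is the external input of the loop between \<open>X\<close> and
    \<open>SG\<close>. The loop gain \<open>8 * v\<close> is below 1/9, so \<open>X\<close> is
    absorbed and both quantities become multiples of \<open>Z\<close>.\<close>
  define Z where "Z = NT + b * SA"
  define X where "X = L\<^sup>2 * SC"
  have Z0: "Z \<ge> 0" "X \<ge> 0" using S0 b by (auto simp: Z_def X_def)
  have "X \<le> 2 * v * (4 * Z + 4 * X)"
    using X1 mult_left_mono[OF SG1, of "2 * v"] v0 by (simp add: X_def Z_def algebra_simps)
  moreover have "8 * v * X \<le> X / 9"
    using v_small Z0 mult_right_mono[of "8 * v" "1 / 9" X] by simp
  moreover have "2 * v * (4 * Z + 4 * X) = 8 * (v * Z) + 8 * v * X" by (simp add: algebra_simps)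
  ultimately have "X \<le> 8 * (v * Z) + X / 9" by linarith
  hence X2: "X \<le> 9 * (v * Z)" by linarith
  have SG2: "SG \<le> 5 * Z"
  proof -
    have "4 * X \<le> (36 * v) * Z" using X2 by linarith
    also have "\<dots> \<le> 1 * Z" using v_small Z0 by (intro mult_right_mono) auto
    finally have "4 * X \<le> Z" by simp
    moreover have "4 * NT + 4 * (b * SA) = 4 * Z" by (simp add: Z_def)
    ultimately show ?thesis using SG1 unfolding X_def[symmetric] by linarith
  qed
  \<comment> \<open>This estimate and the next two split an error into a multiple of
    \<open>NT\<close>, which stays in the bound, and a small fraction of \<open>SA\<close>, to be
    absorbed by the descent term.\<close>
  have X3: "X \<le> L * u / 12 * NT + SA / 1000"
  proof -
    have "9 * (v * Z) = 9 * v * NT + 9 * (v * b) * SA" by (simp add: Z_def algebra_simps)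
    also have "\<dots> \<le> 9 * (L * u / 108) * NT + 9 * (1 / 11664) * SA"
      using v_Lu vb S0 L u0 by (intro add_mono mult_right_mono mult_left_mono) auto
    also have "\<dots> \<le> L * u / 12 * NT + SA / 1000" using S0 by simp
    finally show ?thesis using X2 by linarith
  qed
  have Y3: "4 * \<theta>\<^sup>2 * SG \<le> 5 * (kap\<^sup>2 * L\<^sup>2 * (h * L)) * NT + SA / 1000"
  proof -
    have "4 * \<theta>\<^sup>2 * SG \<le> 4 * \<theta>\<^sup>2 * (5 * Z)" using SG2 by (intro mult_left_mono) auto
    also have "\<dots> = 20 * \<theta>\<^sup>2 * NT + 20 * (\<theta>\<^sup>2 * b) * SA" by (simp add: Z_def algebra_simps)
    also have "\<dots> \<le> 20 * (kap\<^sup>2 * L\<^sup>2 * (h * L) / 4) * NT + 20 * (1 / 46656) * SA"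
      using th2 th2b S0 by (intro add_mono mult_right_mono mult_left_mono) auto
    also have "\<dots> \<le> 5 * (kap\<^sup>2 * L\<^sup>2 * (h * L)) * NT + SA / 1000" using S0 by simp
    finally show ?thesis .
  qed
  have W3: "2 * (L * h) * SG \<le> 10 * (L * h) * NT + SA / 10"
  proof -
    have "2 * (L * h) * SG \<le> 2 * (L * h) * (5 * Z)" using SG2 L h by (intro mult_left_mono) auto
    also have "\<dots> = 10 * (L * h) * NT + 10 * (L * h * b) * SA" by (simp add: Z_def algebra_simps)
    also have "\<dots> \<le> 10 * (L * h) * NT + 10 * (1 / 108) * SA"
      using Lhb S0 L h by (intro add_mono mult_right_mono mult_left_mono) auto
    also have "\<dots> \<le> 10 * (L * h) * NT + SA / 10" using S0 by simp
    finally show ?thesis .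
  qed
  define c where "c = 4 * h * \<theta>\<^sup>2 + L * (h * (1 + \<theta>))\<^sup>2"
  have "\<Phi> T \<le> \<Phi> 0 + (\<Sum>t<T. - (7 / 16 * h) * a t + h / 2 * L\<^sup>2 * C t + c * G t)"
  proof (induction T)
    case (Suc T)
    have "\<Phi> (Suc T) \<le> \<Phi> T + (- (7 / 16 * h) * a T + h / 2 * L\<^sup>2 * C T + c * G T)"
      using \<Phi>[of T] unfolding c_def by simp
    with Suc show ?case by simp
  qed simp
  also have "\<dots> = \<Phi> 0 + (- (7 / 16 * h) * SA + h / 2 * L\<^sup>2 * SC + c * SG)"
    by (simp only: sum.distrib sum_distrib_left SA_def SC_def SG_def)
  finally have tele: "\<Phi> T \<le> \<Phi> 0 - 7 / 16 * h * SA + h / 2 * X + c * SG"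
    by (simp add: X_def)
  have "L * (h * (1 + \<theta>))\<^sup>2 \<le> 2 * L * h\<^sup>2"
    using mult_left_mono[OF one_th, of "L * h\<^sup>2"] L by (simp add: power_mult_distrib mult_ac)
  hence "c * SG \<le> (4 * h * \<theta>\<^sup>2 + 2 * L * h\<^sup>2) * SG"
    using S0 unfolding c_def by (intro mult_right_mono) auto
  also have "\<dots> = h * (4 * \<theta>\<^sup>2 * SG + 2 * (L * h) * SG)" by (simp add: algebra_simps power2_eq_square)
  finally have "7 / 16 * h * SA \<le> \<Phi> 0 - F + h / 2 * X + h * (4 * \<theta>\<^sup>2 * SG + 2 * (L * h) * SG)"
    using tele lower[of T] by linarith
  moreover have "h * ((\<Phi> 0 - F) / h + X / 2 + (4 * \<theta>\<^sup>2 * SG + 2 * (L * h) * SG))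
      = \<Phi> 0 - F + h / 2 * X + h * (4 * \<theta>\<^sup>2 * SG + 2 * (L * h) * SG)"
    using h by (simp add: distrib_left)
  ultimately have "h * (7 / 16 * SA) \<le> h * ((\<Phi> 0 - F) / h + X / 2 + (4 * \<theta>\<^sup>2 * SG + 2 * (L * h) * SG))"
    by (simp add: mult_ac)
  hence main: "7 / 16 * SA \<le> (\<Phi> 0 - F) / h + X / 2 + (4 * \<theta>\<^sup>2 * SG + 2 * (L * h) * SG)"
    using h by (simp only: mult_le_cancel_left_pos)
  \<comment> \<open>The absorbed fractions 1/2000, 1/1000 and 1/10 leave more than 1/6 of 7/16. The
    noise is at most \<open>P / 24 + 5 * Q + 10 * R\<close>; one copy of \<open>R\<close> moves into
    \<open>P\<close>, and all coefficients are rounded up to 9.\<close>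
  define P Q R where "P = L * u * NT" and "Q = kap\<^sup>2 * L\<^sup>2 * (h * L) * NT" and "R = L * h * NT"
  have "P \<ge> 0" "Q \<ge> 0" using L h u0 S0 by (simp_all add: P_def Q_def)
  moreover have "R \<le> P" unfolding P_def R_def using hu L S0 by (intro mult_right_mono mult_left_mono) auto
  moreover have "X \<le> P / 12 + SA / 1000" using X3 by (simp add: P_def)
  moreover have "4 * \<theta>\<^sup>2 * SG \<le> 5 * Q + SA / 1000" using Y3 by (simp add: Q_def)
  moreover have "2 * (L * h) * SG \<le> 10 * R + SA / 10" using W3 by (simp add: R_def)
  ultimately have "SA / 6 \<le> (\<Phi> 0 - F) / h + (9 * Q + 9 * R + 9 * P)"
    using main S0(1) by linarith
  also have "(\<Phi> 0 - F) / h + (9 * Q + 9 * R + 9 * P) = (\<Phi> 0 - F) / h + 9 * h * L * (kap\<^sup>2 * L\<^sup>2 + 1 + 1 / r) * NT"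
    by (simp add: P_def Q_def R_def u_def algebra_simps)
  finally have "SA \<le> ((\<Phi> 0 - F) / h + 9 * h * L * (kap\<^sup>2 * L\<^sup>2 + 1 + 1 / r) * NT) * 6"
    by (simp only: pos_divide_le_eq zero_less_numeral)
  also have "\<dots> = 6 * (\<Phi> 0 - F) / h + 54 * h * L * (kap\<^sup>2 * L\<^sup>2 + 1 + 1 / r) * NT"
    by (simp only: distrib_right) simp
  finally have "SA \<le> 6 * (\<Phi> 0 - F) / h + 54 * h * L * (kap\<^sup>2 * L\<^sup>2 + 1 + 1 / r) * NT" .
  hence "SA / real T \<le> (6 * (\<Phi> 0 - F) / h + 54 * h * L * (kap\<^sup>2 * L\<^sup>2 + 1 + 1 / r) * NT) / real T"
    by (intro divide_right_mono) auto
  thus ?thesis using T by (simp add: SA_def NT_def add_divide_distrib)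
qed

section \<open>The FedPBC iterates\<close>

text \<open>Measurability of \<open>gl\<close>, the Lipschitz bound for \<open>gFi\<close> and the
  bounds on \<open>Lc\<close> appear as assumptions here; they are derived from the losses when the
  locale is interpreted in the final theorem.\<close>

locale fedpbc_system = prob_space M
  for M :: "'w measure" +
  fixes S :: "'s measure" and m s :: nat and eta L sigma beta zeta :: real
    and x0 :: "'a::euclidean_space" and gl :: "nat \<Rightarrow> 'a \<Rightarrow> 's \<Rightarrow> 'a"
    and Fi :: "nat \<Rightarrow> 'a \<Rightarrow> real" and gFi :: "nat \<Rightarrow> 'a \<Rightarrow> 'a" and Lc :: "nat \<Rightarrow> real"
    and xi :: "nat \<Rightarrow> nat \<Rightarrow> 'w \<Rightarrow> 's" and A :: "nat \<Rightarrow> 'w \<Rightarrow> nat set"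
  assumes m: "m \<ge> 2" and s: "s \<ge> 1" and eta_pos: "eta > 0"
    and gl_meas: "\<And>i x. i < m \<Longrightarrow> gl i x \<in> borel_measurable S"
    and gl_lip: "\<And>i x y z. i < m \<Longrightarrow> norm (gl i x z - gl i y z) \<le> Lc i * norm (x - y)"
    and gFi_deriv: "\<And>i x. i < m \<Longrightarrow> (Fi i has_derivative (\<lambda>h. gFi i x \<bullet> h)) (at x)"
    and gFi_lip: "\<And>i x y. i < m \<Longrightarrow> norm (gFi i x - gFi i y) \<le> Lc i * norm (x - y)"
    and Lc: "\<And>i. i < m \<Longrightarrow> 0 \<le> Lc i" "\<And>i. i < m \<Longrightarrow> Lc i \<le> L"
    and xi_meas: "\<And>i t. i < m \<Longrightarrow> xi i t \<in> M \<rightarrow>\<^sub>M S"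
    and A_meas: "\<And>t. A t \<in> M \<rightarrow>\<^sub>M count_space UNIV"
    and A_sub: "\<And>t \<omega>. \<omega> \<in> space M \<Longrightarrow> A t \<omega> \<subseteq> {..<m}"
    and A_indep: "\<And>t. indep_set (sets (filt_samples M S m xi A t)) {A t -` B \<inter> space M | B. True}"
    and unbiased: "\<And>i t b. i < m \<Longrightarrow> b \<in> Basis \<Longrightarrow>
        AE \<omega> in M. real_cond_exp M (filt M S m xi A t)
          (\<lambda>\<omega>. gl i (client_iter eta s gl xi A x0 i t \<omega>) (xi i t \<omega>) \<bullet> b) \<omega>
          = gFi i (client_iter eta s gl xi A x0 i t \<omega>) \<bullet> b"
    and variance: "\<And>i t x. i < m \<Longrightarrow>
        AE \<omega> in M. nn_cond_exp M (filt M S m xi A t)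
          (\<lambda>\<omega>. ennreal ((norm (gl i x (xi i t \<omega>) - gFi i x))\<^sup>2)) \<omega> \<le> ennreal (sigma\<^sup>2)"
    and heterogeneity: "\<And>x. (1 / real m) * (\<Sum>i<m. (norm (gFi i x - (1 / real m) *\<^sub>R (\<Sum>j<m. gFi j x)))\<^sup>2)
        \<le> beta\<^sup>2 * (norm ((1 / real m) *\<^sub>R (\<Sum>j<m. gFi j x)))\<^sup>2 + zeta\<^sup>2"
begin

abbreviation "Ft \<equiv> filt M S m xi A"
abbreviation "Fs \<equiv> filt_samples M S m xi A"
abbreviation "X \<equiv> client_iter eta s gl xi A x0"
abbreviation "xbar \<equiv> avg_iter m eta s gl xi A x0"
abbreviation "avg f \<equiv> (1 / real m) *\<^sub>R (\<Sum>i<m. f i)"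

definition gF where "gF x = avg (\<lambda>i. gFi i x)"
definition F where "F x = (1 / real m) * (\<Sum>i<m. Fi i x)"
definition g where "g i t \<omega> = gl i (X i t \<omega>) (xi i t \<omega>)"
definition Y where "Y i t \<omega> = local_sgd eta s (\<lambda>y. gl i y (xi i t \<omega>)) (X i t \<omega>)"
definition V where "V i t \<omega> = g i t \<omega> - gFi i (X i t \<omega>)"
definition kap where "kap = kappa m eta s Lc"
definition h where "h = eta * real s"
text \<open>Relative to the single step \<open>h * g\<close>, the \<open>s\<close> local steps deviate by a factor of at most \<open>\<theta>\<close>.\<close>

definition \<theta> where "\<theta> = kap * h * L / 2"

lemma m0: "m > 0" "{..<m} \<noteq> {}" "real m > 0" using m by (auto simp: lessThan_empty_iff)

lemma h_pos: "h > 0" using s eta_pos by (simp add: h_def)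

lemma L_nonneg: "L \<ge> 0" using Lc[of 0] m by simp

lemma avg_norm_sq_le: "(norm (avg f))\<^sup>2 \<le> (1 / real m) * (\<Sum>i<m. (norm (f i))\<^sup>2)" for f :: "nat \<Rightarrow> 'a"
  using norm_avg_sq_le[of "{..<m}" f] m0 by simp

lemma avg_mono:
  "(\<And>i. i < m \<Longrightarrow> f i \<le> f' i) \<Longrightarrow> (1 / real m) * (\<Sum>i<m. f i) \<le> (1 / real m) * (\<Sum>i<m. f' i :: real)"
  by (intro mult_left_mono sum_mono) auto

lemma X_0: "X i 0 \<omega> = x0"
  by (simp add: client_iter_def)

text \<open>The server model drops out: an active client receives an average formed in the same
  round, so the client models evolve by local steps and mixing alone.\<close>

lemma X_Suc: "X i (Suc t) \<omega> = mix_step (A t \<omega>) (\<lambda>i. Y i t \<omega>) i"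
  by (auto simp: client_iter_def mix_step_def Y_def Let_def split_beta)

lemma xbar_eq: "xbar t \<omega> = avg (\<lambda>i. X i t \<omega>)"
  by (simp add: avg_iter_def)

lemma xbar_0: "xbar 0 \<omega> = x0"
  using m0 by (simp add: xbar_eq X_0 sum_constant_scaleR)

lemma xbar_Suc: "\<omega> \<in> space M \<Longrightarrow> xbar (Suc t) \<omega> = avg (\<lambda>i. Y i t \<omega>)"
  by (simp add: xbar_eq X_Suc sum_mix_step[OF A_sub])

lemma Lc_L: "i < m \<Longrightarrow> Lc i * norm x \<le> L * norm x"
  using Lc(2) by (intro mult_right_mono) auto

lemma gFi_lip_L: "i < m \<Longrightarrow> norm (gFi i x - gFi i y) \<le> L * norm (x - y)"
  using gFi_lip[of i x y] Lc_L[of i "x - y"] by simp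

lemma gF_lip: "norm (gF x - gF y) \<le> L * norm (x - y)"
proof -
  have "norm (gF x - gF y) = norm (avg (\<lambda>i. gFi i x - gFi i y))"
    by (simp add: gF_def sum_subtractf scaleR_diff_right)
  also have "\<dots> \<le> (1 / real m) * (\<Sum>i<m. norm (gFi i x - gFi i y))"
    using m0 by (simp add: divide_right_mono norm_sum)
  also have "\<dots> \<le> (1 / real m) * (\<Sum>i<m. L * norm (x - y))"
    by (rule avg_mono) (rule gFi_lip_L)
  finally show ?thesis using m0 by simp
qed

lemma F_deriv: "(F has_derivative (\<lambda>k. gF x \<bullet> k)) (at x)"
proof -
  have "(F has_derivative (\<lambda>k. (1 / real m) * (\<Sum>i<m. gFi i x \<bullet> k))) (at x)"
    unfolding F_def using gFi_deriv
    by (intro has_derivative_mult_right has_derivative_sum) auto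
  thus ?thesis by (simp add: gF_def inner_sum_left)
qed

lemma F_descent: "\<bar>F y - F x - gF x \<bullet> (y - x)\<bar> \<le> L * (norm (y - x))\<^sup>2"
  by (rule descent_lemma[OF F_deriv gF_lip L_nonneg])

lemma local_step: "i < m \<Longrightarrow> norm (Y i t \<omega> - X i t \<omega> + h *\<^sub>R g i t \<omega>) \<le> h * \<theta> * norm (g i t \<omega>)"
  using local_sgd_kappa[of "\<lambda>y. gl i y (xi i t \<omega>)" Lc i m L eta s "X i t \<omega>"] gl_lip Lc eta_pos s
  by (simp add: Y_def h_def \<theta>_def kap_def g_def mult_ac)

lemma local_step_norm:
  assumes "i < m"
  shows "norm (Y i t \<omega> - X i t \<omega>) \<le> h * (1 + \<theta>) * norm (g i t \<omega>)"
proof -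
  have "norm (Y i t \<omega> - X i t \<omega>) \<le> norm (Y i t \<omega> - X i t \<omega> + h *\<^sub>R g i t \<omega>) + norm (h *\<^sub>R g i t \<omega>)"
    using norm_triangle_ineq4[of "Y i t \<omega> - X i t \<omega> + h *\<^sub>R g i t \<omega>" "h *\<^sub>R g i t \<omega>"] by simp
  also have "\<dots> \<le> h * \<theta> * norm (g i t \<omega>) + h * norm (g i t \<omega>)"
    using local_step[OF assms] h_pos by (intro add_mono) auto
  finally show ?thesis by (simp add: algebra_simps)
qed

subsection \<open>Measurability\<close>

lemma hist_gens_sets: "hist_gens M S m xi A t \<subseteq> sets M"
  using xi_meas A_meas by (auto simp: hist_gens_def intro: measurable_sets)

lemma sample_gens_sets:
  "hist_gens M S m xi A t \<union> {xi i t -` B \<inter> space M | i B. i < m \<and> B \<in> sets S} \<subseteq> sets M"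
  using hist_gens_sets xi_meas by (auto intro: measurable_sets)

lemma hist_gens_Pow: "hist_gens M S m xi A t \<subseteq> Pow (space M)"
  and sample_gens_Pow:
  "hist_gens M S m xi A t \<union> {xi i t -` B \<inter> space M | i B. i < m \<and> B \<in> sets S} \<subseteq> Pow (space M)"
  by (auto simp: hist_gens_def)

lemma space_filt [simp]: "space (Ft t) = space M" "space (Fs t) = space M"
  by (simp_all add: filt_def filt_samples_def space_measure_of_conv)

lemma sets_filt: "sets (Ft t) = sigma_sets (space M) (hist_gens M S m xi A t)"
  and sets_filt_samples: "sets (Fs t) = sigma_sets (space M)
    (hist_gens M S m xi A t \<union> {xi i t -` B \<inter> space M | i B. i < m \<and> B \<in> sets S})"
  unfolding filt_def filt_samples_def
  using hist_gens_Pow sample_gens_Pow by (simp_all add: sets_measure_of)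

lemma subalgebra_filt: "subalgebra M (Ft t)" and subalgebra_samples: "subalgebra M (Fs t)"
  unfolding subalgebra_def sets_filt sets_filt_samples
  using sets.sigma_sets_subset[OF hist_gens_sets] sets.sigma_sets_subset[OF sample_gens_sets] by auto

text \<open>With \<open>subalgebra_Suc_samples\<close> below, the sigma-algebras interleave:
  \<open>Ft t\<close> knows the models before round \<open>t\<close>, \<open>Fs t\<close> those
  after the local phase, and \<open>Ft (Suc t)\<close> also the active set.\<close>

lemma subalgebra_samples_filt: "subalgebra (Fs t) (Ft t)"
  unfolding subalgebra_def sets_filt sets_filt_samples by (intro conjI sigma_sets_mono') auto

lemma subalgebra_Suc_samples: "subalgebra (Ft (Suc t)) (Fs t)"
  unfolding subalgebra_def sets_filt sets_filt_samples
proof (intro conjI sigma_sets_mono')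
  show "hist_gens M S m xi A t \<union> {xi i t -` B \<inter> space M | i B. i < m \<and> B \<in> sets S} \<subseteq> hist_gens M S m xi A (Suc t)"
  proof (intro Un_least subsetI)
    fix E assume "E \<in> hist_gens M S m xi A t"
    then consider (sample) i r B where "E = xi i r -` B \<inter> space M" "i < m" "r < t" "B \<in> sets S"
      | (active) r B where "E = A r -` B \<inter> space M" "r < t"
      unfolding hist_gens_def by blast
    thus "E \<in> hist_gens M S m xi A (Suc t)"
    proof cases
      case sample
      hence "E = xi i r -` B \<inter> space M \<and> i < m \<and> r < Suc t \<and> B \<in> sets S" by simp
      thus ?thesis unfolding hist_gens_def by blast
    next
      case active
      hence "E = A r -` B \<inter> space M \<and> r < Suc t" by simp
      thus ?thesis unfolding hist_gens_def by blast
    qed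
  next
    fix E assume "E \<in> {xi i t -` B \<inter> space M | i B. i < m \<and> B \<in> sets S}"
    thus "E \<in> hist_gens M S m xi A (Suc t)" unfolding hist_gens_def using lessI[of t] by blast
  qed
qed simp

lemma xi_samples: "i < m \<Longrightarrow> xi i t \<in> Fs t \<rightarrow>\<^sub>M S"
  using measurable_space[OF xi_meas]
  by (intro measurableI) (simp, unfold sets_filt_samples space_filt, intro sigma_sets.Basic, blast)

text \<open>The target is cut down to a finite set so that measurability after mixing can be checked
  for each possible active set separately.\<close>

lemma A_filt: "A t \<in> Ft (Suc t) \<rightarrow>\<^sub>M count_space (Pow {..<m})"
proof (rule measurableI)
  show "A t -` B \<inter> space (Ft (Suc t)) \<in> sets (Ft (Suc t))" for B
    unfolding sets_filt space_filt hist_gens_def by (intro sigma_sets.Basic) blast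
qed (use A_sub in auto)

lemma gl_cont: "i < m \<Longrightarrow> continuous_on UNIV (\<lambda>v. gl i v z)"
  by (rule lipschitz_imp_continuous_on) (rule gl_lip)

text \<open>Measurability of the starting model is a premise because this is one half of the
  round-by-round induction in \<open>X_filt\<close>.\<close>

lemma Y_samples_aux:
  assumes i: "i < m" and X: "X i t \<in> borel_measurable (Ft t)"
  shows "(\<lambda>\<omega>. local_sgd eta k (\<lambda>y. gl i y (xi i t \<omega>)) (X i t \<omega>)) \<in> borel_measurable (Fs t)"
proof (induction k)
  case 0
  show ?case using measurable_from_subalg[OF subalgebra_samples_filt X] by (simp add: local_sgd_def)
next
  case (Suc k)
  have "(\<lambda>\<omega>. gl i (local_sgd eta k (\<lambda>y. gl i y (xi i t \<omega>)) (X i t \<omega>)) (xi i t \<omega>)) \<in> borel_measurable (Fs t)"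
    by (rule measurable_caratheodory[where f = "\<lambda>v \<omega>. gl i v (xi i t \<omega>)",
          OF measurable_compose[OF xi_samples[OF i] gl_meas[OF i]] gl_cont[OF i] Suc])
  with Suc show ?case by (simp add: local_sgd_def)
qed

lemma mix_step_measurable:
  fixes f :: "nat \<Rightarrow> 'w \<Rightarrow> 'a"
  assumes Act: "Act \<subseteq> {..<m}" and f: "\<And>j. j < m \<Longrightarrow> f j \<in> borel_measurable N" and i: "i < m"
  shows "(\<lambda>\<omega>. mix_step Act (\<lambda>j. f j \<omega>) i) \<in> borel_measurable N"
proof (cases "i \<in> Act")
  case True
  have "(\<lambda>\<omega>. (1 / real (card Act)) *\<^sub>R (\<Sum>j\<in>Act. f j \<omega>)) \<in> borel_measurable N"
    using Act by (intro borel_measurable_scaleR borel_measurable_sum f) auto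
  with True show ?thesis by (simp add: mix_step_def)
qed (simp add: mix_step_def f i)

lemma X_filt: "i < m \<Longrightarrow> X i t \<in> borel_measurable (Ft t)"
proof (induction t arbitrary: i)
  case 0
  have "X i 0 = (\<lambda>\<omega>. x0)" by (rule ext) (rule X_0)
  thus ?case by simp
next
  case (Suc t)
  have Y: "Y j t \<in> borel_measurable (Ft (Suc t))" if "j < m" for j
    using measurable_from_subalg[OF subalgebra_Suc_samples Y_samples_aux[OF that Suc.IH[OF that]]]
    unfolding Y_def .
  have "(\<lambda>\<omega>. mix_step (A t \<omega>) (\<lambda>i. Y i t \<omega>) i) \<in> borel_measurable (Ft (Suc t))"
  proof (rule measurable_compose_countable'[OF _ A_filt])
    fix Act assume Act: "Act \<in> Pow {..<m}"
    show "(\<lambda>\<omega>. mix_step Act (\<lambda>i. Y i t \<omega>) i) \<in> borel_measurable (Ft (Suc t))"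
      using mix_step_measurable[OF _ Y Suc.prems] Act by simp
  qed (simp add: countable_finite)
  moreover have "X i (Suc t) = (\<lambda>\<omega>. mix_step (A t \<omega>) (\<lambda>i. Y i t \<omega>) i)" by (rule ext) (rule X_Suc)
  ultimately show ?case by simp
qed

lemma Y_samples: "i < m \<Longrightarrow> Y i t \<in> borel_measurable (Fs t)"
  using Y_samples_aux[OF _ X_filt] unfolding Y_def .

lemma X_meas: "i < m \<Longrightarrow> X i t \<in> borel_measurable M"
  by (rule measurable_from_subalg[OF subalgebra_filt X_filt])

lemma g_meas: "i < m \<Longrightarrow> g i t \<in> borel_measurable M"
  unfolding g_def
  by (rule measurable_caratheodory[where f = "\<lambda>v \<omega>. gl i v (xi i t \<omega>)",
        OF measurable_compose[OF xi_meas gl_meas] gl_cont X_meas])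

lemma gFi_cont: "i < m \<Longrightarrow> continuous_on UNIV (gFi i)"
  by (rule lipschitz_imp_continuous_on) (rule gFi_lip)

lemma xbar_filt: "xbar t \<in> borel_measurable (Ft t)"
  using X_filt unfolding xbar_eq[abs_def] by (auto intro!: borel_measurable_scaleR borel_measurable_sum)

lemma gF_xbar_filt: "(\<lambda>\<omega>. gF (xbar t \<omega>)) \<in> borel_measurable (Ft t)"
  by (rule measurable_compose[OF xbar_filt borel_measurable_continuous_onI])
     (rule lipschitz_imp_continuous_on, rule gF_lip)

subsection \<open>Square integrability\<close>

text \<open>The iterate is \<open>Ft t\<close>-measurable, so the conditional bound at fixed points
  carries over to it. The nonnegative integral is used because finiteness of the second moment is
  only a consequence.\<close>

lemma nn_variance:
  assumes i: "i < m"
  shows "(\<integral>\<^sup>+\<omega>. ennreal ((norm (V i t \<omega>))\<^sup>2) \<partial>M) \<le> ennreal (sigma\<^sup>2)"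
  unfolding V_def g_def
proof (rule nn_integral_frozen_le[OF subalgebra_filt, where h = "\<lambda>v \<omega>. (norm (gl i v (xi i t \<omega>) - gFi i v))\<^sup>2"])
  show "(\<lambda>\<omega>. (norm (gl i v (xi i t \<omega>) - gFi i v))\<^sup>2) \<in> borel_measurable M" for v
    using measurable_compose[OF xi_meas[OF i] gl_meas[OF i]] by measurable
  show "continuous_on UNIV (\<lambda>v. (norm (gl i v (xi i t \<omega>) - gFi i v))\<^sup>2)" for \<omega>
    by (intro continuous_intros gl_cont gFi_cont i)
qed (rule variance[OF i], rule X_filt[OF i])

lemma V_meas: "i < m \<Longrightarrow> V i t \<in> borel_measurable M"
  unfolding V_def
  using g_meas measurable_compose[OF X_meas borel_measurable_continuous_onI[OF gFi_cont]] by auto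

lemma V_square: "i < m \<Longrightarrow> square_integrable M (V i t)"
  unfolding square_integrable_def
  using V_meas nn_variance[of i t] by (auto intro!: integrableI_bounded le_less_trans[OF nn_variance[of i t]])

lemma V_variance:
  assumes i: "i < m"
  shows "expectation (\<lambda>\<omega>. (norm (V i t \<omega>))\<^sup>2) \<le> sigma\<^sup>2"
proof -
  have "ennreal (expectation (\<lambda>\<omega>. (norm (V i t \<omega>))\<^sup>2)) \<le> ennreal (sigma\<^sup>2)"
    using nn_variance[OF i] square_integrable_norm[OF V_square[OF i]]
    by (subst nn_integral_eq_integral[symmetric]) auto
  thus ?thesis by simp
qed

lemma gFi_square:
  assumes "i < m" "square_integrable M f" shows "square_integrable M (\<lambda>\<omega>. gFi i (f \<omega>))"
  using square_integrable_comp_lipschitz[OF finite_measure_axioms assms(2) gFi_lip[OF assms(1)]] .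

lemma g_square_aux: "i < m \<Longrightarrow> square_integrable M (X i t) \<Longrightarrow> square_integrable M (g i t)"
  using square_integrable_add[OF V_square[of i t] gFi_square[of i "X i t"]] by (simp add: V_def)

lemma Y_meas: "i < m \<Longrightarrow> Y i t \<in> borel_measurable M"
  by (rule measurable_from_subalg[OF subalgebra_samples Y_samples])

lemma Y_square_aux:
  assumes i: "i < m" and X: "square_integrable M (X i t)"
  shows "square_integrable M (Y i t)"
proof -
  have "square_integrable M (\<lambda>\<omega>. Y i t \<omega> - X i t \<omega>)"
  proof (rule square_integrable_bound)
    show "integrable M (\<lambda>\<omega>. (h * (1 + \<theta>))\<^sup>2 * (norm (g i t \<omega>))\<^sup>2)"
      using square_integrable_norm[OF g_square_aux[OF i X]] by simp
    show "(norm (Y i t \<omega> - X i t \<omega>))\<^sup>2 \<le> (h * (1 + \<theta>))\<^sup>2 * (norm (g i t \<omega>))\<^sup>2" for \<omega>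
      using power_mono[OF local_step_norm[OF i]] by (simp add: power_mult_distrib)
  qed (use Y_meas X_meas i in auto)
  from square_integrable_add[OF this X] show ?thesis by simp
qed

text \<open>All clients are treated together: mixing does not increase the sum of squares, so the
  squares after local training dominate whatever the active set is.\<close>

lemma X_square: "i < m \<Longrightarrow> square_integrable M (X i t)"
proof (induction t arbitrary: i)
  case 0
  have "X i 0 = (\<lambda>\<omega>. x0)" by (rule ext) (rule X_0)
  thus ?case by (simp add: square_integrable_def)
next
  case (Suc t)
  show ?case
  proof (rule square_integrable_bound[OF X_meas[OF Suc.prems]])
    show "integrable M (\<lambda>\<omega>. \<Sum>j<m. (norm (Y j t \<omega>))\<^sup>2)"
      using Y_square_aux[OF _ Suc.IH] by (auto simp: square_integrable_def)
    fix \<omega> assume w: "\<omega> \<in> space M"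
    have "(norm (X i (Suc t) \<omega>))\<^sup>2 \<le> (\<Sum>j<m. (norm (mix_step (A t \<omega>) (\<lambda>i. Y i t \<omega>) j))\<^sup>2)"
      unfolding X_Suc using Suc.prems by (intro member_le_sum) auto
    also have "\<dots> \<le> (\<Sum>j<m. (norm (Y j t \<omega>))\<^sup>2)" by (rule sum_norm_mix_step_le[OF A_sub[OF w]])
    finally show "(norm (X i (Suc t) \<omega>))\<^sup>2 \<le> (\<Sum>j<m. (norm (Y j t \<omega>))\<^sup>2)" .
  qed
qed

lemma g_square: "i < m \<Longrightarrow> square_integrable M (g i t)"
  and Y_square: "i < m \<Longrightarrow> square_integrable M (Y i t)"
  by (simp_all add: g_square_aux Y_square_aux X_square)

lemma xbar_square: "square_integrable M (xbar t)"
  unfolding xbar_eq[abs_def]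
  by (intro square_integrable_scaleR square_integrable_sum X_square) auto

lemma gF_square: "square_integrable M (\<lambda>\<omega>. gF (xbar t \<omega>))"
  by (rule square_integrable_comp_lipschitz[OF finite_measure_axioms xbar_square gF_lip])

text \<open>The descent inequality based at \<open>x0\<close>, used in both directions, shows that
  \<open>F\<close> grows at most quadratically.\<close>

lemma F_integrable: "integrable M (\<lambda>\<omega>. F (xbar t \<omega>))"
proof (rule Bochner_Integration.integrable_bound)
  let ?d = "\<lambda>\<omega>. xbar t \<omega> - x0"
  have d: "square_integrable M ?d"
    by (intro square_integrable_diff xbar_square) (simp add: square_integrable_def)
  show "integrable M (\<lambda>\<omega>. \<bar>F x0\<bar> + \<bar>gF x0 \<bullet> ?d \<omega>\<bar> + L * (norm (?d \<omega>))\<^sup>2)"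
    using square_integrable_norm[OF d] square_integrable_inner[OF _ d, of "\<lambda>_. gF x0"]
    by (auto simp: square_integrable_def)
  have "continuous_on UNIV F"
    by (intro continuous_at_imp_continuous_on ballI has_derivative_continuous[OF F_deriv])
  thus "(\<lambda>\<omega>. F (xbar t \<omega>)) \<in> borel_measurable M"
    using square_integrable_measurable[OF xbar_square] by (auto intro: measurable_compose borel_measurable_continuous_onI)
  have "\<bar>F (xbar t \<omega>)\<bar> \<le> \<bar>F x0\<bar> + \<bar>gF x0 \<bullet> ?d \<omega>\<bar> + L * (norm (?d \<omega>))\<^sup>2" for \<omega>
    using F_descent[of "xbar t \<omega>" x0] by linarith
  thus "AE \<omega> in M. norm (F (xbar t \<omega>)) \<le> norm (\<bar>F x0\<bar> + \<bar>gF x0 \<bullet> ?d \<omega>\<bar> + L * (norm (?d \<omega>))\<^sup>2)"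
    using abs_ge_self order_trans by (intro AE_I2) fastforce
qed

end

text \<open>Multiplying the usual Young inequality by \<open>q\<^sup>2\<close> avoids dividing by \<open>q\<close>, which may be 0.\<close>

lemma weighted_power2_norm_add_le:
  fixes x y :: "'a::real_normed_vector"
  assumes q: "0 \<le> q" "q < 1"
  shows "q\<^sup>2 * (norm (x + y))\<^sup>2 \<le> q * (norm x)\<^sup>2 + (norm y)\<^sup>2 / (1 - q)"
proof -
  let ?a = "norm x" and ?b = "norm y"
  have "(norm (x + y))\<^sup>2 \<le> (?a + ?b)\<^sup>2" by (intro power_mono norm_triangle_ineq) auto
  hence "q\<^sup>2 * (norm (x + y))\<^sup>2 \<le> q\<^sup>2 * (?a + ?b)\<^sup>2" by (intro mult_left_mono) auto
  also have "\<dots> \<le> q * ?a\<^sup>2 + ?b\<^sup>2 / (1 - q)"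
  proof -
    have "q\<^sup>2 \<le> 1" using q by (simp add: power_le_one)
    \<comment> \<open>Completed square: this expression is \<open>1 - q\<close> times the gap
      between the two sides of the claim.\<close>
    hence "0 \<le> q * ((1 - q) * ?a - q * ?b)\<^sup>2 + (1 - q\<^sup>2) * ?b\<^sup>2"
      using q by (intro add_nonneg_nonneg mult_nonneg_nonneg) auto
    also have "\<dots> = (1 - q) * (q * ?a\<^sup>2) + ?b\<^sup>2 - (1 - q) * (q\<^sup>2 * (?a + ?b)\<^sup>2)"
      by (simp add: algebra_simps power2_eq_square)
    finally have "(1 - q) * (q\<^sup>2 * (?a + ?b)\<^sup>2) \<le> (1 - q) * (q * ?a\<^sup>2 + ?b\<^sup>2 / (1 - q))"
      using q by (simp add: distrib_left)
    thus ?thesis using q by simp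
  qed
  finally show ?thesis .
qed

lemma mix_step_diff:
  assumes "Act \<subseteq> {..<m}"
  shows "mix_step Act y i - c = mix_step Act (\<lambda>i. y i - c) i"
proof (cases "i \<in> Act")
  case True
  hence "card Act \<noteq> 0" using assms finite_active by (auto simp: card_eq_0_iff)
  thus ?thesis using True
    by (simp add: mix_step_def sum_subtractf scaleR_diff_right sum_constant_scaleR)
qed (simp add: mix_step_def)

context fedpbc_system
begin

definition Cp where "Cp t \<omega> = (1 / real m) * (\<Sum>i<m. (norm (X i t \<omega> - xbar t \<omega>))\<^sup>2)"
definition Gp where "Gp t \<omega> = (1 / real m) * (\<Sum>i<m. (norm (g i t \<omega>))\<^sup>2)"
definition ap where "ap t \<omega> = (norm (gF (xbar t \<omega>)))\<^sup>2"
definition rho where "rho = rho_mix M m A"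

lemma Cp_integrable: "integrable M (Cp t)" and Gp_integrable: "integrable M (Gp t)"
  and ap_integrable: "integrable M (ap t)"
  unfolding Cp_def[abs_def] Gp_def[abs_def] ap_def[abs_def]
  by (auto intro!: integrable_mult_right Bochner_Integration.integrable_sum square_integrable_norm
      square_integrable_diff X_square xbar_square g_square gF_square)

lemma Cp_nonneg: "Cp t \<omega> \<ge> 0" and Gp_nonneg: "Gp t \<omega> \<ge> 0" and ap_nonneg: "ap t \<omega> \<ge> 0"
  by (auto simp: Cp_def Gp_def ap_def sum_nonneg)

text \<open>By the variance decomposition the raw second moment exceeds the heterogeneity by the
  squared norm of the mean gradient; this is the origin of the factor
  \<open>beta\<^sup>2 + 1\<close>.\<close>

lemma gFi_mean_square:
  "(1 / real m) * (\<Sum>i<m. (norm (gFi i x))\<^sup>2) \<le> (beta\<^sup>2 + 1) * (norm (gF x))\<^sup>2 + zeta\<^sup>2"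
  using heterogeneity[of x] sum_norm_centered[of "{..<m}" "\<lambda>i. gFi i x"] m0
  by (simp add: gF_def field_simps)

text \<open>Two successive splittings, each costing a factor 2: off the noise, then off the change
  of the true gradient between a client model and the average.\<close>

lemma Gp_le:
  "Gp t \<omega> \<le> 2 * ((1 / real m) * (\<Sum>i<m. (norm (V i t \<omega>))\<^sup>2))
     + 4 * L\<^sup>2 * Cp t \<omega> + 4 * ((beta\<^sup>2 + 1) * ap t \<omega> + zeta\<^sup>2)"
proof -
  have "Gp t \<omega> \<le> (1 / real m) * (\<Sum>i<m. 2 * (norm (V i t \<omega>))\<^sup>2
      + 4 * L\<^sup>2 * (norm (X i t \<omega> - xbar t \<omega>))\<^sup>2 + 4 * (norm (gFi i (xbar t \<omega>)))\<^sup>2)"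
    unfolding Gp_def
  proof (rule avg_mono)
    fix i assume i: "i < m"
    have "(norm (g i t \<omega>))\<^sup>2 \<le> 2 * (norm (V i t \<omega>))\<^sup>2 + 2 * (norm (gFi i (X i t \<omega>)))\<^sup>2"
      using power2_norm_add_le[of "V i t \<omega>" "gFi i (X i t \<omega>)"] by (simp add: V_def)
    moreover have "(norm (gFi i (X i t \<omega>)))\<^sup>2 \<le> 2 * (norm (gFi i (X i t \<omega>) - gFi i (xbar t \<omega>)))\<^sup>2
        + 2 * (norm (gFi i (xbar t \<omega>)))\<^sup>2"
      using power2_norm_add_le[of "gFi i (X i t \<omega>) - gFi i (xbar t \<omega>)" "gFi i (xbar t \<omega>)"] by simp
    moreover have "(norm (gFi i (X i t \<omega>) - gFi i (xbar t \<omega>)))\<^sup>2 \<le> L\<^sup>2 * (norm (X i t \<omega> - xbar t \<omega>))\<^sup>2"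
      using power_mono[OF gFi_lip_L[OF i], of _ _ 2] by (simp add: power_mult_distrib)
    ultimately show "(norm (g i t \<omega>))\<^sup>2 \<le> 2 * (norm (V i t \<omega>))\<^sup>2
      + 4 * L\<^sup>2 * (norm (X i t \<omega> - xbar t \<omega>))\<^sup>2 + 4 * (norm (gFi i (xbar t \<omega>)))\<^sup>2" by linarith
  qed
  also have "\<dots> = 2 * ((1 / real m) * (\<Sum>i<m. (norm (V i t \<omega>))\<^sup>2)) + 4 * L\<^sup>2 * Cp t \<omega>
      + 4 * ((1 / real m) * (\<Sum>i<m. (norm (gFi i (xbar t \<omega>)))\<^sup>2))"
    unfolding Cp_def sum.distrib sum_distrib_left[symmetric] by (simp add: add_divide_distrib)
  also have "\<dots> \<le> 2 * ((1 / real m) * (\<Sum>i<m. (norm (V i t \<omega>))\<^sup>2)) + 4 * L\<^sup>2 * Cp t \<omega>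
      + 4 * ((beta\<^sup>2 + 1) * ap t \<omega> + zeta\<^sup>2)"
    using gFi_mean_square[of "xbar t \<omega>"] unfolding ap_def by (intro add_left_mono mult_left_mono) auto
  finally show ?thesis .
qed

lemma gradient_second_moment:
  "expectation (Gp t) \<le> 4 * (sigma\<^sup>2 + zeta\<^sup>2) + 4 * (beta\<^sup>2 + 1) * expectation (ap t) + 4 * L\<^sup>2 * expectation (Cp t)"
proof -
  let ?V = "\<lambda>\<omega>. (1 / real m) * (\<Sum>i<m. (norm (V i t \<omega>))\<^sup>2)"
  have Vi: "integrable M (\<lambda>\<omega>. (norm (V i t \<omega>))\<^sup>2)" if "i < m" for i
    using square_integrable_norm[OF V_square[OF that]] .
  have V_int: "integrable M ?V" using Vi by (intro integrable_mult_right Bochner_Integration.integrable_sum) auto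
  have "expectation ?V = (1 / real m) * (\<Sum>i<m. expectation (\<lambda>\<omega>. (norm (V i t \<omega>))\<^sup>2))"
    using Vi by simp
  also have "\<dots> \<le> (1 / real m) * (\<Sum>i<m. sigma\<^sup>2)" by (intro avg_mono V_variance)
  finally have V_le: "expectation ?V \<le> sigma\<^sup>2" using m0 by simp
  have "expectation (Gp t) \<le> expectation (\<lambda>\<omega>. 2 * ?V \<omega> + 4 * L\<^sup>2 * Cp t \<omega> + 4 * ((beta\<^sup>2 + 1) * ap t \<omega> + zeta\<^sup>2))"
    by (intro integral_mono Bochner_Integration.integrable_add integrable_mult_right V_int
        Cp_integrable ap_integrable Gp_integrable Gp_le integrable_const)
  also have "\<dots> = 2 * expectation ?V + 4 * L\<^sup>2 * expectation (Cp t) + 4 * ((beta\<^sup>2 + 1) * expectation (ap t) + zeta\<^sup>2)"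
  proof -
    have "integrable M (\<lambda>\<omega>. 2 * ?V \<omega>)" "integrable M (\<lambda>\<omega>. 4 * L\<^sup>2 * Cp t \<omega>)"
      "integrable M (\<lambda>\<omega>. 4 * ((beta\<^sup>2 + 1) * ap t \<omega> + zeta\<^sup>2))" "integrable M (\<lambda>\<omega>. (beta\<^sup>2 + 1) * ap t \<omega>)"
      by (intro Bochner_Integration.integrable_add integrable_mult_right V_int
          Cp_integrable ap_integrable integrable_const)+
    thus ?thesis by (simp only: Bochner_Integration.integral_add Bochner_Integration.integrable_add
          integral_mult_right_zero integrable_const lebesgue_integral_const prob_space scaleR_one)
  qed
  finally have "expectation (Gp t) \<le> 2 * expectation ?V + 4 * L\<^sup>2 * expectation (Cp t)
      + 4 * ((beta\<^sup>2 + 1) * expectation (ap t) + zeta\<^sup>2)" .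
  also have "\<dots> \<le> 4 * sigma\<^sup>2 + 4 * L\<^sup>2 * expectation (Cp t) + 4 * ((beta\<^sup>2 + 1) * expectation (ap t) + zeta\<^sup>2)"
  proof (intro add_right_mono)
    \<comment> \<open>Rounded up so that both noise levels carry the same factor 4 and merge into
      one quantity.\<close>
    show "2 * expectation ?V \<le> 4 * sigma\<^sup>2" using V_le zero_le_power2[of sigma] by linarith
  qed
  finally show ?thesis by (simp add: algebra_simps)
qed

subsection \<open>Consensus error\<close>

lemma lambda2_mixing_range:
  "0 \<le> lambda2 (exp_mixing_sq M m (A t))" "lambda2 (exp_mixing_sq M m (A t)) \<le> 1"
  using lambda2_exp_mixing[OF m A_meas A_sub] by auto

text \<open>The uniform bound 1 makes the set of second eigenvalues bounded, as required for a real
  supremum to dominate its members.\<close>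

lemma lambda2_le_rho: "lambda2 (exp_mixing_sq M m (A t)) \<le> rho"
  unfolding rho_def rho_mix_def
  by (rule cSUP_upper) (auto intro!: bdd_aboveI2 lambda2_mixing_range)

lemma rho_nonneg: "0 \<le> rho"
  using lambda2_mixing_range(1) lambda2_le_rho order_trans by blast

definition Yc where "Yc t \<omega> i = Y i t \<omega> - avg (\<lambda>j. Y j t \<omega>)"

lemma sum_Yc: "(\<Sum>i<m. Yc t \<omega> i) = 0"
  using m0 by (simp add: Yc_def sum_subtractf sum_constant_scaleR)

lemma Yc_square: "i < m \<Longrightarrow> square_integrable M (\<lambda>\<omega>. Yc t \<omega> i)"
  unfolding Yc_def by (intro square_integrable_diff square_integrable_scaleR square_integrable_sum Y_square) auto

lemma Yc_samples: "i < m \<Longrightarrow> (\<lambda>\<omega>. Yc t \<omega> i) \<in> borel_measurable (Fs t)"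
  unfolding Yc_def by (intro borel_measurable_diff borel_measurable_scaleR borel_measurable_sum Y_samples) auto

lemma Cp_Suc:
  assumes "\<omega> \<in> space M"
  shows "Cp (Suc t) \<omega> = (1 / real m) * (\<Sum>i<m. (norm (mix_step (A t \<omega>) (Yc t \<omega>) i))\<^sup>2)"
proof -
  have "X i (Suc t) \<omega> - xbar (Suc t) \<omega> = mix_step (A t \<omega>) (Yc t \<omega>) i" for i
    unfolding X_Suc xbar_Suc[OF assms] Yc_def using A_sub[OF assms] by (rule mix_step_diff)
  thus ?thesis by (simp add: Cp_def)
qed

text \<open>Splitting over the finitely many values of the active set isolates its randomness. Since
  \<open>Yc t\<close> is \<open>Fs t\<close>-measurable, independence replaces each indicator by its
  probability, and then \<open>Yc t \<omega>\<close> is a fixed sum-zero family for every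
  \<open>\<omega>\<close>.\<close>

lemma expectation_mixing:
  "expectation (Cp (Suc t)) \<le> rho * expectation (\<lambda>\<omega>. (1 / real m) * (\<Sum>i<m. (norm (Yc t \<omega> i))\<^sup>2))"
proof -
  let ?P = "Pow {..<m}"
  define Q where "Q Act \<omega> = (1 / real m) * (\<Sum>i<m. (norm (mix_step Act (Yc t \<omega>) i))\<^sup>2)" for Act \<omega>
  define R where "R \<omega> = (1 / real m) * (\<Sum>i<m. (norm (Yc t \<omega> i))\<^sup>2)" for \<omega>
  define E where "E Act = A t -` {Act} \<inter> space M" for Act
  have E: "E Act \<in> sets M" for Act unfolding E_def using A_meas by (rule measurable_sets) simp
  have R_int: "integrable M R" unfolding R_def[abs_def]
    using square_integrable_norm[OF Yc_square]
    by (intro integrable_mult_right Bochner_Integration.integrable_sum) auto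
  have Q_le: "Q Act \<omega> \<le> R \<omega>" "Q Act \<omega> \<ge> 0" if "Act \<in> ?P" for Act \<omega>
    unfolding Q_def R_def using that
    by (auto intro!: mult_left_mono sum_norm_mix_step_le sum_nonneg mult_nonneg_nonneg simp del: times_divide_eq_left)
  have Q_meas: "Q Act \<in> borel_measurable (Fs t)" if "Act \<in> ?P" for Act
  proof -
    have "(\<lambda>\<omega>. mix_step Act (Yc t \<omega>) i) \<in> borel_measurable (Fs t)" if "i < m" for i
      using mix_step_measurable[of Act "\<lambda>j \<omega>. Yc t \<omega> j" "Fs t" i] Yc_samples \<open>Act \<in> ?P\<close> that by simp
    thus ?thesis unfolding Q_def[abs_def]
      by (intro borel_measurable_times borel_measurable_sum borel_measurable_power
          borel_measurable_const) auto
  qed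
  have Q_int: "integrable M (Q Act)" if "Act \<in> ?P" for Act
    using Q_le[OF that] measurable_from_subalg[OF subalgebra_samples Q_meas[OF that]]
    by (intro Bochner_Integration.integrable_bound[OF R_int])
       (auto intro!: AE_I2 order_trans[OF Q_le(1)[OF that] abs_ge_self])
  have "expectation (Cp (Suc t)) = expectation (\<lambda>\<omega>. \<Sum>Act\<in>?P. indicator (E Act) \<omega> * Q Act \<omega>)"
  proof (rule Bochner_Integration.integral_cong)
    fix \<omega> assume w: "\<omega> \<in> space M"
    have "(\<Sum>Act\<in>?P. indicator (E Act) \<omega> * Q Act \<omega>) = (\<Sum>Act\<in>?P. if A t \<omega> = Act then Q Act \<omega> else 0)"
      using w by (intro sum.cong) (auto simp: E_def indicator_def)
    also have "\<dots> = Q (A t \<omega>) \<omega>" using A_sub[OF w] by (simp add: sum.delta')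
    finally show "Cp (Suc t) \<omega> = (\<Sum>Act\<in>?P. indicator (E Act) \<omega> * Q Act \<omega>)"
      by (simp add: Cp_Suc[OF w] Q_def)
  qed simp
  also have "\<dots> = (\<Sum>Act\<in>?P. expectation (\<lambda>\<omega>. indicator (E Act) \<omega> * Q Act \<omega>))"
    using integrable_mult_indicator[OF E Q_int] by (intro Bochner_Integration.integral_sum) auto
  also have "\<dots> = (\<Sum>Act\<in>?P. prob (E Act) * expectation (Q Act))"
  proof (intro sum.cong refl integral_indep_event[OF subalgebra_samples E])
    fix Act a assume "a \<in> sets (Fs t)"
    thus "prob (a \<inter> E Act) = prob a * prob (E Act)"
      by (intro indep_setD[OF A_indep]) (auto simp: E_def)
  qed (use Q_meas Q_int in auto)
  also have "\<dots> = expectation (\<lambda>\<omega>. \<Sum>Act\<in>?P. prob (E Act) * Q Act \<omega>)"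
    using Q_int by (subst Bochner_Integration.integral_sum) auto
  \<comment> \<open>The spectral bound is applied pointwise in \<open>\<omega>\<close>, with the
    probabilities already averaged over the active set.\<close>
  also have "\<dots> \<le> expectation (\<lambda>\<omega>. rho * R \<omega>)"
  proof (rule integral_mono)
    show "integrable M (\<lambda>\<omega>. \<Sum>Act\<in>?P. prob (E Act) * Q Act \<omega>)" using Q_int by auto
    show "integrable M (\<lambda>\<omega>. rho * R \<omega>)" using R_int by simp
    fix \<omega>
    let ?n = "\<Sum>i<m. (norm (Yc t \<omega> i))\<^sup>2"
    have "(\<Sum>Act\<in>?P. prob (E Act) * Q Act \<omega>)
        = (1 / real m) * (\<Sum>Act\<in>?P. prob (E Act) * (\<Sum>i<m. (norm (mix_step Act (Yc t \<omega>) i))\<^sup>2))"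
      by (simp add: Q_def flip: sum_divide_distrib)
    also have "\<dots> \<le> (1 / real m) * (lambda2 (exp_mixing_sq M m (A t)) * ?n)"
      unfolding E_def by (intro mult_left_mono lambda2_exp_mixing(3)[OF m A_meas A_sub sum_Yc]) auto
    also have "\<dots> \<le> (1 / real m) * (rho * ?n)"
      by (intro mult_left_mono mult_right_mono lambda2_le_rho sum_nonneg) auto
    finally show "(\<Sum>Act\<in>?P. prob (E Act) * Q Act \<omega>) \<le> rho * R \<omega>" by (simp add: R_def)
  qed
  finally show ?thesis by (simp add: R_def[abs_def])
qed

text \<open>Half of the contraction is spent on Young's inequality: with weight
  \<open>q = sqrt rho\<close> the old error keeps the factor \<open>sqrt rho\<close>, and the local
  updates are amplified by the inverse gap \<open>1 / (1 - sqrt rho)\<close>.\<close>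

lemma consensus_recursion:
  assumes rho1: "rho < 1"
  shows "expectation (Cp (Suc t)) \<le> sqrt rho * expectation (Cp t)
    + (h * (1 + \<theta>))\<^sup>2 / (1 - sqrt rho) * expectation (Gp t)"
proof -
  let ?q = "sqrt rho"
  have q: "0 \<le> ?q" "?q < 1" "?q\<^sup>2 = rho" using rho_nonneg rho1 by auto
  let ?D = "\<lambda>i \<omega>. Y i t \<omega> - X i t \<omega>"
  have pointwise: "rho * ((1 / real m) * (\<Sum>i<m. (norm (Yc t \<omega> i))\<^sup>2))
      \<le> ?q * Cp t \<omega> + (h * (1 + \<theta>))\<^sup>2 / (1 - ?q) * Gp t \<omega>" for \<omega>
  proof -
    let ?Dc = "\<lambda>i. ?D i \<omega> - avg (\<lambda>j. ?D j \<omega>)"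
    have "Yc t \<omega> i = (X i t \<omega> - xbar t \<omega>) + ?Dc i" for i
      by (simp add: Yc_def xbar_eq sum_subtractf scaleR_diff_right)
    hence "rho * ((1 / real m) * (\<Sum>i<m. (norm (Yc t \<omega> i))\<^sup>2))
        = (1 / real m) * (\<Sum>i<m. ?q\<^sup>2 * (norm ((X i t \<omega> - xbar t \<omega>) + ?Dc i))\<^sup>2)"
      using q(3) by (simp add: sum_distrib_left)
    also have "\<dots> \<le> (1 / real m) * (\<Sum>i<m. ?q * (norm (X i t \<omega> - xbar t \<omega>))\<^sup>2 + (norm (?Dc i))\<^sup>2 / (1 - ?q))"
      by (intro avg_mono weighted_power2_norm_add_le q)
    also have "\<dots> = ?q * Cp t \<omega> + (1 / (1 - ?q)) * ((1 / real m) * (\<Sum>i<m. (norm (?Dc i))\<^sup>2))"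
      unfolding Cp_def sum.distrib sum_distrib_left[symmetric] sum_divide_distrib[symmetric]
      by (simp add: add_divide_distrib)
    finally have split: "rho * ((1 / real m) * (\<Sum>i<m. (norm (Yc t \<omega> i))\<^sup>2))
        \<le> ?q * Cp t \<omega> + (1 / (1 - ?q)) * ((1 / real m) * (\<Sum>i<m. (norm (?Dc i))\<^sup>2))" .
    have "(1 / real m) * (\<Sum>i<m. (norm (?Dc i))\<^sup>2) \<le> (1 / real m) * (\<Sum>i<m. (norm (?D i \<omega>))\<^sup>2)"
      using sum_norm_centered[of "{..<m}" "\<lambda>i. ?D i \<omega>"] m0 by (intro mult_left_mono) auto
    also have "\<dots> \<le> (1 / real m) * (\<Sum>i<m. (h * (1 + \<theta>))\<^sup>2 * (norm (g i t \<omega>))\<^sup>2)"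
    proof (rule avg_mono)
      fix i assume "i < m"
      from power_mono[OF local_step_norm[OF this], of t \<omega> 2]
      show "(norm (?D i \<omega>))\<^sup>2 \<le> (h * (1 + \<theta>))\<^sup>2 * (norm (g i t \<omega>))\<^sup>2" by (simp add: power_mult_distrib)
    qed
    also have "\<dots> = (h * (1 + \<theta>))\<^sup>2 * Gp t \<omega>"
      by (simp add: Gp_def flip: sum_distrib_left)
    finally have "(1 / (1 - ?q)) * ((1 / real m) * (\<Sum>i<m. (norm (?Dc i))\<^sup>2))
        \<le> (1 / (1 - ?q)) * ((h * (1 + \<theta>))\<^sup>2 * Gp t \<omega>)"
      using q(2) by (intro mult_left_mono) auto
    with split show ?thesis by simp
  qed
  have "expectation (Cp (Suc t)) \<le> expectation (\<lambda>\<omega>. rho * ((1 / real m) * (\<Sum>i<m. (norm (Yc t \<omega> i))\<^sup>2)))"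
    using expectation_mixing[of t] by simp
  also have "\<dots> \<le> expectation (\<lambda>\<omega>. ?q * Cp t \<omega> + (h * (1 + \<theta>))\<^sup>2 / (1 - ?q) * Gp t \<omega>)"
    using Cp_integrable[of t] Gp_integrable[of t] square_integrable_norm[OF Yc_square] pointwise
    by (intro integral_mono integrable_mult_right Bochner_Integration.integrable_add Bochner_Integration.integrable_sum) auto
  also have "\<dots> = ?q * expectation (Cp t) + (h * (1 + \<theta>))\<^sup>2 / (1 - ?q) * expectation (Gp t)"
    using Cp_integrable[of t] Gp_integrable[of t]
    by (subst Bochner_Integration.integral_add) (simp_all only: integrable_mult_right integral_mult_right_zero)
  finally show ?thesis .
qed

subsection \<open>Descent of the objective\<close>

text \<open>The gradient at the average iterate is \<open>Ft t\<close>-measurable and can be taken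
  out of the conditional expectation. The argument runs coordinatewise, since unbiasedness is stated
  so, and square integrability makes the products integrable.\<close>

lemma noise_orthogonal:
  assumes i: "i < m"
  shows "expectation (\<lambda>\<omega>. gF (xbar t \<omega>) \<bullet> V i t \<omega>) = 0"
proof -
  interpret ce: sigma_finite_subalgebra M "Ft t"
    by (intro finite_measure_subalgebra_is_sigma_finite finite_measure_subalgebra.intro
        finite_measure_subalgebra_axioms.intro subalgebra_filt finite_measure_axioms)
  let ?v = "\<lambda>\<omega>. gF (xbar t \<omega>)"
  have gi: "square_integrable M (\<lambda>\<omega>. gFi i (X i t \<omega>))" using gFi_square[OF i X_square[OF i]] .
  have comp: "square_integrable M (\<lambda>\<omega>. f \<omega> \<bullet> b)" if f: "square_integrable M f" and b: "b \<in> Basis"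
    for f :: "'w \<Rightarrow> 'a" and b :: 'a
  proof (rule square_integrable_bound[OF _ square_integrable_norm[OF f]])
    show "(norm (f \<omega> \<bullet> b))\<^sup>2 \<le> (norm (f \<omega>))\<^sup>2" for \<omega>
      using power_mono[OF Basis_le_norm[OF b, of "f \<omega>"], of 2] by simp
  qed (use square_integrable_measurable[OF f] in auto)
  have int: "integrable M (\<lambda>\<omega>. (?v \<omega> \<bullet> b) * (f \<omega> \<bullet> b))" if "b \<in> Basis" "square_integrable M f" for b f
    using square_integrable_inner[OF comp[OF gF_square that(1)] comp[OF that(2,1)]] by simp
  have eq: "expectation (\<lambda>\<omega>. (?v \<omega> \<bullet> b) * (g i t \<omega> \<bullet> b)) = expectation (\<lambda>\<omega>. (?v \<omega> \<bullet> b) * (gFi i (X i t \<omega>) \<bullet> b))"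
    if b: "b \<in> Basis" for b
  proof -
    have vm: "(\<lambda>\<omega>. ?v \<omega> \<bullet> b) \<in> borel_measurable (Ft t)" using gF_xbar_filt by measurable
    have gm: "(\<lambda>\<omega>. g i t \<omega> \<bullet> b) \<in> borel_measurable M" using g_meas[OF i] by measurable
    have "expectation (\<lambda>\<omega>. (?v \<omega> \<bullet> b) * (g i t \<omega> \<bullet> b))
        = expectation (\<lambda>\<omega>. (?v \<omega> \<bullet> b) * real_cond_exp M (Ft t) (\<lambda>\<omega>. g i t \<omega> \<bullet> b) \<omega>)"
      using ce.real_cond_exp_intg(2)[OF int[OF b g_square[OF i]] vm gm] by simp
    also have "\<dots> = expectation (\<lambda>\<omega>. (?v \<omega> \<bullet> b) * (gFi i (X i t \<omega>) \<bullet> b))"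
    proof (rule integral_cong_AE)
      show "AE \<omega> in M. (?v \<omega> \<bullet> b) * real_cond_exp M (Ft t) (\<lambda>\<omega>. g i t \<omega> \<bullet> b) \<omega>
          = (?v \<omega> \<bullet> b) * (gFi i (X i t \<omega>) \<bullet> b)"
        using unbiased[OF i b, of t] unfolding g_def by eventually_elim simp
    qed (use measurable_from_subalg[OF subalgebra_filt vm] square_integrable_measurable[OF gi] in measurable)
    finally show ?thesis .
  qed
  have "expectation (\<lambda>\<omega>. ?v \<omega> \<bullet> V i t \<omega>)
      = expectation (\<lambda>\<omega>. \<Sum>b\<in>Basis. (?v \<omega> \<bullet> b) * (g i t \<omega> \<bullet> b) - (?v \<omega> \<bullet> b) * (gFi i (X i t \<omega>) \<bullet> b))"
    by (subst euclidean_inner) (simp add: V_def inner_diff_left right_diff_distrib)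
  also have "\<dots> = (\<Sum>b\<in>Basis. expectation (\<lambda>\<omega>. (?v \<omega> \<bullet> b) * (g i t \<omega> \<bullet> b))
      - expectation (\<lambda>\<omega>. (?v \<omega> \<bullet> b) * (gFi i (X i t \<omega>) \<bullet> b)))"
    using int g_square[OF i] gi by simp
  also have "\<dots> = 0" using eq by simp
  finally show ?thesis .
qed

lemma descent_pointwise:
  assumes w: "\<omega> \<in> space M"
  shows "F (xbar (Suc t) \<omega>) \<le> F (xbar t \<omega>) - 7 / 16 * h * ap t \<omega> + h / 2 * L\<^sup>2 * Cp t \<omega>
    + (4 * h * \<theta>\<^sup>2 + L * (h * (1 + \<theta>))\<^sup>2) * Gp t \<omega> - h * (gF (xbar t \<omega>) \<bullet> avg (\<lambda>i. V i t \<omega>))"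
proof -
  let ?v = "gF (xbar t \<omega>)" and ?x = "xbar t \<omega>" and ?y = "xbar (Suc t) \<omega>"
  let ?R = "avg (\<lambda>i. Y i t \<omega> - X i t \<omega> + h *\<^sub>R g i t \<omega>)"
  let ?G = "avg (\<lambda>i. gFi i (X i t \<omega>))"
  have diff: "?y - ?x = avg (\<lambda>i. Y i t \<omega> - X i t \<omega>)"
    unfolding xbar_Suc[OF w] xbar_eq[of t] by (simp add: sum_subtractf scaleR_diff_right)
  \<comment> \<open>Three contributions: the bias of the local phase, the averaged true gradients,
    and noise that vanishes in expectation.\<close>
  have decomp: "?y - ?x = ?R - h *\<^sub>R ?G - h *\<^sub>R avg (\<lambda>i. V i t \<omega>)"
    unfolding diff by (simp add: V_def sum_subtractf sum.distrib scaleR_diff_right scaleR_add_right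
        scaleR_left_commute flip: scaleR_sum_right)
  \<comment> \<open>Polarisation: half of the squared norm of \<open>?v\<close> is gained, half of
    the squared distance between \<open>?v\<close> and \<open>?G\<close> is lost, and the squared
    norm of \<open>?G\<close> is dropped.\<close>
  have drift: "- (?v \<bullet> ?G) \<le> - 1 / 2 * ap t \<omega> + 1 / 2 * (L\<^sup>2 * Cp t \<omega>)"
  proof -
    have "(norm (?v - ?G))\<^sup>2 = ap t \<omega> - 2 * (?v \<bullet> ?G) + (norm ?G)\<^sup>2"
    proof -
      have "(norm (a - b))\<^sup>2 = (norm a)\<^sup>2 - 2 * (a \<bullet> b) + (norm b)\<^sup>2" for a b :: 'a
        by (simp add: power2_norm_eq_inner inner_diff_left inner_diff_right inner_commute)
      thus ?thesis unfolding ap_def .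
    qed
    moreover have "(norm (?v - ?G))\<^sup>2 \<le> L\<^sup>2 * Cp t \<omega>"
    proof -
      have "?v - ?G = avg (\<lambda>i. gFi i ?x - gFi i (X i t \<omega>))"
        by (simp add: gF_def sum_subtractf scaleR_diff_right)
      hence "(norm (?v - ?G))\<^sup>2 \<le> (1 / real m) * (\<Sum>i<m. (norm (gFi i ?x - gFi i (X i t \<omega>)))\<^sup>2)"
        by (simp only: avg_norm_sq_le)
      also have "\<dots> \<le> (1 / real m) * (\<Sum>i<m. L\<^sup>2 * (norm (X i t \<omega> - ?x))\<^sup>2)"
      proof (rule avg_mono)
        fix i assume "i < m"
        from power_mono[OF gFi_lip_L[OF this], of ?x "X i t \<omega>" 2]
        show "(norm (gFi i ?x - gFi i (X i t \<omega>)))\<^sup>2 \<le> L\<^sup>2 * (norm (X i t \<omega> - ?x))\<^sup>2"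
          by (simp add: power_mult_distrib norm_minus_commute)
      qed
      also have "\<dots> = L\<^sup>2 * Cp t \<omega>" by (simp add: Cp_def flip: sum_distrib_left)
      finally show ?thesis .
    qed
    moreover have "(norm ?G)\<^sup>2 \<ge> 0" by simp
    ultimately show ?thesis by linarith
  qed
  have bias: "?v \<bullet> ?R \<le> h * (ap t \<omega> / 16 + 4 * \<theta>\<^sup>2 * Gp t \<omega>)"
  proof -
    have "(norm ?R)\<^sup>2 \<le> (1 / real m) * (\<Sum>i<m. (norm (Y i t \<omega> - X i t \<omega> + h *\<^sub>R g i t \<omega>))\<^sup>2)"
      by (rule avg_norm_sq_le)
    also have "\<dots> \<le> (1 / real m) * (\<Sum>i<m. (h * \<theta>)\<^sup>2 * (norm (g i t \<omega>))\<^sup>2)"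
    proof (rule avg_mono)
      fix i assume "i < m"
      from power_mono[OF local_step[OF this], of t \<omega> 2]
      show "(norm (Y i t \<omega> - X i t \<omega> + h *\<^sub>R g i t \<omega>))\<^sup>2 \<le> (h * \<theta>)\<^sup>2 * (norm (g i t \<omega>))\<^sup>2"
        by (simp add: power_mult_distrib)
    qed
    also have "\<dots> = (h * \<theta>)\<^sup>2 * Gp t \<omega>" by (simp add: Gp_def flip: sum_distrib_left)
    finally have R: "(norm ?R)\<^sup>2 \<le> (h * \<theta>)\<^sup>2 * Gp t \<omega>" .
    have "?v \<bullet> ?R \<le> norm ?v * norm ?R" by (rule norm_cauchy_schwarz)
    hence "h * (?v \<bullet> ?R) \<le> h * (norm ?v * norm ?R)" using h_pos by (intro mult_left_mono) auto
    also have "\<dots> \<le> h * h * (norm ?v)\<^sup>2 / 16 + 4 * (norm ?R)\<^sup>2"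
    proof -
      \<comment> \<open>Weights 1/16 and 4 in Young's inequality: of the gain 1/2 from
        \<open>drift\<close> there remains 7/16.\<close>
      have "h * (a * b) \<le> h * h * a\<^sup>2 / 16 + 4 * b\<^sup>2" for a b :: real
        using sum_squares_bound[of "h * a / 4" "2 * b"] by (simp add: power2_eq_square mult_ac)
      thus ?thesis .
    qed
    also have "\<dots> \<le> h * h * (norm ?v)\<^sup>2 / 16 + 4 * ((h * \<theta>)\<^sup>2 * Gp t \<omega>)" using R by simp
    also have "\<dots> = h * (h * (ap t \<omega> / 16 + 4 * \<theta>\<^sup>2 * Gp t \<omega>))"
      by (simp add: ap_def algebra_simps power2_eq_square)
    finally show ?thesis using h_pos by (simp only: mult_le_cancel_left_pos)
  qed
  have quad: "L * (norm (?y - ?x))\<^sup>2 \<le> L * (h * (1 + \<theta>))\<^sup>2 * Gp t \<omega>"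
  proof -
    have "(norm (?y - ?x))\<^sup>2 \<le> (1 / real m) * (\<Sum>i<m. (norm (Y i t \<omega> - X i t \<omega>))\<^sup>2)"
      unfolding diff by (rule avg_norm_sq_le)
    also have "\<dots> \<le> (1 / real m) * (\<Sum>i<m. (h * (1 + \<theta>))\<^sup>2 * (norm (g i t \<omega>))\<^sup>2)"
    proof (rule avg_mono)
      fix i assume "i < m"
      from power_mono[OF local_step_norm[OF this], of t \<omega> 2]
      show "(norm (Y i t \<omega> - X i t \<omega>))\<^sup>2 \<le> (h * (1 + \<theta>))\<^sup>2 * (norm (g i t \<omega>))\<^sup>2" by (simp add: power_mult_distrib)
    qed
    also have "\<dots> = (h * (1 + \<theta>))\<^sup>2 * Gp t \<omega>" by (simp add: Gp_def flip: sum_distrib_left)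
    finally show ?thesis using mult_left_mono[OF _ L_nonneg] by (simp add: mult.assoc)
  qed
  have "F ?y \<le> F ?x + ?v \<bullet> (?y - ?x) + L * (norm (?y - ?x))\<^sup>2"
    using F_descent[of ?y ?x] by linarith
  also have "?v \<bullet> (?y - ?x) = ?v \<bullet> ?R + h * (- (?v \<bullet> ?G)) - h * (?v \<bullet> avg (\<lambda>i. V i t \<omega>))"
    unfolding decomp by (simp only: inner_diff_right inner_scaleR_right)
  finally have "F ?y \<le> F ?x + h * (ap t \<omega> / 16 + 4 * \<theta>\<^sup>2 * Gp t \<omega>)
      + h * (- 1 / 2 * ap t \<omega> + 1 / 2 * (L\<^sup>2 * Cp t \<omega>)) - h * (?v \<bullet> avg (\<lambda>i. V i t \<omega>))
      + L * (h * (1 + \<theta>))\<^sup>2 * Gp t \<omega>"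
    using bias mult_left_mono[OF drift, of h] quad h_pos by linarith
  also have "\<dots> = F ?x - 7 / 16 * h * ap t \<omega> + h / 2 * L\<^sup>2 * Cp t \<omega>
    + (4 * h * \<theta>\<^sup>2 + L * (h * (1 + \<theta>))\<^sup>2) * Gp t \<omega> - h * (?v \<bullet> avg (\<lambda>i. V i t \<omega>))"
    by (simp only: distrib_left distrib_right)
  finally show ?thesis .
qed

lemma descent_expectation:
  "expectation (\<lambda>\<omega>. F (xbar (Suc t) \<omega>)) \<le> expectation (\<lambda>\<omega>. F (xbar t \<omega>))
    - 7 / 16 * h * expectation (ap t) + h / 2 * L\<^sup>2 * expectation (Cp t)
    + (4 * h * \<theta>\<^sup>2 + L * (h * (1 + \<theta>))\<^sup>2) * expectation (Gp t)"
proof -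
  define n where "n \<omega> = gF (xbar t \<omega>) \<bullet> avg (\<lambda>i. V i t \<omega>)" for \<omega>
  have vi: "integrable M (\<lambda>\<omega>. gF (xbar t \<omega>) \<bullet> V i t \<omega>)" if "i < m" for i
    by (rule square_integrable_inner[OF gF_square V_square[OF that]])
  have n_int: "integrable M n"
    unfolding n_def[abs_def] inner_scaleR_right inner_sum_right using vi
    by (intro integrable_mult_right Bochner_Integration.integrable_sum) auto
  have n0: "expectation n = 0"
    using vi noise_orthogonal by (simp add: n_def[abs_def] inner_sum_right)
  note [simp] = n_int F_integrable ap_integrable Cp_integrable Gp_integrable
  have "expectation (\<lambda>\<omega>. F (xbar (Suc t) \<omega>)) \<le> expectation (\<lambda>\<omega>. F (xbar t \<omega>) - 7 / 16 * h * ap t \<omega>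
    + h / 2 * L\<^sup>2 * Cp t \<omega> + (4 * h * \<theta>\<^sup>2 + L * (h * (1 + \<theta>))\<^sup>2) * Gp t \<omega> - h * n \<omega>)"
    by (intro integral_mono descent_pointwise[of _ t, folded n_def] Bochner_Integration.integrable_add
        Bochner_Integration.integrable_diff integrable_mult_right) simp_all
  also have "\<dots> = expectation (\<lambda>\<omega>. F (xbar t \<omega>))
    - 7 / 16 * h * expectation (ap t) + h / 2 * L\<^sup>2 * expectation (Cp t)
    + (4 * h * \<theta>\<^sup>2 + L * (h * (1 + \<theta>))\<^sup>2) * expectation (Gp t) - h * expectation n"
    by (simp only: Bochner_Integration.integral_add Bochner_Integration.integral_diff
        Bochner_Integration.integrable_add Bochner_Integration.integrable_diff
        integrable_mult_right integral_mult_right_zero n_int F_integrable ap_integrable Cp_integrable Gp_integrable)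
  finally show ?thesis using n0 by simp
qed

lemma stationarity:
  assumes L1: "L \<ge> 1" and lower: "\<And>x. F x \<ge> Fstar" and T: "T \<ge> 1"
    and eta_le: "eta \<le> (1 - sqrt rho) / (108 * L\<^sup>2 * real s ^ 3 * (beta\<^sup>2 + 1) * (1 + kap\<^sup>2 * L\<^sup>2))"
  shows "1 / real T * (\<Sum>t<T. expectation (ap t)) \<le> 6 * (F x0 - Fstar) / (h * real T)
      + 54 * h * L * (kap\<^sup>2 * L\<^sup>2 + 1 + 1 / (1 - sqrt rho)) * (sigma\<^sup>2 + zeta\<^sup>2)"
proof -
  let ?r = "1 - sqrt rho" and ?b = "beta\<^sup>2 + 1" and ?K = "1 + kap\<^sup>2 * L\<^sup>2"
  have posd: "108 * L\<^sup>2 * ?b * ?K > 0" using L1 by (intro mult_pos_pos add_nonneg_pos add_pos_nonneg) auto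
  have s1: "real s \<ge> 1" using s by simp
  hence pos: "108 * L\<^sup>2 * real s ^ 3 * ?b * ?K > 0"
    using L1 by (intro mult_pos_pos add_nonneg_pos add_pos_nonneg) auto
  \<comment> \<open>The spectral gap is forced by the hypotheses: a nonpositive bound would
    contradict \<open>eta > 0\<close>.\<close>
  have r: "?r > 0"
  proof (rule ccontr)
    assume "\<not> ?thesis"
    hence "?r / (108 * L\<^sup>2 * real s ^ 3 * ?b * ?K) \<le> 0" using pos by (intro divide_nonpos_pos) auto
    with eta_le eta_pos show False by linarith
  qed
  hence rho1: "rho < 1" by simp
  \<comment> \<open>One factor \<open>s\<close> turns \<open>eta\<close> into \<open>h\<close>; the
    cube in the step size condition covers it because \<open>s \<ge> 1\<close>.\<close>
  have "h * (108 * L\<^sup>2 * ?b * ?K) = (eta * (108 * L\<^sup>2 * ?b * ?K)) * real s" by (simp add: h_def)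
  also have "\<dots> \<le> (eta * (108 * L\<^sup>2 * ?b * ?K)) * real s ^ 3"
    using self_le_power[OF s1 zero_less_numeral] posd eta_pos by (intro mult_left_mono mult_nonneg_nonneg) auto
  also have "\<dots> = eta * (108 * L\<^sup>2 * real s ^ 3 * ?b * ?K)" by (simp add: mult_ac)
  also have "\<dots> \<le> ?r" using eta_le pos by (simp only: pos_le_divide_eq)
  finally have h_le: "h \<le> ?r / (108 * L\<^sup>2 * ?b * ?K)" using posd by (simp only: pos_le_divide_eq)
  have kap0: "kap \<ge> 0" using kappa_nonneg[of m eta Lc s] m0 eta_pos Lc(1) by (simp add: kap_def)
  have "1 / real T * (\<Sum>t<T. expectation (ap t)) \<le> 6 * (expectation (\<lambda>\<omega>. F (xbar 0 \<omega>)) - Fstar) / (h * real T)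
      + 54 * h * L * (kap\<^sup>2 * L\<^sup>2 + 1 + 1 / ?r) * (sigma\<^sup>2 + zeta\<^sup>2)"
  proof (rule stationarity_from_recursions[where b = "beta\<^sup>2 + 1" and \<theta> = \<theta> and C = "\<lambda>t. expectation (Cp t)"
        and G = "\<lambda>t. expectation (Gp t)" and \<Phi> = "\<lambda>t. expectation (\<lambda>\<omega>. F (xbar t \<omega>))"])
    show "expectation (Cp 0) = 0" by (simp add: Cp_def[abs_def] X_0 xbar_0)
    show "expectation (Cp (Suc t)) \<le> (1 - ?r) * expectation (Cp t) + (h * (1 + \<theta>))\<^sup>2 / ?r * expectation (Gp t)" for t
      using consensus_recursion[OF rho1, of t] by simp
    show "Fstar \<le> expectation (\<lambda>\<omega>. F (xbar t \<omega>))" for t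
      using integral_mono[of M "\<lambda>_. Fstar", OF _ F_integrable[of t] lower] by (simp add: prob_space)
    show "?r \<le> 1" using rho_nonneg by simp
  qed (use h_pos L1 r kap0 T h_le descent_expectation gradient_second_moment Cp_nonneg Gp_nonneg ap_nonneg
      in \<open>auto simp: \<theta>_def integral_nonneg mult_ac\<close>)
  thus ?thesis by (simp add: xbar_0 prob_space)
qed

end

section \<open>Convergence\<close>

text \<open>The left side uses nonnegative integrals, so the bound includes the finiteness of the
  expected squared gradients.\<close>

theorem theorem1:
  fixes M :: "'w measure" and S :: "'s measure"
    and m s T :: nat and eta c L sigma beta zeta Fstar :: real
    and x0 :: "'a::euclidean_space"
    and l :: "nat \<Rightarrow> 'a \<Rightarrow> 's \<Rightarrow> real" and gl :: "nat \<Rightarrow> 'a \<Rightarrow> 's \<Rightarrow> 'a"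
    and D :: "nat \<Rightarrow> 's measure"
    and Fi :: "nat \<Rightarrow> 'a \<Rightarrow> real" and gFi :: "nat \<Rightarrow> 'a \<Rightarrow> 'a"
    and Lc :: "nat \<Rightarrow> real"
    and xi :: "nat \<Rightarrow> nat \<Rightarrow> 'w \<Rightarrow> 's" and A :: "nat \<Rightarrow> 'w \<Rightarrow> nat set"
  defines "F \<equiv> (\<lambda>x. (1 / real m) * (\<Sum>i<m. Fi i x))"
    and "gF \<equiv> (\<lambda>x. (1 / real m) *\<^sub>R (\<Sum>i<m. gFi i x))"
    and "xc \<equiv> client_iter eta s gl xi A x0"
    and "xbar \<equiv> avg_iter m eta s gl xi A x0"
    and "Ft \<equiv> filt M S m xi A"
    and "rho \<equiv> rho_mix M m A"
    and "kap \<equiv> kappa m eta s Lc"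
  assumes M: "prob_space M"
    and m: "m \<ge> 2"
    and s: "s \<ge> 1"
    and eta_pos: "eta > 0"
    \<comment> \<open>losses, local objectives F_i(x) = E_{xi ~ D_i}[l_i(x; xi)] and gradients\<close>
    and D: "\<And>i. i < m \<Longrightarrow> prob_space (D i) \<and> sets (D i) = sets S"
    and l_int: "\<And>i x. i < m \<Longrightarrow> integrable (D i) (l i x)"
    and Fi_def: "\<And>i x. i < m \<Longrightarrow> Fi i x = (\<integral>z. l i x z \<partial>D i)"
    and gl_deriv: "\<And>i x z. i < m \<Longrightarrow> ((\<lambda>y. l i y z) has_derivative (\<lambda>h. gl i x z \<bullet> h)) (at x)"
    and gFi_deriv: "\<And>i x. i < m \<Longrightarrow> (Fi i has_derivative (\<lambda>h. gFi i x \<bullet> h)) (at x)"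
    \<comment> \<open>randomness: samples and active sets\<close>
    and xi_meas: "\<And>i t. i < m \<Longrightarrow> xi i t \<in> M \<rightarrow>\<^sub>M S"
    and xi_distr: "\<And>i t. i < m \<Longrightarrow> distr M S (xi i t) = D i"
    and A_meas: "\<And>t. A t \<in> M \<rightarrow>\<^sub>M count_space UNIV"
    and A_sub: "\<And>t \<omega>. \<omega> \<in> space M \<Longrightarrow> A t \<omega> \<subseteq> {..<m}"
    and A_indep: "\<And>t. prob_space.indep_set M (sets (filt_samples M S m xi A t))
                                               {A t -` B \<inter> space M | B. True}"
    and c: "0 < c" "c \<le> 1"
    and p_lb: "\<And>i t. i < m \<Longrightarrow> measure M {\<omega> \<in> space M. i \<in> A t \<omega>} \<ge> c"
    \<comment> \<open>(A1)\<close>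
    and A1: "\<And>i x y z. i < m \<Longrightarrow> norm (gl i x z - gl i y z) \<le> Lc i * norm (x - y)"
    and L_def: "L = Max (Lc ` {..<m})"
    \<comment> \<open>(A2)\<close>
    and A2_int: "\<And>i t. i < m \<Longrightarrow> integrable M (\<lambda>\<omega>. gl i (xc i t \<omega>) (xi i t \<omega>))"
    and A2_unbiased: "\<And>i t b. i < m \<Longrightarrow> b \<in> Basis \<Longrightarrow>
        AE \<omega> in M. real_cond_exp M (Ft t) (\<lambda>\<omega>. gl i (xc i t \<omega>) (xi i t \<omega>) \<bullet> b) \<omega>
                    = gFi i (xc i t \<omega>) \<bullet> b"
    and A2_var: "\<And>i t x. i < m \<Longrightarrow>
        AE \<omega> in M. nn_cond_exp M (Ft t) (\<lambda>\<omega>. ennreal ((norm (gl i x (xi i t \<omega>) - gFi i x))\<^sup>2)) \<omega>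
                    \<le> ennreal (sigma\<^sup>2)"
    \<comment> \<open>(A3)\<close>
    and A3: "\<And>x. F x \<ge> Fstar"
    \<comment> \<open>(A4)\<close>
    and A4: "beta \<ge> 0" "zeta \<ge> 0"
        "\<And>x. (1 / real m) * (\<Sum>i<m. (norm (gFi i x - gF x))\<^sup>2) \<le> beta\<^sup>2 * (norm (gF x))\<^sup>2 + zeta\<^sup>2"
    and L_ge: "L \<ge> 1"
    and eta_le: "eta \<le> (1 - sqrt rho) /
        (108 * L\<^sup>2 * real s ^ 3 * (beta\<^sup>2 + 1) * (1 + kap\<^sup>2 * L\<^sup>2))"
    and T: "T \<ge> 1"
  shows "ennreal (1 / real T) * (\<Sum>t<T. \<integral>\<^sup>+ \<omega>. ennreal ((norm (gF (xbar t \<omega>)))\<^sup>2) \<partial>M)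
         \<le> ennreal (6 * (F x0 - Fstar) / (eta * real s * real T)
              + 54 * eta * real s * L * (kap\<^sup>2 * L\<^sup>2 + 1 + 1 / (1 - sqrt rho)) * (sigma\<^sup>2 + zeta\<^sup>2))"
proof -
  interpret prob_space M by (rule M)
  have gl_meas: "gl i x \<in> borel_measurable S" if i: "i < m" for i x
  proof (rule gradient_measurable[OF _ gl_deriv[OF i]])
    have "l i y \<in> borel_measurable (D i)" for y using l_int[OF i] by (rule borel_measurable_integrable)
    thus "l i y \<in> borel_measurable S" for y using D[OF i] by (simp cong: measurable_cong_sets)
  qed
  have gFi_lip: "norm (gFi i x - gFi i y) \<le> Lc i * norm (x - y)" if i: "i < m" for i x y
    using D[OF i] by (intro lipschitz_gradient_integral[of "D i" "l i" "Fi i" "gl i" "gFi i"]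
        l_int[OF i] Fi_def[OF i] gl_deriv[OF i] gFi_deriv[OF i] A1[OF i]) auto
  have Lc0: "0 \<le> Lc i" if i: "i < m" for i
  proof -
    \<comment> \<open>A unit vector against the origin: there the Lipschitz bound is
      \<open>Lc i\<close> itself, which therefore dominates a norm.\<close>
    obtain b :: 'a where "b \<in> Basis" using nonempty_Basis by blast
    hence "norm (gl i b undefined - gl i 0 undefined) \<le> Lc i"
      using A1[OF i, of b undefined 0] by simp
    thus ?thesis using norm_ge_zero order_trans by blast
  qed
  have LcL: "Lc i \<le> L" if "i < m" for i unfolding L_def using that by (intro Max_ge) auto
  interpret sys: fedpbc_system M S m s eta L sigma beta zeta x0 gl Fi gFi Lc xi A
    by unfold_locales
      (fact m s eta_pos gl_meas A1 gFi_deriv gFi_lip Lc0 LcL xi_meas A_meas A_sub A_indep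
        A2_unbiased[unfolded xc_def Ft_def] A2_var[unfolded Ft_def] A4(3)[unfolded gF_def])+
  have F_eq: "F = sys.F" and gF_eq: "gF = sys.gF"
    by (auto simp: F_def gF_def sys.F_def sys.gF_def)
  have rho_eq: "rho = sys.rho" and kap_eq: "kap = sys.kap"
    by (simp_all add: rho_def sys.rho_def kap_def sys.kap_def)
  have ap: "(norm (gF (xbar t \<omega>)))\<^sup>2 = sys.ap t \<omega>" for t \<omega>
    by (simp add: gF_eq xbar_def sys.ap_def)
  have "(\<Sum>t<T. \<integral>\<^sup>+ \<omega>. ennreal ((norm (gF (xbar t \<omega>)))\<^sup>2) \<partial>M) = (\<Sum>t<T. ennreal (expectation (sys.ap t)))"
    unfolding ap using sys.ap_integrable sys.ap_nonneg by (intro sum.cong refl nn_integral_eq_integral) auto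
  also have "\<dots> = ennreal (\<Sum>t<T. expectation (sys.ap t))"
    using sys.ap_nonneg by (intro sum_ennreal integral_nonneg) auto
  finally have "ennreal (1 / real T) * (\<Sum>t<T. \<integral>\<^sup>+ \<omega>. ennreal ((norm (gF (xbar t \<omega>)))\<^sup>2) \<partial>M)
      = ennreal (1 / real T * (\<Sum>t<T. expectation (sys.ap t)))"
    using sys.ap_nonneg by (subst ennreal_mult) (auto intro!: sum_nonneg integral_nonneg)
  also have "\<dots> \<le> ennreal (6 * (F x0 - Fstar) / (eta * real s * real T)
      + 54 * eta * real s * L * (kap\<^sup>2 * L\<^sup>2 + 1 + 1 / (1 - sqrt rho)) * (sigma\<^sup>2 + zeta\<^sup>2))"
    using sys.stationarity[OF L_ge A3[unfolded F_eq] T eta_le[unfolded rho_eq kap_eq]]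
    unfolding F_eq rho_eq kap_eq sys.h_def by (intro ennreal_leI) (simp add: mult.assoc)
  finally show ?thesis .
qed

end
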